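(* Let $d\in\mathbb{N}$ and $1\le p<\infty$. Then there is a constant $C>0$ (independent of $m$) such that $$\varrho_m\big(S^{1/p}_{p,1}B([0,1]^d),L_p([0,1]^d)\big)\le C\,m^{-1/p}\,(\log^{d-1}m)^{\frac1p+1}$$ for all $m\in\mathbb{N}$ with $m\ge2$.
   Context: Notation: $\mathbb{N}=\{1,2,\dots\}$, $\mathbb{N}_0=\mathbb{N}\cup\{0\}$, $a_+=\max\{a,0\}$, $|x|_1=\sum_i|x_i|$; $\log^{d-1}m=(\log m)^{d-1}$. Function spaces. Let $\mathcal{F}$ be the Fourier transform on $\mathbb{R}^d$, $\mathcal{F}f(\xi)=(2\pi)^{-d/2}\int_{\mathbb{R}^d}f(x)e^{-i\xi\cdot x}dx$. Fix a system $\varphi=\{\varphi_n\}_{n=0}^\infty\subset C_0^\infty(\mathbb{R})$ with (i) $\operatorname{supp}\varphi_0\subset\{|x|\le 2\}$; (ii) $\operatorname{supp}\varphi_n\subset\{2^{n-1}\le|x|\le 2^{n+1}\}$ for $n\ge1$; (iii) for every $\ell\in\mathbb{N}_0$, $\sup_{x,n}2^{n\ell}|D^\ell\varphi_n(x)|<\infty$; (iv) $\sum_{n=0}^\infty\varphi_n(x)=1$ for all $x\in\mathbb{R}$. For $f\in L_1(\mathbb{R}^d)$ and $\ell\in\mathbb{N}_0^d$ put $f_\ell=\mathcal{F}^{-1}[\varphi_{\ell_1}(\xi_1)\cdots\varphi_{\ell_d}(\xi_d)\mathcal{F}f(\xi)]$. For $0<p,q\le\infty$ and $r>(1/p-1)_+$,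 $S^r_{p,q}B(\mathbb{R}^d)$ is the set of all $f\in L_1(\mathbb{R}^d)$ with $\|f|S^r_{p,q}B(\mathbb{R}^d)\|=\big(\sum_{j\in\mathbb{N}_0^d}2^{|j|_1rq}\|f_j\|_p^q\big)^{1/q}<\infty$ (usual modification for $q=\infty$). The space $S^r_{p,q}B([0,1]^d)$ consists of all $f\in L_1([0,1]^d)$ that are restrictions to $[0,1]^d$ of some $g\in S^r_{p,q}B(\mathbb{R}^d)$, with $\|f|S^r_{p,q}B([0,1]^d)\|$ the infimum of $\|g|S^r_{p,q}B(\mathbb{R}^d)\|$ over all such $g$. Elements of $S^{1/p}_{p,1}B([0,1]^d)$ are identified with their continuous representatives. Sampling widths. For a space $Y$ of continuous functions on $[0,1]^d$ with norm $\|\cdot|Y\|$, $$\varrho_m(Y,L_q([0,1]^d))=\inf_{\substack{X_m\subset[0,1]^d,\ |X_m|=m\\ \psi:\mathbb{C}^m\to L_q([0,1]^d)}}\ \sup_{\|f|Y\|\le1}\|f-\psi(f(X_m))\|_{L_q([0,1]^d)},$$ where $f(X_m)\in\mathbb{C}^m$ is the vector of values of $f$ at the points of $X_m$ and $\psi$ ranges over arbitrary (not necessarily linear) maps. *)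

theory Defs
  imports "HOL-Analysis.Analysis"
begin

subsection \<open>\<open>L\<^sub>p\<close> (quasi-)norms for finite exponents\<close>

(* x to the power a in [0, \<infinity>], for a > 0 only; infinity is mapped to infinity. *)
definition ennreal_rpow :: "ennreal \<Rightarrow> real \<Rightarrow> ennreal" where
  "ennreal_rpow x a = (if x = \<infinity> then \<infinity> else ennreal (enn2real x powr a))"

definition Lp_norm :: "real \<Rightarrow> 'a measure \<Rightarrow> ('a \<Rightarrow> complex) \<Rightarrow> ennreal" where
  "Lp_norm p M f = ennreal_rpow (\<integral>\<^sup>+x. ennreal (norm (f x) powr p) \<partial>M) (1 / p)"

(* Functions, not classes of functions; almost everywhere equality is written out where needed. *)
definition Lp_space :: "real \<Rightarrow> 'a measure \<Rightarrow> ('a \<Rightarrow> complex) set" where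
  "Lp_space p M = {f \<in> borel_measurable M. Lp_norm p M f < \<infinity>}"

subsection \<open>Smooth dyadic resolutions of unity on the real line\<close>

definition iter_deriv :: "nat \<Rightarrow> (real \<Rightarrow> complex) \<Rightarrow> real \<Rightarrow> complex" where
  "iter_deriv l g = ((\<lambda>h x. vector_derivative h (at x)) ^^ l) g"

definition smooth :: "(real \<Rightarrow> complex) \<Rightarrow> bool" where
  "smooth g \<longleftrightarrow> (\<forall>l x. iter_deriv l g differentiable at x)"

definition supp :: "(real \<Rightarrow> complex) \<Rightarrow> real set" where
  "supp g = closure {x. g x \<noteq> 0}"

(* Compactness of the supports of the phi n follows from the first two support conditions.
   The functions may be complex-valued, as all function spaces below are complex. *)
definition dyadic_resolution :: "(nat \<Rightarrow> real \<Rightarrow> complex) \<Rightarrow> bool" where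
  "dyadic_resolution \<phi> \<longleftrightarrow>
     (\<forall>n. smooth (\<phi> n)) \<and>
     supp (\<phi> 0) \<subseteq> {x. \<bar>x\<bar> \<le> 2} \<and>
     (\<forall>n\<ge>1. supp (\<phi> n) \<subseteq> {x. 2 ^ (n - 1) \<le> \<bar>x\<bar> \<and> \<bar>x\<bar> \<le> 2 ^ (n + 1)}) \<and>
     (\<forall>l. \<exists>B. \<forall>n x. 2 ^ (n * l) * norm (iter_deriv l (\<phi> n) x) \<le> B) \<and>
     (\<forall>x. (\<lambda>n. \<phi> n x) sums 1)"

subsection \<open>Fourier transform and dyadic blocks\<close>

definition fourier :: "(real ^ 'n \<Rightarrow> complex) \<Rightarrow> real ^ 'n \<Rightarrow> complex" where
  "fourier f \<xi> = complex_of_real ((2 * pi) powr (- real CARD('n) / 2)) *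
     (LINT x|lborel. f x * exp (- \<i> * complex_of_real (\<xi> \<bullet> x)))"

definition fourier_inv :: "(real ^ 'n \<Rightarrow> complex) \<Rightarrow> real ^ 'n \<Rightarrow> complex" where
  "fourier_inv g x = complex_of_real ((2 * pi) powr (- real CARD('n) / 2)) *
     (LINT \<xi>|lborel. g \<xi> * exp (\<i> * complex_of_real (\<xi> \<bullet> x)))"

(* For integrable f the Fourier transform of the block is continuous with compact support,
   so the integral defining the inverse transform converges absolutely. *)
definition fourier_block ::
  "(nat \<Rightarrow> real \<Rightarrow> complex) \<Rightarrow> (real ^ 'n \<Rightarrow> complex) \<Rightarrow> nat ^ 'n \<Rightarrow> real ^ 'n \<Rightarrow> complex" where
  "fourier_block \<phi> f l = fourier_inv (\<lambda>\<xi>. (\<Prod>i\<in>UNIV. \<phi> (l $ i) (\<xi> $ i)) * fourier f \<xi>)"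

subsection \<open>Besov spaces of dominating mixed smoothness\<close>

(* Meant for 0 < p, q < \<infinity> and r > max (1/p - 1) 0; the infinite exponents are not covered. *)
definition besov_norm ::
  "(nat \<Rightarrow> real \<Rightarrow> complex) \<Rightarrow> real \<Rightarrow> real \<Rightarrow> real \<Rightarrow> (real ^ 'n \<Rightarrow> complex) \<Rightarrow> ennreal" where
  "besov_norm \<phi> r p q f = ennreal_rpow
     (\<Sum>\<^sub>\<infinity>j\<in>UNIV. ennreal (2 powr (real (\<Sum>i\<in>UNIV. j $ i) * r * q)) *
        ennreal_rpow (Lp_norm p lborel (fourier_block \<phi> f j)) q) (1 / q)"

definition besov ::
  "(nat \<Rightarrow> real \<Rightarrow> complex) \<Rightarrow> real \<Rightarrow> real \<Rightarrow> real \<Rightarrow> (real ^ 'n \<Rightarrow> complex) set" where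
  "besov \<phi> r p q = {f. integrable lborel f \<and> besov_norm \<phi> r p q f < \<infinity>}"

abbreviation cube :: "(real ^ 'n) set" where
  "cube \<equiv> cbox 0 1"

abbreviation cube_measure :: "(real ^ 'n) measure" where
  "cube_measure \<equiv> restrict_space lborel cube"

(* Functions on the cube are functions on the whole space whose values off the cube are ignored. *)
definition besov_extensions ::
  "(nat \<Rightarrow> real \<Rightarrow> complex) \<Rightarrow> real \<Rightarrow> real \<Rightarrow> real \<Rightarrow> (real ^ 'n \<Rightarrow> complex) \<Rightarrow> (real ^ 'n \<Rightarrow> complex) set" where
  "besov_extensions \<phi> r p q f = {g \<in> besov \<phi> r p q. AE x in cube_measure. g x = f x}"

definition besov_cube ::
  "(nat \<Rightarrow> real \<Rightarrow> complex) \<Rightarrow> real \<Rightarrow> real \<Rightarrow> real \<Rightarrow> (real ^ 'n \<Rightarrow> complex) set" where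
  "besov_cube \<phi> r p q = {f. integrable cube_measure f \<and> besov_extensions \<phi> r p q f \<noteq> {}}"

definition besov_cube_norm ::
  "(nat \<Rightarrow> real \<Rightarrow> complex) \<Rightarrow> real \<Rightarrow> real \<Rightarrow> real \<Rightarrow> (real ^ 'n \<Rightarrow> complex) \<Rightarrow> ennreal" where
  "besov_cube_norm \<phi> r p q f = (INF g \<in> besov_extensions \<phi> r p q f. besov_norm \<phi> r p q g)"

(* The continuous representatives of the elements of the Besov space on the cube. *)
definition besov_cube_cont ::
  "(nat \<Rightarrow> real \<Rightarrow> complex) \<Rightarrow> real \<Rightarrow> real \<Rightarrow> real \<Rightarrow> (real ^ 'n \<Rightarrow> complex) set" where
  "besov_cube_cont \<phi> r p q = {f \<in> besov_cube \<phi> r p q. continuous_on cube f}"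

subsection \<open>Sampling widths\<close>

(* Y is a set of functions continuous on the cube and N its norm.  An m-point set is given by an
   enumeration xs, and complex m-vectors are lists of length m; psi is only constrained, and only
   applied, on such lists. *)
definition sampling_width ::
  "nat \<Rightarrow> (real ^ 'n \<Rightarrow> complex) set \<Rightarrow> ((real ^ 'n \<Rightarrow> complex) \<Rightarrow> ennreal) \<Rightarrow> real \<Rightarrow> ennreal" where
  "sampling_width m Y N q =
     (INF xs \<in> {xs. length xs = m \<and> distinct xs \<and> set xs \<subseteq> cube}.
      INF \<psi> \<in> {\<psi> :: complex list \<Rightarrow> real ^ 'n \<Rightarrow> complex.
                 \<forall>v. length v = m \<longrightarrow> \<psi> v \<in> Lp_space q cube_measure}.
      SUP f \<in> {f \<in> Y. N f \<le> 1}. Lp_norm q cube_measure (\<lambda>x. f x - \<psi> (map f xs) x))"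

end

theory Submission
  imports Defs "HOL-Probability.Probability" "HOL-Real_Asymp.Real_Asymp"
begin

text \<open>Smolyak's algorithm built from piecewise constant interpolation on dyadic grids attains the rate.
  Let \<open>D k\<close> be the tensor product of the differences of consecutive dyadic interpolation operators. A
  dyadic block \<open>g j\<close> of an extension is band-limited, hence reproduced by convolution with a
  dilated tensor kernel that is integrable and of bounded variation, so that \<open>D k (g j)\<close> is an integral
  operator with product kernel. The Schur test bounds its \<open>L_p\<close> norm by
  \<open>C 2^((|j| - |k|) / p) |g j|_p\<close>; bounded variation gives this bound both for \<open>k \<le> j\<close> and for
  \<open>k > j\<close>. Summation over \<open>j\<close> produces the Besov norm, and summation over the levels \<open>|k| \<ge> n\<close>
  omitted by the algorithm gives an error of order \<open>n^(d-1) 2^(-n/p)\<close> with about \<open>n^(d-1) 2^n\<close> nodes.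
  That the blocks sum to the function pointwise on the cube follows from the weak form of Fourier
  inversion, by convolution with Gaussians.\<close>

subsection \<open>Product integrals and convexity inequalities\<close>

text \<open>Smoothness 1/p is the limiting case for point evaluation, and this shapes the argument:
  the factor 2^(|j|/p) that sampling costs on block \<open>j\<close> is exactly the Besov weight, so
  nothing is left over and summability with q = 1 must do the rest. One univariate estimate serves
  all pairs of levels: the kernel of a difference has rows of mass O(1) and columns of mass
  O(2^(j-k)), and L_p lies between the two. Step functions suffice because 1/p never exceeds 1. An
  explicit kernel is used rather than one built from the resolution, because its mass and variation
  have elementary bounds. A second obstacle is that an extension agrees with the function only
  almost everywhere, while samples are taken on a null set; hence the block series, not the
  extension, is evaluated at the nodes. The exponent of the logarithm has two sources: with m about
  n^(d-1) 2^n nodes, 2^(-n/p) is about m^(-1/p) n^((d-1)/p), and the number of index vectors on a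
  level contributes a further n^(d-1).\<close>

lemma Basis_vec_real: "(Basis :: (real ^ 'n) set) = range (\<lambda>i. axis i 1)"
  by (auto simp: Basis_vec_def)

lemma inj_axis_one: "inj (\<lambda>i::'n::finite. axis i (1::real))"
  by (auto simp: inj_on_def axis_eq_axis)

lemma nn_integral_lborel_vec_prod:
  fixes f :: "'n::finite \<Rightarrow> real \<Rightarrow> ennreal"
  assumes "\<And>i. f i \<in> borel_measurable borel"
  shows "(\<integral>\<^sup>+x. (\<Prod>i\<in>UNIV. f i (x $ i)) \<partial>lborel) = (\<Prod>i\<in>UNIV. \<integral>\<^sup>+t. f i t \<partial>lborel)"
proof -
  \<comment> \<open>\<open>r\<close> inverts \<open>axis\<close>, so that products over
    \<open>Basis\<close> can be reindexed by the coordinate type.\<close>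
  define r where "r = the_inv (\<lambda>i::'n. axis i (1::real))"
  have r: "r (axis i 1) = i" for i
    unfolding r_def by (rule the_inv_f_f[OF inj_axis_one])
  have "(\<integral>\<^sup>+x. (\<Prod>b\<in>Basis. f (r b) (x \<bullet> b)) \<partial>(lborel :: (real ^ 'n) measure)) =
      (\<Prod>b\<in>(Basis :: (real ^ 'n) set). \<integral>\<^sup>+t. f (r b) t \<partial>lborel)"
    by (rule nn_integral_lborel_prod) (use assms in auto)
  then show ?thesis
    unfolding Basis_vec_real by (simp add: prod.reindex[OF inj_axis_one] r inner_axis)
qed

lemma
  fixes f :: "'n::finite \<Rightarrow> real \<Rightarrow> complex"
  assumes f: "\<And>i. integrable lborel (f i)"
  shows integrable_lborel_vec_prod: "integrable lborel (\<lambda>x::real ^ 'n. \<Prod>i\<in>UNIV. f i (x $ i))" (is ?thesis1)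
    and integral_lborel_vec_prod:
      "(LINT x|lborel. (\<Prod>i\<in>UNIV. f i ((x :: real ^ 'n) $ i))) = (\<Prod>i\<in>UNIV. LINT t|lborel. f i t)" (is ?thesis2)
proof -
  define r where "r = the_inv (\<lambda>i::'n. axis i (1::real))"
  have r: "r (axis i 1) = i" for i
    unfolding r_def by (rule the_inv_f_f[OF inj_axis_one])
  interpret product_sigma_finite "\<lambda>b::real ^ 'n. (lborel :: real measure)" by standard
  have [measurable]: "f i \<in> borel_measurable borel" for i
    using borel_measurable_integrable[OF f[of i]] by simp
  let ?T = "\<lambda>g. \<Sum>b\<in>Basis. g b *\<^sub>R (b :: real ^ 'n)"
  let ?P = "\<Pi>\<^sub>M b\<in>(Basis :: (real ^ 'n) set). (lborel :: real measure)"
  have T: "?T \<in> measurable ?P borel" by measurable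
  have eq: "(\<Prod>i\<in>UNIV. f i (?T g $ i)) = (\<Prod>b\<in>Basis. f (r b) (g b))" for g
  proof -
    have "?T g $ i = g (axis i 1)" for i
      using inner_sum_left_Basis[of "axis i 1" g]
      by (simp add: cart_eq_inner_axis)
    then show ?thesis unfolding Basis_vec_real by (simp add: prod.reindex[OF inj_axis_one] r)
  qed
  have m: "(\<lambda>x::real ^ 'n. \<Prod>i\<in>UNIV. f i (x $ i)) \<in> borel_measurable borel" by measurable
  show ?thesis1
    unfolding lborel_eq[where 'a="real^'n"]
    by (subst integrable_distr_eq[OF T m], unfold eq, rule product_integrable_prod) (auto intro: f)
  have "(LINT x|lborel. (\<Prod>i\<in>UNIV. f i ((x :: real ^ 'n) $ i))) =
      (LINT g|?P. (\<Prod>b\<in>Basis. f (r b) (g b)))"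
    unfolding lborel_eq[where 'a="real^'n"] by (subst integral_distr[OF T m], unfold eq) simp
  also have "\<dots> = (\<Prod>b\<in>(Basis :: (real ^ 'n) set). LINT t|lborel. f (r b) t)"
    by (rule product_integral_prod) (auto intro: f)
  finally show ?thesis2 
    unfolding Basis_vec_real by (simp add: prod.reindex[OF inj_axis_one] r)
qed

section \<open>Powers and L_p norms with values in [0, infinity]\<close>

lemma ennreal_rpow_ennreal [simp]: "0 \<le> x \<Longrightarrow> ennreal_rpow (ennreal x) a = ennreal (x powr a)"
  by (simp add: ennreal_rpow_def)

lemma ennreal_rpow_top [simp]: "ennreal_rpow top a = top"
  by (simp add: ennreal_rpow_def)

lemma ennreal_rpow_0 [simp]: "ennreal_rpow 0 a = 0"
  by (simp add: ennreal_rpow_def)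

lemma ennreal_rpow_1 [simp]: "ennreal_rpow x 1 = x"
  by (cases x) (auto simp: ennreal_rpow_def)

lemma ennreal_rpow_mono:
  assumes "x \<le> y" "0 \<le> a" shows "ennreal_rpow x a \<le> ennreal_rpow y a"
  using assms by (cases x; cases y) (auto simp: top_unique intro!: ennreal_leI powr_mono2)

lemma ennreal_rpow_rpow: "ennreal_rpow (ennreal_rpow x a) b = ennreal_rpow x (a * b)"
  by (cases x) (auto simp: powr_powr)

lemma ennreal_rpow_measurable [measurable (raw)]:
  assumes [measurable]: "f \<in> borel_measurable M"
  shows "(\<lambda>x. ennreal_rpow (f x) a) \<in> borel_measurable M"
  unfolding ennreal_rpow_def by measurable

text \<open>The tangent at \<open>m\<close> lies below the convex graph of \<open>t powr p\<close>.
  The inequality is arranged into nonnegative terms because it is used in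
  \<open>ennreal\<close>.\<close>

lemma Young_tangent:
  fixes t m p :: real
  assumes "1 \<le> p" "0 \<le> t" "0 \<le> m"
  shows "p * m powr (p - 1) * t \<le> t powr p + (p - 1) * m powr p"
proof (cases "p = 1")
  case True
  then show ?thesis using assms by (cases "m = 0") auto
next
  case False
  with assms have p: "1 < p" by auto
  have "t * m powr (p - 1) \<le> t powr p / p + (m powr (p - 1)) powr (p / (p - 1)) / (p / (p - 1))"
    by (rule Youngs_inequality) (use p assms in \<open>auto simp: field_simps\<close>)
  also have "(m powr (p - 1)) powr (p / (p - 1)) = m powr p"
    using p by (simp add: powr_powr)
  finally show ?thesis using p by (simp add: field_simps)
qed

text \<open>The tangent inequality is integrated against the weight, and then the point of tangency
  is chosen. The mass is only bounded by \<open>A\<close>, not normalized, because the weights are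
  moduli of kernels. Minkowski's inequality, the Nikolskii inequality and the Schur test all rest on
  this estimate.\<close>

lemma nn_integral_Jensen_powr:
  fixes w u :: "'a \<Rightarrow> ennreal"
  assumes [measurable]: "w \<in> borel_measurable M" "u \<in> borel_measurable M"
    and p: "1 \<le> p" and A: "0 < A" and w: "(\<integral>\<^sup>+x. w x \<partial>M) \<le> ennreal A"
  shows "ennreal_rpow (\<integral>\<^sup>+x. w x * u x \<partial>M) p
    \<le> ennreal (A powr (p - 1)) * (\<integral>\<^sup>+x. w x * ennreal_rpow (u x) p \<partial>M)"
proof (cases "\<integral>\<^sup>+x. w x * ennreal_rpow (u x) p \<partial>M")
  case top
  then show ?thesis using A by (simp add: ennreal_mult_top)
next
  case (real q)
  define I where "I = (\<integral>\<^sup>+x. w x * u x \<partial>M)"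
  have key: "ennreal (p * m powr (p - 1)) * I \<le> ennreal (q + (p - 1) * m powr p * A)" if m: "0 < m" for m
  proof -
    have "ennreal (p * m powr (p - 1)) * u x \<le> ennreal_rpow (u x) p + ennreal ((p - 1) * m powr p)" for x
      using Young_tangent[OF p, of _ m] p m
      by (cases "u x") (auto simp: ennreal_mult[symmetric] ennreal_plus[symmetric] simp del: ennreal_plus)
    then have "ennreal (p * m powr (p - 1)) * (w x * u x)
        \<le> w x * (ennreal_rpow (u x) p + ennreal ((p - 1) * m powr p))" for x
      by (metis mult.left_commute mult_left_mono zero_le)
    then have "(\<integral>\<^sup>+x. ennreal (p * m powr (p - 1)) * (w x * u x) \<partial>M)
        \<le> (\<integral>\<^sup>+x. w x * ennreal_rpow (u x) p + w x * ennreal ((p - 1) * m powr p) \<partial>M)"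
      by (intro nn_integral_mono) (simp add: distrib_left)
    also have "\<dots> = ennreal q + (\<integral>\<^sup>+x. w x \<partial>M) * ennreal ((p - 1) * m powr p)"
      using real by (subst nn_integral_add) (auto simp: nn_integral_multc)
    also have "\<dots> \<le> ennreal q + ennreal A * ennreal ((p - 1) * m powr p)"
      by (intro add_left_mono mult_right_mono w) auto
    also have "\<dots> = ennreal (q + (p - 1) * m powr p * A)"
      using A p real by (simp add: ennreal_mult[symmetric] mult_ac flip: ennreal_plus)
    finally show ?thesis by (simp add: I_def nn_integral_cmult)
  qed
  \<comment> \<open>Any fixed point of tangency bounds \<open>I\<close>, so that its value may enter
    the choice of the optimal one.\<close>
  have "I < \<infinity>"
    using key[of 1] p by (cases I) (auto simp: ennreal_mult_top top_unique)
  then obtain r where r: "I = ennreal r" "0 \<le> r" by (cases I) auto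
  show ?thesis
  proof (cases "r = 0")
    case True
    then show ?thesis using r p by (simp add: I_def[symmetric])
  next
    case False
    with r have r0: "0 < r" by simp
    have rA: "(r / A) powr (p - 1) * r = r powr p / A powr (p - 1)"
      using r0 A by (simp add: powr_divide powr_diff)
    have rA2: "(r / A) powr p * A = r powr p / A powr (p - 1)"
      using r0 A by (simp add: powr_divide powr_diff)
    \<comment> \<open>Tangency at \<open>r / A\<close>, the mean of \<open>u\<close> when the mass
      is \<open>A\<close>, is the optimal choice.\<close>
    have "p * ((r / A) powr (p - 1) * r) \<le> q + (p - 1) * ((r / A) powr p * A)"
      using key[of "r / A"] r0 A p real
      by (simp add: r ennreal_mult[symmetric] mult.assoc del: ennreal_plus)
    then have "r powr p \<le> A powr (p - 1) * q"
      unfolding rA rA2 using A by (simp add: field_simps)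
    then show ?thesis
      using real r by (simp add: I_def[symmetric] ennreal_mult[symmetric])
  qed
qed

lemma Lp_norm_le_iff:
  assumes "0 < p" "0 \<le> c"
  shows "Lp_norm p M f \<le> ennreal c \<longleftrightarrow> (\<integral>\<^sup>+x. ennreal (norm (f x) powr p) \<partial>M) \<le> ennreal (c powr p)"
proof -
  have "Lp_norm p M f \<le> ennreal c \<longleftrightarrow> ennreal_rpow (Lp_norm p M f) p \<le> ennreal_rpow (ennreal c) p"
    using assms ennreal_rpow_mono[of "Lp_norm p M f" "ennreal c" p]
      ennreal_rpow_mono[of "ennreal_rpow (Lp_norm p M f) p" "ennreal_rpow (ennreal c) p" "1 / p"]
    by (auto simp only: ennreal_rpow_rpow) auto
  then show ?thesis using assms by (simp add: Lp_norm_def ennreal_rpow_rpow)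
qed

text \<open>Minkowski's inequality by Jensen: writing the sum as \<open>b i\<close> times
  \<open>norm (u i x) / b i\<close> bounds its p-th power by \<open>S powr (p - 1)\<close> times the
  sum of \<open>b i powr (1 - p)\<close> times the p-th powers, and integration turns this into
  \<open>S powr p\<close>.\<close>

lemma Lp_norm_sum_le:
  fixes u :: "'i \<Rightarrow> 'a \<Rightarrow> complex"
  assumes I: "finite I" and meas: "\<And>i. i \<in> I \<Longrightarrow> u i \<in> borel_measurable M"
    and c: "\<And>i. i \<in> I \<Longrightarrow> 0 \<le> c i" and u: "\<And>i. i \<in> I \<Longrightarrow> Lp_norm p M (u i) \<le> ennreal (c i)"
    and p: "1 \<le> p"
  shows "Lp_norm p M (\<lambda>x. \<Sum>i\<in>I. u i x) \<le> ennreal (\<Sum>i\<in>I. c i)"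
proof (cases "I = {}")
  case True
  then show ?thesis using p by (simp add: Lp_norm_def)
next
  case False
  have pos: "Lp_norm p M (\<lambda>x. \<Sum>i\<in>I. u i x) \<le> ennreal (\<Sum>i\<in>I. b i)"
    if b: "\<And>i. i \<in> I \<Longrightarrow> 0 < b i" and ub: "\<And>i. i \<in> I \<Longrightarrow> Lp_norm p M (u i) \<le> ennreal (b i)" for b
  proof -
    define S where "S = (\<Sum>i\<in>I. b i)"
    have S: "0 < S" unfolding S_def using I False b by (intro sum_pos) auto
    have pt: "ennreal (norm (\<Sum>i\<in>I. u i x) powr p)
      \<le> ennreal (S powr (p - 1)) * (\<Sum>i\<in>I. ennreal (b i powr (1 - p)) * ennreal (norm (u i x) powr p))" for x
    proof -
      have "ennreal (norm (\<Sum>i\<in>I. u i x) powr p) \<le> ennreal ((\<Sum>i\<in>I. norm (u i x)) powr p)"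
        using p by (intro ennreal_leI powr_mono2 norm_sum) auto
      also have "\<dots> = ennreal_rpow (\<integral>\<^sup>+i. ennreal (b i) * ennreal (norm (u i x) / b i) \<partial>count_space I) p"
      proof -
        have "(\<Sum>i\<in>I. ennreal (b i) * ennreal (norm (u i x) / b i)) = (\<Sum>i\<in>I. ennreal (norm (u i x)))"
          using b by (intro sum.cong refl) (auto simp: ennreal_mult'[symmetric] less_imp_le dest: less_imp_neq[symmetric])
        then show ?thesis by (simp add: nn_integral_count_space_finite I sum_nonneg)
      qed
      also have "\<dots> \<le> ennreal (S powr (p - 1)) *
          (\<integral>\<^sup>+i. ennreal (b i) * ennreal_rpow (ennreal (norm (u i x) / b i)) p \<partial>count_space I)"
        using b by (intro nn_integral_Jensen_powr p S)
          (auto simp: nn_integral_count_space_finite I S_def less_imp_le sum_ennreal)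
      also have "(\<integral>\<^sup>+i. ennreal (b i) * ennreal_rpow (ennreal (norm (u i x) / b i)) p \<partial>count_space I)
          = (\<Sum>i\<in>I. ennreal (b i powr (1 - p)) * ennreal (norm (u i x) powr p))"
        unfolding nn_integral_count_space_finite[OF I]
        using b by (intro sum.cong refl)
          (auto simp: less_imp_le powr_divide powr_diff ennreal_mult'[symmetric])
      finally show ?thesis .
    qed
    have "(\<integral>\<^sup>+x. ennreal (norm (\<Sum>i\<in>I. u i x) powr p) \<partial>M) \<le>
      (\<integral>\<^sup>+x. ennreal (S powr (p - 1)) * (\<Sum>i\<in>I. ennreal (b i powr (1 - p)) * ennreal (norm (u i x) powr p)) \<partial>M)"
      by (intro nn_integral_mono pt)
    also have "\<dots> = ennreal (S powr (p - 1)) * (\<Sum>i\<in>I. ennreal (b i powr (1 - p)) * (\<integral>\<^sup>+x. ennreal (norm (u i x) powr p) \<partial>M))"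
      using meas by (simp add: nn_integral_cmult nn_integral_sum)
    also have "\<dots> \<le> ennreal (S powr (p - 1)) * (\<Sum>i\<in>I. ennreal (b i powr (1 - p)) * ennreal (b i powr p))"
      using ub b p by (intro mult_left_mono sum_mono) (auto simp: Lp_norm_le_iff less_imp_le)
    also have "(\<Sum>i\<in>I. ennreal (b i powr (1 - p)) * ennreal (b i powr p)) = ennreal S"
      unfolding S_def using b
      by (subst sum_ennreal[symmetric]) (auto simp: less_imp_le ennreal_mult'[symmetric] powr_add[symmetric])
    also have "ennreal (S powr (p - 1)) * ennreal S = ennreal (S powr p)"
      using S by (simp add: ennreal_mult'[symmetric] powr_diff)
    finally show ?thesis using S p by (simp add: Lp_norm_le_iff S_def)
  qed
  show ?thesis
  proof (rule ennreal_le_epsilon)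
    fix e :: real assume e: "0 < e"
    \<comment> \<open>The bounds \<open>c i\<close> may vanish, but the weights are divided by; each
      bound is raised by an equal share of \<open>e\<close>.\<close>
    define d where "d = e / card I"
    have d: "0 < d" using e I False by (simp add: d_def card_gt_0_iff)
    have "Lp_norm p M (\<lambda>x. \<Sum>i\<in>I. u i x) \<le> ennreal (\<Sum>i\<in>I. c i + d)"
    proof (rule pos)
      fix i assume i: "i \<in> I"
      show "0 < c i + d" using c[OF i] d by simp
      show "Lp_norm p M (u i) \<le> ennreal (c i + d)"
        by (rule order_trans[OF u[OF i]]) (use d in \<open>auto intro: ennreal_leI\<close>)
    qed
    also have "(\<Sum>i\<in>I. c i + d) = (\<Sum>i\<in>I. c i) + e"
      using I False by (simp add: sum.distrib d_def)
    finally show "Lp_norm p M (\<lambda>x. \<Sum>i\<in>I. u i x) \<le> ennreal (\<Sum>i\<in>I. c i) + ennreal e"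
      using e c by (simp add: sum_nonneg ennreal_plus)
  qed
qed

text \<open>Fatou's lemma: a uniform bound along a pointwise convergent sequence is enough. It
  reduces the infinite sums of the error estimate to finite partial sums.\<close>

lemma Lp_norm_lim_le:
  fixes u :: "nat \<Rightarrow> 'a \<Rightarrow> complex"
  assumes [measurable]: "\<And>n. u n \<in> borel_measurable M"
    and lim: "\<And>x. x \<in> space M \<Longrightarrow> (\<lambda>n. u n x) \<longlonglongrightarrow> v x"
    and u: "\<And>n. Lp_norm p M (u n) \<le> ennreal c" and p: "0 < p" and c: "0 \<le> c"
  shows "Lp_norm p M v \<le> ennreal c"
proof -
  have "(\<integral>\<^sup>+x. ennreal (norm (v x) powr p) \<partial>M) = (\<integral>\<^sup>+x. liminf (\<lambda>n. ennreal (norm (u n x) powr p)) \<partial>M)"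
  proof (intro nn_integral_cong)
    fix x assume "x \<in> space M"
    then have "(\<lambda>n. ennreal (norm (u n x) powr p)) \<longlonglongrightarrow> ennreal (norm (v x) powr p)"
      using p by (intro tendsto_ennrealI tendsto_powr' tendsto_norm lim tendsto_const) auto
    from lim_imp_Liminf[OF sequentially_bot this]
    show "ennreal (norm (v x) powr p) = liminf (\<lambda>n. ennreal (norm (u n x) powr p))" ..
  qed
  also have "\<dots> \<le> liminf (\<lambda>n. \<integral>\<^sup>+x. ennreal (norm (u n x) powr p) \<partial>M)"
    by (intro nn_integral_liminf) auto
  also have "\<dots> \<le> limsup (\<lambda>n. \<integral>\<^sup>+x. ennreal (norm (u n x) powr p) \<partial>M)"
    by (rule Liminf_le_Limsup) simp
  also have "\<dots> \<le> ennreal (c powr p)"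
    using u p c by (intro Limsup_bounded) (auto simp: Lp_norm_le_iff)
  finally show ?thesis using p c by (simp add: Lp_norm_le_iff)
qed

subsection \<open>A band-limited reproducing kernel\<close>

text \<open>The de la Vallee-Poussin kernel \<open>(cos 2u - cos 4u) / (2 pi u^2)\<close>: its Fourier transform is the
  trapezoid that equals 1 on \<open>[-2, 2]\<close> and vanishes off \<open>[-4, 4]\<close>.\<close>

definition kern :: "real \<Rightarrow> real" where
  "kern u = 3 / pi * (sinc (3 * u) * sinc u)"

text \<open>At 0 the quotient is 0 by the division convention while \<open>kern 0\<close> is
  \<open>3 / pi\<close>; the form with \<open>sinc\<close> is the continuous one.\<close>

lemma kern_eq: "u \<noteq> 0 \<Longrightarrow> kern u = (cos (2 * u) - cos (4 * u)) / (2 * pi * u\<^sup>2)"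
proof -
  assume "u \<noteq> 0"
  have "cos (2 * u) - cos (4 * u) = 2 * sin (3 * u) * sin u"
    using cos_diff_cos[of "2 * u" "4 * u"] by simp
  then show ?thesis using \<open>u \<noteq> 0\<close> by (simp add: kern_def power2_eq_square)
qed

lemma abs_sinc_le_1: "\<bar>sinc x\<bar> \<le> 1"
  using abs_sin_x_le_abs_x[of x] by (auto simp: divide_le_eq)

lemma abs_sinc_le: "\<bar>sinc x\<bar> \<le> 1 / \<bar>x\<bar>" if "x \<noteq> 0"
  using that by (auto simp: divide_right_mono)

lemma abs_kern_le_1: "\<bar>kern u\<bar> \<le> 1"
proof -
  have "\<bar>kern u\<bar> = 3 / pi * (\<bar>sinc (3 * u)\<bar> * \<bar>sinc u\<bar>)"
    by (simp only: kern_def abs_mult) simp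
  also have "\<dots> \<le> 3 / pi * (1 * 1)"
    by (intro mult_left_mono mult_mono abs_sinc_le_1) auto
  also have "\<dots> \<le> 1" using pi_gt3 by simp
  finally show ?thesis .
qed

lemma abs_kern_le_inverse_square: "u \<noteq> 0 \<Longrightarrow> \<bar>kern u\<bar> \<le> 1 / u\<^sup>2"
proof -
  assume u: "u \<noteq> 0"
  have "\<bar>kern u\<bar> = 3 / pi * (\<bar>sinc (3 * u)\<bar> * \<bar>sinc u\<bar>)"
    by (simp only: kern_def abs_mult) simp
  also have "\<dots> \<le> 3 / pi * ((1 / \<bar>3 * u\<bar>) * (1 / \<bar>u\<bar>))"
    using u by (intro mult_left_mono mult_mono abs_sinc_le) auto
  also have "\<dots> = 1 / pi * (1 / u\<^sup>2)" by (simp add: abs_mult power2_eq_square)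
  also have "\<dots> \<le> 1 * (1 / u\<^sup>2)" using pi_gt3 by (intro mult_right_mono) auto
  finally show ?thesis by simp
qed

text \<open>Merges the bounds near 0 and at infinity into a multiple of the derivative of
  \<open>arctan\<close>, whose integrability is read off from the limits of
  \<open>arctan\<close>.\<close>

lemma abs_kern_le: "\<bar>kern u\<bar> \<le> 2 * inverse (1 + u\<^sup>2)"
proof (cases "u\<^sup>2 \<le> 1")
  case True
  have "1 * (1 + u\<^sup>2) \<le> 2" using True by simp
  then have "1 \<le> 2 * inverse (1 + u\<^sup>2)"
    by (simp add: field_simps add_pos_nonneg)
  then show ?thesis using abs_kern_le_1[of u] by simp
next
  case False
  then have u: "u \<noteq> 0" by auto
  have "1 / u\<^sup>2 \<le> 2 * inverse (1 + u\<^sup>2)"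
    using False u by (simp add: field_simps add_pos_nonneg)
  then show ?thesis using abs_kern_le_inverse_square[OF u] by simp
qed

lemma continuous_on_kern: "continuous_on A kern"
  unfolding kern_def by (intro continuous_intros continuous_on_compose2[OF continuous_on_sinc[of UNIV]]) auto

lemma borel_measurable_kern [measurable]: "kern \<in> borel_measurable borel"
  by (intro borel_measurable_continuous_onI continuous_on_kern)

lemma integrable_inverse_1_plus_square: "integrable lborel (\<lambda>u::real. inverse (1 + u\<^sup>2))"
proof -
  have "set_integrable lborel (einterval (-\<infinity>) \<infinity>) (\<lambda>u::real. inverse (1 + u\<^sup>2))"
  proof (rule interval_integral_FTC_nonneg)
    show "(arctan has_real_derivative inverse (1 + x\<^sup>2)) (at x)" for x :: real
      by (rule DERIV_arctan)
    show "isCont (\<lambda>u::real. inverse (1 + u\<^sup>2)) x" for x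
      by (intro continuous_intros) (simp add: add_nonneg_eq_0_iff)
    show "((arctan \<circ> real_of_ereal) \<longlongrightarrow> - (pi / 2)) (at_right (-\<infinity>))"
      by (simp add: ereal_tendsto_simps1 tendsto_arctan_at_bot)
    show "((arctan \<circ> real_of_ereal) \<longlongrightarrow> (pi / 2)) (at_left \<infinity>)"
      by (simp add: ereal_tendsto_simps1 tendsto_arctan_at_top)
  qed auto
  then show ?thesis by (simp add: set_integrable_def)
qed

lemma integrable_kern: "integrable lborel kern"
  by (rule Bochner_Integration.integrable_bound[OF integrable_mult_right[OF integrable_inverse_1_plus_square, of 2]])
     (use abs_kern_le in \<open>auto simp: add_pos_nonneg\<close>)

section \<open>Variation of the kernel\<close>

lemma kern_derivative:
  assumes "u \<noteq> 0"
  shows "(kern has_real_derivative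
    3 / pi * (3 * ((cos (3 * u) * (3 * u) - sin (3 * u)) / (3 * u)\<^sup>2) * sinc u
            + sinc (3 * u) * ((cos u * u - sin u) / u\<^sup>2))) (at u)"
proof -
  have D: "(sinc has_real_derivative (cos x * x - sin x) / x\<^sup>2) (at x)" if "x \<noteq> 0" for x :: real
  proof (rule has_field_derivative_transform_within_open[where S = "- {0}" and f = "\<lambda>x. sin x / x"])
    show "((\<lambda>x. sin x / x) has_real_derivative (cos x * x - sin x) / x\<^sup>2) (at x)"
      using that by (auto intro!: derivative_eq_intros simp: power2_eq_square)
  qed (use that in auto)
  have D3: "((\<lambda>u. sinc (3 * u)) has_real_derivative (cos (3 * u) * (3 * u) - sin (3 * u)) / (3 * u)\<^sup>2 * 3) (at u)"
    by (rule DERIV_chain'[OF _ D]) (use assms in \<open>auto intro!: derivative_eq_intros\<close>)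
  show ?thesis
    unfolding kern_def
    by (rule derivative_eq_intros DERIV_mult[OF D3 D[OF assms]] refl)+ (simp add: mult_ac)
qed

text \<open>The function inside the modulus is odd with derivative \<open>- sin z * z\<close>, so
  the mean value theorem on \<open>[0, x]\<close> suffices. This bound serves near 0, the next one
  far from 0.\<close>

lemma abs_sinc_deriv_le_1: "\<bar>cos x * x - sin x\<bar> \<le> x\<^sup>2" for x :: real
proof -
  have nn: "\<bar>cos x * x - sin x\<bar> \<le> x\<^sup>2" if "0 \<le> x" for x :: real
  proof -
    have "\<exists>\<xi>. \<bar>cos x * x - sin x\<bar> \<le> x * x" 
    proof (cases "x = 0")
      case False
      with that have "0 < x" by simp
      have "\<exists>z>0. z < x \<and> (cos x * x - sin x) - (cos 0 * 0 - sin 0) = (x - 0) * (- sin z * z)"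
        by (rule MVT2[OF \<open>0 < x\<close>]) (auto intro!: derivative_eq_intros)
      then obtain z where z: "0 < z" "z < x" "cos x * x - sin x = x * (- sin z * z)" by auto
      have "\<bar>x * (- sin z * z)\<bar> = x * (\<bar>sin z\<bar> * z)" using z by (simp add: abs_mult)
      also have "\<dots> \<le> x * (1 * x)" using z by (intro mult_left_mono mult_mono) auto
      finally show ?thesis using z by simp
    qed auto
    then show ?thesis by (simp add: power2_eq_square)
  qed
  show ?thesis
    using nn[of x] nn[of "-x"] by (cases "0 \<le> x") (auto simp: abs_minus_commute)
qed

lemma abs_sinc_deriv_le_2: "\<bar>cos x * x - sin x\<bar> \<le> \<bar>x\<bar> + 1" for x :: real
proof -
  have "\<bar>cos x * x - sin x\<bar> \<le> \<bar>cos x\<bar> * \<bar>x\<bar> + \<bar>sin x\<bar>" by (simp add: abs_mult[symmetric])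
  also have "\<dots> \<le> 1 * \<bar>x\<bar> + 1" by (intro add_mono mult_right_mono) auto
  finally show ?thesis by simp
qed

text \<open>The majorant is a multiple of the derivative of \<open>arctan\<close>, so that variation
  can be measured by \<open>arctan\<close>. The constant 8 comes from the range of modulus at most
  1, where the derivative is bounded by 4.\<close>

lemma abs_kern_deriv_le:
  assumes "u \<noteq> 0" and D: "(kern has_real_derivative D) (at u)"
  shows "\<bar>D\<bar> \<le> 8 * inverse (1 + u\<^sup>2)"
proof -
  define A where "A = (cos (3 * u) * (3 * u) - sin (3 * u)) / (3 * u)\<^sup>2"
  define B where "B = (cos u * u - sin u) / u\<^sup>2"
  have "D = 3 / pi * (3 * A * sinc u + sinc (3 * u) * B)"
    unfolding A_def B_def by (rule DERIV_unique[OF D kern_derivative[OF assms(1)]])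
  then have "\<bar>D\<bar> = 3 / pi * \<bar>3 * A * sinc u + sinc (3 * u) * B\<bar>"
    by (simp only: abs_mult) simp
  also have "\<dots> \<le> 1 * \<bar>3 * A * sinc u + sinc (3 * u) * B\<bar>"
    by (intro mult_right_mono) (use pi_gt3 in auto)
  also have "\<dots> \<le> 3 * (\<bar>A\<bar> * \<bar>sinc u\<bar>) + \<bar>sinc (3 * u)\<bar> * \<bar>B\<bar>"
    using abs_triangle_ineq[of "3 * A * sinc u" "sinc (3 * u) * B"]
    by (simp only: abs_mult abs_numeral mult.assoc mult_1)
  finally have le: "\<bar>D\<bar> \<le> 3 * (\<bar>A\<bar> * \<bar>sinc u\<bar>) + \<bar>sinc (3 * u)\<bar> * \<bar>B\<bar>" .
  have A1: "\<bar>A\<bar> \<le> 1" and B1: "\<bar>B\<bar> \<le> 1"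
    using abs_sinc_deriv_le_1[of "3 * u"] abs_sinc_deriv_le_1[of u] assms(1)
    by (auto simp: A_def B_def divide_le_eq)
  show ?thesis
  proof (cases "\<bar>u\<bar> \<le> 1")
    case True
    then have u2: "u\<^sup>2 \<le> 1" by (simp add: abs_square_le_1)
    have "\<bar>D\<bar> \<le> 3 * (1 * 1) + 1 * 1"
      by (rule order_trans[OF le]) (intro add_mono mult_left_mono mult_mono A1 B1 abs_sinc_le_1; simp)
    also have "\<dots> \<le> 8 * inverse (1 + u\<^sup>2)" using u2 by (simp add: field_simps add_pos_nonneg)
    finally show ?thesis .
  next
    case False
    have A2: "\<bar>A\<bar> \<le> (\<bar>3 * u\<bar> + 1) / (3 * u)\<^sup>2" and B2: "\<bar>B\<bar> \<le> (\<bar>u\<bar> + 1) / u\<^sup>2"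
      using abs_sinc_deriv_le_2[of "3 * u"] abs_sinc_deriv_le_2[of u] assms(1)
      by (auto simp: A_def B_def intro: divide_right_mono)
    have v: "1 \<le> \<bar>u\<bar>" "u\<^sup>2 = \<bar>u\<bar> * \<bar>u\<bar>" using False by (auto simp: power2_eq_square)
    have "(\<bar>3 * u\<bar> + 1) / (3 * u)\<^sup>2 = (3 * \<bar>u\<bar> + 1) / (9 * \<bar>u\<bar> * \<bar>u\<bar>)"
      by (simp add: v(2) power_mult_distrib abs_mult mult.assoc)
    also have "\<dots> \<le> (4 * \<bar>u\<bar>) / (9 * \<bar>u\<bar> * \<bar>u\<bar>)"
      using v(1) by (intro divide_right_mono) auto
    also have "\<dots> = (4 / 9) / \<bar>u\<bar>" using assms(1) by simp
    finally have "(\<bar>3 * u\<bar> + 1) / (3 * u)\<^sup>2 \<le> (4 / 9) / \<bar>u\<bar>" .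
    with A2 have A3: "\<bar>A\<bar> \<le> (4 / 9) / \<bar>u\<bar>" by simp
    have "(\<bar>u\<bar> + 1) / u\<^sup>2 \<le> (2 * \<bar>u\<bar>) / (\<bar>u\<bar> * \<bar>u\<bar>)"
      unfolding v(2) using v(1) by (intro divide_right_mono) auto
    also have "\<dots> = 2 / \<bar>u\<bar>"
      by (rule mult_divide_mult_cancel_right) (use assms(1) in simp)
    finally have "(\<bar>u\<bar> + 1) / u\<^sup>2 \<le> 2 / \<bar>u\<bar>" .
    with B2 have B3: "\<bar>B\<bar> \<le> 2 / \<bar>u\<bar>" by simp
    have "\<bar>D\<bar> \<le> 3 * ((4 / 9) / \<bar>u\<bar> * (1 / \<bar>u\<bar>)) + (1 / \<bar>3 * u\<bar>) * (2 / \<bar>u\<bar>)"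
      using assms(1) by (intro order_trans[OF le] add_mono mult_left_mono mult_mono A3 B3 abs_sinc_le) auto
    also have "\<dots> = 2 / u\<^sup>2"
      using assms(1) by (simp add: v(2) abs_mult)
    also have "\<dots> \<le> 8 * inverse (1 + u\<^sup>2)"
    proof -
      have "1 \<le> u\<^sup>2" using False by (simp add: abs_square_le_1 less_imp_le flip: not_le)
      then have "2 * (1 + u\<^sup>2) \<le> 8 * u\<^sup>2" "0 < u\<^sup>2" "0 < 1 + u\<^sup>2" by auto
      then show ?thesis by (simp add: divide_le_eq pos_le_divide_eq inverse_eq_divide)
    qed
    finally show ?thesis .
  qed
qed

text \<open>\<open>8 * arctan\<close> plus or minus \<open>kern\<close> is nondecreasing. An
  increment of the monotone function \<open>arctan\<close> can later be enlarged to a larger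
  interval, which is impossible with an increment of \<open>kern\<close> itself.\<close>

lemma kern_variation:
  assumes "a \<le> b"
  shows "\<bar>kern b - kern a\<bar> \<le> 8 * (arctan b - arctan a)"
proof -
  have one: "\<bar>kern b - kern a\<bar> \<le> 8 * (arctan b - arctan a)"
    if ab: "a \<le> b" and z: "\<And>x. a < x \<Longrightarrow> x < b \<Longrightarrow> x \<noteq> 0" for a b
  proof -
    have mono: "8 * arctan a + s * kern a \<le> 8 * arctan b + s * kern b" if s: "s = 1 \<or> s = -1" for s
    proof (rule DERIV_nonneg_imp_increasing_open[OF ab])
      fix x assume x: "a < x" "x < b"
      note D = kern_derivative[OF z[OF x]]
      obtain d where d: "(kern has_real_derivative d) (at x)" using D by blast
      have "((\<lambda>x. 8 * arctan x + s * kern x) has_real_derivative 8 * inverse (1 + x\<^sup>2) + s * d) (at x)"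
        by (rule derivative_eq_intros d refl)+ simp
      moreover have "0 \<le> 8 * inverse (1 + x\<^sup>2) + s * d"
        using abs_kern_deriv_le[OF z[OF x] d] s by auto
      ultimately show "\<exists>y. ((\<lambda>x. 8 * arctan x + s * kern x) has_real_derivative y) (at x) \<and> 0 \<le> y" by blast
    next
      show "continuous_on {a..b} (\<lambda>x. 8 * arctan x + s * kern x)"
        by (intro continuous_intros continuous_on_kern)
    qed
    show ?thesis using mono[of 1] mono[of "-1"] by auto
  qed
  \<comment> \<open>The derivative formula excludes 0, so an interval around 0 is cut there.\<close>
  show ?thesis
  proof (cases "a < 0 \<and> 0 < b")
    case True
    then show ?thesis using one[of a 0] one[of 0 b] by fastforce
  next
    case False
    then show ?thesis using assms by (intro one) auto
  qed
qed

section \<open>Fourier transform of the kernel\<close>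

lemma has_bochner_integral_one_minus_cos:
  "has_bochner_integral lborel (\<lambda>u. (1 - cos (a * u)) / u\<^sup>2) (pi * \<bar>a\<bar>)"
proof -
  define F where "F = (\<lambda>u::real. (1 - cos u) / u\<^sup>2)"
  have [measurable]: "F \<in> borel_measurable borel" unfolding F_def by measurable
  have F_even: "F (- u) = F u" for u by (simp add: F_def)
  \<comment> \<open>The antiderivative on the positive axis comes from integration by parts; the
    boundary term vanishes at 0 and at infinity, so only the limit \<open>pi / 2\<close> of
    \<open>Si\<close> remains.\<close>
  have D: "((\<lambda>t. Si t - (1 - cos t) / t) has_real_derivative F x) (at x)" if "0 < x" for x
  proof -
    have "((\<lambda>t. (1 - cos t) / t) has_real_derivative (sin x * x - (1 - cos x)) / (x * x)) (at x)"
      using that by (auto intro!: derivative_eq_intros)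
    from DERIV_diff[OF DERIV_Si this] show ?thesis
      by (rule back_subst[where P = "\<lambda>d. (_ has_real_derivative d) (at x)"])
        (use that in \<open>simp add: F_def power2_eq_square diff_divide_distrib\<close>)
  qed
  have lim0: "((\<lambda>t. Si t - (1 - cos t) / t) \<longlongrightarrow> 0) (at_right 0)"
  proof -
    have "((\<lambda>t::real. (1 - cos t) / t) \<longlongrightarrow> 0) (at_right 0)" by real_asymp
    moreover have "(Si \<longlongrightarrow> Si 0) (at_right 0)"
      using isCont_Si[of 0] unfolding isCont_def by (simp add: filterlim_at_split)
    moreover have "Si 0 = 0" by (simp add: Si_def flip: zero_ereal_def)
    ultimately show ?thesis using tendsto_diff[of Si 0 "at_right 0" "\<lambda>t. (1 - cos t) / t" 0] by simp
  qed
  have limi: "((\<lambda>t. Si t - (1 - cos t) / t) \<longlongrightarrow> pi / 2) at_top"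
  proof -
    have "((\<lambda>t::real. (1 - cos t) / t) \<longlongrightarrow> 0) at_top" by real_asymp
    from tendsto_diff[OF Si_at_top this] show ?thesis by simp
  qed
  have FTC: "set_integrable lborel (einterval 0 \<infinity>) F" "(LBINT x=0..\<infinity>. F x) = pi / 2 - 0"
  proof -
    have A: "0 < (\<infinity>::ereal)" by simp
    have B: "\<And>x. 0 < ereal x \<Longrightarrow> ereal x < \<infinity> \<Longrightarrow>
        ((\<lambda>t. Si t - (1 - cos t) / t) has_real_derivative F x) (at x)"
      using D by simp
    have C: "\<And>x. 0 < ereal x \<Longrightarrow> ereal x < \<infinity> \<Longrightarrow> isCont F x"
      unfolding F_def by (intro continuous_intros) auto
    have E: "AE x in lborel. 0 < ereal x \<longrightarrow> ereal x < \<infinity> \<longrightarrow> 0 \<le> F x"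
      by (simp add: F_def)
    have G: "(((\<lambda>t. Si t - (1 - cos t) / t) \<circ> real_of_ereal) \<longlongrightarrow> 0) (at_right 0)"
      using lim0 by (simp add: zero_ereal_def ereal_tendsto_simps1)
    have H: "(((\<lambda>t. Si t - (1 - cos t) / t) \<circ> real_of_ereal) \<longlongrightarrow> pi / 2) (at_left \<infinity>)"
      using limi by (simp add: ereal_tendsto_simps1)
    show "set_integrable lborel (einterval 0 \<infinity>) F" "(LBINT x=0..\<infinity>. F x) = pi / 2 - 0"
      using interval_integral_FTC_nonneg[OF A B C E G H] by blast+
  qed
  have half: "has_bochner_integral lborel (\<lambda>x. indicator {0<..} x * F x) (pi / 2)"
    using FTC by (simp add: has_bochner_integral_iff set_integrable_def interval_lebesgue_integral_def
        set_lebesgue_integral_def zero_ereal_def)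
  then have "has_bochner_integral lborel (\<lambda>x. indicator {0<..} (0 + -1 * x) * F (0 + -1 * x)) (pi / 2 /\<^sub>R \<bar>-1\<bar>)"
    by (subst (asm) lborel_has_bochner_integral_real_affine_iff[where c = "-1" and t = 0]) auto
  then have half': "has_bochner_integral lborel (\<lambda>x. indicator {..<0} x * F x) (pi / 2)"
    by (simp add: F_even indicator_def)
  have "has_bochner_integral lborel (\<lambda>x. indicator {0<..} x * F x + indicator {..<0} x * F x) (pi / 2 + pi / 2)"
    by (rule has_bochner_integral_add[OF half half'])
  also have "(\<lambda>x. indicator {0<..} x * F x + indicator {..<0} x * F x) = F"
  proof
    show "indicator {0<..} x * F x + indicator {..<0} x * F x = F x" for x
      by (cases x "0::real" rule: linorder_cases) (auto simp: F_def)
  qed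
  finally have F: "has_bochner_integral lborel F pi" by simp
  show ?thesis
  proof (cases "a = 0")
    case False
    have "has_bochner_integral lborel (\<lambda>x. F (0 + a * x)) (pi /\<^sub>R \<bar>a\<bar>)"
      using F False
      by (subst (asm) lborel_has_bochner_integral_real_affine_iff[where c = a and t = 0]) auto
    then have "has_bochner_integral lborel (\<lambda>x. a\<^sup>2 * F (0 + a * x)) (a\<^sup>2 * (pi /\<^sub>R \<bar>a\<bar>))"
      by (intro has_bochner_integral_mult_right)
    also have "a\<^sup>2 * (pi /\<^sub>R \<bar>a\<bar>) = pi * \<bar>a\<bar>"
      using False by (cases "a > 0") (auto simp: power2_eq_square)
    also have "(\<lambda>x. a\<^sup>2 * F (0 + a * x)) = (\<lambda>u. (1 - cos (a * u)) / u\<^sup>2)"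
      using False by (auto simp: F_def power_mult_distrib)
    finally show ?thesis .
  qed auto
qed

text \<open>The product formula for cosines splits the integrand into four terms
  \<open>(1 - cos (a * u)) / u\<^sup>2\<close> with integrals \<open>pi * \<bar>a\<bar>\<close>. On
  the given range of \<xi> none of the four frequencies changes sign, and their signed sum is
  constant.\<close>

lemma integral_kern_cos:
  assumes "\<bar>\<xi>\<bar> \<le> 2"
  shows "(LINT u|lborel. kern u * cos (\<xi> * u)) = 1"
proof -
  have hb: "has_bochner_integral lborel
     (\<lambda>u. ((1 - cos ((4 - \<xi>) * u)) / u\<^sup>2 + (1 - cos ((4 + \<xi>) * u)) / u\<^sup>2
        - (1 - cos ((2 - \<xi>) * u)) / u\<^sup>2 - (1 - cos ((2 + \<xi>) * u)) / u\<^sup>2) / (4 * pi))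
     ((pi * \<bar>4 - \<xi>\<bar> + pi * \<bar>4 + \<xi>\<bar> - pi * \<bar>2 - \<xi>\<bar> - pi * \<bar>2 + \<xi>\<bar>) / (4 * pi))"
    by (intro has_bochner_integral_divide has_bochner_integral_diff has_bochner_integral_add
        has_bochner_integral_one_minus_cos)
  have "has_bochner_integral lborel
     (\<lambda>u. ((1 - cos ((4 - \<xi>) * u)) / u\<^sup>2 + (1 - cos ((4 + \<xi>) * u)) / u\<^sup>2
        - (1 - cos ((2 - \<xi>) * u)) / u\<^sup>2 - (1 - cos ((2 + \<xi>) * u)) / u\<^sup>2) / (4 * pi)) 1" (is "has_bochner_integral _ ?G 1")
  proof -
    have "\<bar>4 - \<xi>\<bar> = 4 - \<xi>" "\<bar>4 + \<xi>\<bar> = 4 + \<xi>" "\<bar>2 - \<xi>\<bar> = 2 - \<xi>" "\<bar>2 + \<xi>\<bar> = 2 + \<xi>"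
      using assms by auto
    then have "(pi * \<bar>4 - \<xi>\<bar> + pi * \<bar>4 + \<xi>\<bar> - pi * \<bar>2 - \<xi>\<bar> - pi * \<bar>2 + \<xi>\<bar>) / (4 * pi) = 1"
      by (simp add: field_simps)
    with hb show ?thesis by simp
  qed
  note hb1 = this
  have "(LINT u|lborel. kern u * cos (\<xi> * u)) = (LINT u|lborel. ?G u)"
  proof (rule integral_cong_AE)
    show "AE u in lborel. kern u * cos (\<xi> * u) = ?G u"
      using AE_lborel_singleton[of "0::real"]
    proof eventually_elim
      case (elim u)
      have "cos (2 * u) * cos (\<xi> * u) = (cos ((2 - \<xi>) * u) + cos ((2 + \<xi>) * u)) / 2"
        using cos_times_cos[of "2 * u" "\<xi> * u"] by (simp only: left_diff_distrib distrib_right)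
      moreover have "cos (4 * u) * cos (\<xi> * u) = (cos ((4 - \<xi>) * u) + cos ((4 + \<xi>) * u)) / 2"
        using cos_times_cos[of "4 * u" "\<xi> * u"] by (simp only: left_diff_distrib distrib_right)
      ultimately have eq: "(cos (2 * u) - cos (4 * u)) * cos (\<xi> * u) =
         (1 - cos ((4 - \<xi>) * u) + (1 - cos ((4 + \<xi>) * u)) - (1 - cos ((2 - \<xi>) * u)) - (1 - cos ((2 + \<xi>) * u))) / 2"
        by (simp add: left_diff_distrib)
      then have "kern u * cos (\<xi> * u) = (1 - cos ((4 - \<xi>) * u) + (1 - cos ((4 + \<xi>) * u)) - (1 - cos ((2 - \<xi>) * u)) - (1 - cos ((2 + \<xi>) * u))) / 2 / (2 * pi * u\<^sup>2)"
        by (simp only: kern_eq[OF elim] times_divide_eq_left eq)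
      also have "\<dots> = ?G u"
        by (simp only: diff_divide_distrib[symmetric] add_divide_distrib[symmetric] divide_divide_eq_left) (simp add: mult_ac)
      finally show ?case .
    qed
  qed measurable
  also note has_bochner_integral_integral_eq[OF hb1]
  finally show ?thesis .
qed

lemma kern_even [simp]: "kern (- u) = kern u"
  using sinc_neg[of "3 * u"] sinc_neg[of u] by (simp only: kern_def mult_minus_right)

lemma integral_kern_iexp:
  assumes "\<bar>\<xi>\<bar> \<le> 2"
  shows "(LINT u|lborel. complex_of_real (kern u) * exp (- \<i> * complex_of_real (\<xi> * u))) = 1"
proof -
  have ic: "integrable lborel (\<lambda>u. kern u * cos (\<xi> * u))"
    by (rule Bochner_Integration.integrable_bound[OF integrable_kern])
       (auto simp: abs_mult mult_left_le)
  have isn: "integrable lborel (\<lambda>u. kern u * sin (\<xi> * u))"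
    by (rule Bochner_Integration.integrable_bound[OF integrable_kern])
       (auto simp: abs_mult mult_left_le)
  have "(LINT u|lborel. kern u * sin (\<xi> * u)) = \<bar>-1\<bar> *\<^sub>R (LINT u|lborel. kern (0 + -1 * u) * sin (\<xi> * (0 + -1 * u)))"
    by (rule lborel_integral_real_affine) simp
  then have s0: "(LINT u|lborel. kern u * sin (\<xi> * u)) = 0" by simp
  have "(\<lambda>u. complex_of_real (kern u) * exp (- \<i> * complex_of_real (\<xi> * u))) =
     (\<lambda>u. complex_of_real (kern u * cos (\<xi> * u)) - \<i> * complex_of_real (kern u * sin (\<xi> * u)))"
  proof
    fix u
    have "exp (- \<i> * complex_of_real (\<xi> * u)) = cis (- (\<xi> * u))" by (simp add: cis_conv_exp)
    then show "complex_of_real (kern u) * exp (- \<i> * complex_of_real (\<xi> * u)) =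
       complex_of_real (kern u * cos (\<xi> * u)) - \<i> * complex_of_real (kern u * sin (\<xi> * u))"
      by (simp add: complex_eq_iff)
  qed
  then show ?thesis
    using ic isn s0 integral_kern_cos[OF assms] by (simp del: of_real_mult)
qed

subsection \<open>Fourier transforms and Gaussian convolutions\<close>

lemma integral_lborel_affine:
  fixes f :: "'a::euclidean_space \<Rightarrow> complex"
  assumes [measurable]: "f \<in> borel_measurable borel" and c: "c \<noteq> 0"
  shows "(LINT x|lborel. f x) = \<bar>c\<bar> ^ DIM('a) *\<^sub>R (LINT x|lborel. f (t + c *\<^sub>R x))"
  by (subst lborel_affine[OF c, of t]) (simp add: integral_density integral_distr)

lemma integrable_lborel_reflect:
  fixes f :: "'a::euclidean_space \<Rightarrow> complex"
  assumes "integrable lborel f"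
  shows "integrable lborel (\<lambda>y. f (x - y))"
proof -
  have [measurable]: "f \<in> borel_measurable borel"
    using borel_measurable_integrable[OF assms] by simp
  have "integrable (density (distr lborel borel (\<lambda>y. x + (-1) *\<^sub>R y)) (\<lambda>_. (\<bar>-1::real\<bar> ^ DIM('a)))) f"
    using assms by (subst (asm) lborel_affine[of "-1" x]) auto
  then show ?thesis
    by (subst (asm) integrable_density, simp, simp, simp, subst (asm) integrable_distr_eq) auto
qed

lemma integral_lborel_reflect:
  fixes f :: "'a::euclidean_space \<Rightarrow> complex"
  assumes "f \<in> borel_measurable borel"
  shows "(LINT y|lborel. f (x - y)) = (LINT y|lborel. f y)"
  using integral_lborel_affine[OF assms, of "-1" x] by simp

lemma nn_integral_lborel_reflect:
  fixes f :: "'a::euclidean_space \<Rightarrow> ennreal"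
  assumes [measurable]: "f \<in> borel_measurable borel"
  shows "(\<integral>\<^sup>+y. f (x - y) \<partial>lborel) = (\<integral>\<^sup>+y. f y \<partial>lborel)"
  by (subst (2) lborel_affine[of "-1" x]) (simp_all add: nn_integral_density nn_integral_distr)

lemma norm_iexp [simp]: "norm (exp (\<i> * complex_of_real a)) = 1" "norm (exp (- (\<i> * complex_of_real a))) = 1"
  by (simp_all add: norm_exp_eq_Re)

lemma fourier_measurable [measurable]:
  fixes f :: "real ^ 'n \<Rightarrow> complex"
  assumes "integrable lborel f"
  shows "fourier f \<in> borel_measurable borel"
proof -
  have [measurable]: "f \<in> borel_measurable borel"
    using borel_measurable_integrable[OF assms] by simp
  show ?thesis unfolding fourier_def[abs_def] by measurable
qed

lemma norm_fourier_le:
  fixes f :: "real ^ 'n \<Rightarrow> complex"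
  shows "norm (fourier f \<xi>) \<le> (2 * pi) powr (- real CARD('n) / 2) * (LINT x|lborel. norm (f x))"
proof -
  have "norm (LINT x|lborel. f x * exp (- \<i> * complex_of_real (\<xi> \<bullet> x))) \<le> (LINT x|lborel. norm (f x * exp (- \<i> * complex_of_real (\<xi> \<bullet> x))))"
    by (rule integral_norm_bound)
  also have "\<dots> = (LINT x|lborel. norm (f x))" by (simp add: norm_mult)
  finally show ?thesis unfolding fourier_def by (simp add: norm_mult mult_left_mono)
qed

lemma integrable_fourier_inv:
  assumes "integrable lborel (\<Psi> :: real ^ 'n \<Rightarrow> complex)"
  shows "integrable lborel (\<lambda>\<xi>. \<Psi> \<xi> * exp (\<i> * complex_of_real (\<xi> \<bullet> x)))"
proof -
  have [measurable]: "\<Psi> \<in> borel_measurable borel"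
    using borel_measurable_integrable[OF assms] by simp
  show ?thesis
    by (rule Bochner_Integration.integrable_bound[OF assms]) (auto simp: norm_mult)
qed

text \<open>Dominated convergence with both the function and the point allowed to move: a fixed
  function gives continuity, a fixed point gives the limit of the smoothed partial sums.\<close>

lemma fourier_inv_tendsto:
  fixes \<Psi> :: "nat \<Rightarrow> real ^ 'n \<Rightarrow> complex"
  assumes [measurable]: "\<And>m. \<Psi> m \<in> borel_measurable borel" "\<Psi>' \<in> borel_measurable borel"
    and w: "integrable lborel w" and le: "\<And>m \<xi>. norm (\<Psi> m \<xi>) \<le> w \<xi>"
    and lim: "\<And>\<xi>. (\<lambda>m. \<Psi> m \<xi>) \<longlonglongrightarrow> \<Psi>' \<xi>" and x: "x \<longlonglongrightarrow> x'"
  shows "(\<lambda>m. fourier_inv (\<Psi> m) (x m)) \<longlonglongrightarrow> fourier_inv \<Psi>' x'"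
  unfolding fourier_inv_def
  by (intro tendsto_mult tendsto_const integral_dominated_convergence[where w = w] w tendsto_exp tendsto_intros
      AE_I2 lim x) (auto simp: norm_mult le)

lemma continuous_on_fourier_inv:
  assumes "integrable lborel (\<Psi> :: real ^ 'n \<Rightarrow> complex)"
  shows "continuous_on A (fourier_inv \<Psi>)"
proof -
  have [measurable]: "\<Psi> \<in> borel_measurable borel"
    using borel_measurable_integrable[OF assms] by simp
  have "isCont (fourier_inv \<Psi>) x" for x
    unfolding continuous_at_sequentially comp_def
    by (intro allI impI fourier_inv_tendsto[where w = "\<lambda>\<xi>. norm (\<Psi> \<xi>)"]) (use assms in auto)
  then show ?thesis by (simp add: continuous_at_imp_continuous_on)
qed

lemma fourier_inv_measurable [measurable]:
  assumes "integrable lborel (\<Psi> :: real ^ 'n \<Rightarrow> complex)"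
  shows "fourier_inv \<Psi> \<in> borel_measurable borel"
  by (intro borel_measurable_continuous_onI continuous_on_fourier_inv assms)

lemma fourier_inv_sum:
  assumes "finite J" "\<And>j. j \<in> J \<Longrightarrow> integrable lborel (\<Psi> j :: real ^ 'n \<Rightarrow> complex)"
  shows "fourier_inv (\<lambda>\<xi>. \<Sum>j\<in>J. \<Psi> j \<xi>) x = (\<Sum>j\<in>J. fourier_inv (\<Psi> j) x)"
  unfolding fourier_inv_def using assms
  by (simp add: sum_distrib_right sum_distrib_left Bochner_Integration.integral_sum integrable_fourier_inv)

text \<open>The integrability needed for exchanging integrals; \<open>h\<close> stands for an
  exponential of modulus 1.\<close>

lemma integrable_lborel_pair_mult:
  fixes f :: "'a::euclidean_space \<Rightarrow> complex" and g :: "'b::euclidean_space \<Rightarrow> complex"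
  assumes f: "integrable lborel f" and g: "integrable lborel g"
    and [measurable]: "h \<in> borel_measurable (lborel \<Otimes>\<^sub>M lborel)" and h: "\<And>z. norm (h z) = 1"
  shows "integrable (lborel \<Otimes>\<^sub>M lborel) (\<lambda>(x, y). f x * g y * h (x, y))"
proof (rule lborel_pair.Fubini_integrable)
  have [measurable]: "f \<in> borel_measurable borel" "g \<in> borel_measurable borel"
    using borel_measurable_integrable[OF f] borel_measurable_integrable[OF g] by simp_all
  show "(\<lambda>(x, y). f x * g y * h (x, y)) \<in> borel_measurable (lborel \<Otimes>\<^sub>M lborel)" by measurable
  have "(\<lambda>x. LINT y|lborel. norm (case (x, y) of (x, y) \<Rightarrow> f x * g y * h (x, y)))
      = (\<lambda>x. norm (f x) * (LINT y|lborel. norm (g y)))"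
    by (simp add: norm_mult h)
  then show "integrable lborel (\<lambda>x. LINT y|lborel. norm (case (x, y) of (x, y) \<Rightarrow> f x * g y * h (x, y)))"
    using f by simp
  have "integrable lborel (\<lambda>y. f x * g y * h (x, y))" for x
    by (rule Bochner_Integration.integrable_bound[where f = "\<lambda>y. f x * g y"])
      (use g in \<open>auto simp: norm_mult h\<close>)
  then show "AE x in lborel. integrable lborel (\<lambda>y. case (x, y) of (x, y) \<Rightarrow> f x * g y * h (x, y))" by simp
qed

text \<open>Fubini followed by the substitution \<open>y = x - u\<close>. The transform of \<kappa>
  carries no power of \<open>2 * pi\<close>, so none appears in the formula. It is applied to the
  reproducing kernel and to Gaussians.\<close>

lemma convolution_fourier_inv:
  fixes \<Psi> \<kappa> :: "real ^ 'n \<Rightarrow> complex"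
  assumes \<Psi>: "integrable lborel \<Psi>" and \<kappa>: "integrable lborel \<kappa>"
  shows "(LINT y|lborel. fourier_inv \<Psi> y * \<kappa> (x - y)) =
    fourier_inv (\<lambda>\<xi>. \<Psi> \<xi> * (LINT u|lborel. \<kappa> u * exp (- \<i> * complex_of_real (\<xi> \<bullet> u)))) x"
proof -
  have [measurable]: "\<Psi> \<in> borel_measurable borel" "\<kappa> \<in> borel_measurable borel"
    using borel_measurable_integrable[OF \<Psi>] borel_measurable_integrable[OF \<kappa>] by simp_all
  define c where "c = complex_of_real ((2 * pi) powr (- real CARD('n) / 2))"
  have "fourier_inv \<Psi> y * \<kappa> (x - y) =
      c * (LINT \<xi>|lborel. \<Psi> \<xi> * \<kappa> (x - y) * exp (\<i> * complex_of_real (\<xi> \<bullet> y)))" for y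
    unfolding fourier_inv_def c_def[symmetric]
    by (simp only: mult.assoc integral_mult_left_zero[symmetric]) (simp only: mult_ac)
  then have "(LINT y|lborel. fourier_inv \<Psi> y * \<kappa> (x - y)) =
      c * (LINT y|lborel. LINT \<xi>|lborel. \<Psi> \<xi> * \<kappa> (x - y) * exp (\<i> * complex_of_real (\<xi> \<bullet> y)))"
    by (simp del: integral_mult_left_zero)
  also have "(LINT y|lborel. LINT \<xi>|lborel. \<Psi> \<xi> * \<kappa> (x - y) * exp (\<i> * complex_of_real (\<xi> \<bullet> y)))
      = (LINT \<xi>|lborel. LINT y|lborel. \<Psi> \<xi> * \<kappa> (x - y) * exp (\<i> * complex_of_real (\<xi> \<bullet> y)))"
  proof (rule lborel_pair.Fubini_integral)
    show "integrable (lborel \<Otimes>\<^sub>M lborel) (\<lambda>(\<xi>, y). \<Psi> \<xi> * \<kappa> (x - y) * exp (\<i> * complex_of_real (\<xi> \<bullet> y)))"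
      using integrable_lborel_pair_mult[OF \<Psi> integrable_lborel_reflect[OF \<kappa>, of x],
          where h = "\<lambda>(\<xi>, y). exp (\<i> * complex_of_real (\<xi> \<bullet> y))"]
      by (simp add: split_beta')
  qed
  also have "\<dots> = (LINT \<xi>|lborel. (\<Psi> \<xi> * (LINT u|lborel. \<kappa> u * exp (- \<i> * complex_of_real (\<xi> \<bullet> u)))) * exp (\<i> * complex_of_real (\<xi> \<bullet> x)))"
  proof (intro Bochner_Integration.integral_cong refl)
    fix \<xi>
    have "(LINT y|lborel. \<Psi> \<xi> * \<kappa> (x - y) * exp (\<i> * complex_of_real (\<xi> \<bullet> y))) =
      (LINT y|lborel. (\<lambda>u. \<Psi> \<xi> * \<kappa> u * exp (\<i> * complex_of_real (\<xi> \<bullet> (x - u)))) (x - y))"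
      by simp
    also have "\<dots> = (LINT u|lborel. \<Psi> \<xi> * \<kappa> u * exp (\<i> * complex_of_real (\<xi> \<bullet> (x - u))))"
      by (rule integral_lborel_reflect) measurable
    also have "\<dots> = (LINT u|lborel. \<Psi> \<xi> * exp (\<i> * complex_of_real (\<xi> \<bullet> x)) * (\<kappa> u * exp (- \<i> * complex_of_real (\<xi> \<bullet> u))))"
      by (simp add: inner_diff_right right_diff_distrib exp_diff exp_minus field_simps)
    also have "\<dots> = \<Psi> \<xi> * exp (\<i> * complex_of_real (\<xi> \<bullet> x)) * (LINT u|lborel. \<kappa> u * exp (- \<i> * complex_of_real (\<xi> \<bullet> u)))"
      by simp
    finally show "(LINT y|lborel. \<Psi> \<xi> * \<kappa> (x - y) * exp (\<i> * complex_of_real (\<xi> \<bullet> y))) =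
      (\<Psi> \<xi> * (LINT u|lborel. \<kappa> u * exp (- \<i> * complex_of_real (\<xi> \<bullet> u)))) * exp (\<i> * complex_of_real (\<xi> \<bullet> x))"
      by (simp add: mult_ac)
  qed
  finally show ?thesis by (simp add: fourier_inv_def c_def)
qed

text \<open>The exponential of an inner product is a product over the coordinates. The sign
  \<open>s\<close> covers the forward and the inverse transform.\<close>

lemma tensor_transform:
  fixes k :: "'n::finite \<Rightarrow> real \<Rightarrow> real" and \<xi> :: "real ^ 'n"
  assumes k: "\<And>i. integrable lborel (k i)" and s: "s = 1 \<or> s = -1"
  shows "(LINT u|lborel. complex_of_real (\<Prod>i\<in>UNIV. k i (u $ i)) * exp (s * \<i> * complex_of_real (\<xi> \<bullet> u))) =
    (\<Prod>i\<in>UNIV. LINT t|lborel. complex_of_real (k i t) * exp (s * \<i> * complex_of_real (\<xi> $ i * t)))"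
proof -
  have eq: "complex_of_real (\<Prod>i\<in>UNIV. k i (u $ i)) * exp (s * \<i> * complex_of_real (\<xi> \<bullet> u)) =
     (\<Prod>i\<in>UNIV. complex_of_real (k i (u $ i)) * exp (s * \<i> * complex_of_real (\<xi> $ i * u $ i)))" for u
    by (simp add: prod.distrib inner_vec_def sum_distrib_left exp_sum)
  have int: "integrable lborel (\<lambda>t. complex_of_real (k i t) * exp (s * \<i> * complex_of_real (\<xi> $ i * t)))" for i
  proof (rule Bochner_Integration.integrable_bound[OF k[of i]])
    have [measurable]: "k i \<in> borel_measurable borel"
      using borel_measurable_integrable[OF k[of i]] by simp
    show "(\<lambda>t. complex_of_real (k i t) * exp (s * \<i> * complex_of_real (\<xi> $ i * t))) \<in> borel_measurable lborel" by measurable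
  qed (use s in \<open>auto simp: norm_mult simp del: of_real_mult\<close>)
  show ?thesis unfolding eq by (rule integral_lborel_vec_prod[OF int])
qed

section \<open>Gaussians as approximate identities\<close>

definition gauss :: "real \<Rightarrow> real ^ 'n \<Rightarrow> real" where
  "gauss \<epsilon> u = (\<Prod>i\<in>UNIV. normal_density 0 \<epsilon> (u $ i))"

definition gauss_hat :: "real \<Rightarrow> real ^ 'n \<Rightarrow> real" where
  "gauss_hat \<epsilon> \<xi> = (\<Prod>i\<in>UNIV. exp (- (\<epsilon>\<^sup>2 * (\<xi> $ i)\<^sup>2) / 2))"

lemma gauss_measurable [measurable]: "gauss \<epsilon> \<in> borel_measurable borel"
  unfolding gauss_def[abs_def] by measurable

lemma gauss_hat_measurable [measurable]: "gauss_hat \<epsilon> \<in> borel_measurable borel"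
  unfolding gauss_hat_def[abs_def] by measurable

lemma gauss_nonneg [simp]: "0 \<le> gauss \<epsilon> u"
  by (simp add: gauss_def prod_nonneg)

lemma gauss_hat_bounds: "0 \<le> gauss_hat \<epsilon> \<xi>" "gauss_hat \<epsilon> \<xi> \<le> 1"
  by (auto simp: gauss_hat_def prod_nonneg intro!: prod_le_1)

text \<open>Obtained by rescaling the characteristic function of the standard normal
  distribution.\<close>

lemma normal_density_transform:
  assumes "0 < \<epsilon>"
  shows "(LINT t|lborel. complex_of_real (normal_density 0 \<epsilon> t) * exp (\<i> * complex_of_real (s * t)))
    = complex_of_real (exp (- (\<epsilon>\<^sup>2 * s\<^sup>2) / 2))"
proof -
  have std: "(LINT t|lborel. complex_of_real (std_normal_density t) * exp (\<i> * complex_of_real (a * t))) = complex_of_real (exp (- a\<^sup>2 / 2))" for a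
  proof -
    have "char std_normal_distribution a = (LINT t|lborel. std_normal_density t *\<^sub>R exp (\<i> * complex_of_real (a * t)))"
      unfolding char_def by (subst integral_density) auto
    then show ?thesis by (simp add: char_std_normal_distribution scaleR_conv_of_real)
  qed
  have sc: "normal_density 0 \<epsilon> (\<epsilon> * t) = std_normal_density t / \<epsilon>" for t
    using assms by (simp add: normal_density_def real_sqrt_mult power_mult_distrib field_simps)
  have "(LINT t|lborel. complex_of_real (normal_density 0 \<epsilon> t) * exp (\<i> * complex_of_real (s * t))) =
     \<bar>\<epsilon>\<bar> *\<^sub>R (LINT t|lborel. complex_of_real (normal_density 0 \<epsilon> (0 + \<epsilon> * t)) * exp (\<i> * complex_of_real (s * (0 + \<epsilon> * t))))"
    using assms by (intro lborel_integral_real_affine) auto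
  also have "\<dots> = \<epsilon> *\<^sub>R (LINT t|lborel. complex_of_real (1 / \<epsilon>) * (complex_of_real (std_normal_density t) * exp (\<i> * complex_of_real ((s * \<epsilon>) * t))))"
    using assms by (simp add: sc mult.assoc)
  also have "\<dots> = \<epsilon> *\<^sub>R (complex_of_real (1 / \<epsilon>) * complex_of_real (exp (- (s * \<epsilon>)\<^sup>2 / 2)))"
    by (simp only: integral_mult_right_zero std)
  finally show ?thesis using assms by (simp add: scaleR_conv_of_real power_mult_distrib mult_ac)
qed

lemma integrable_gauss: "integrable lborel (\<lambda>u. complex_of_real (gauss \<epsilon> (u :: real ^ 'n)))"
  if "0 < \<epsilon>"
  unfolding gauss_def of_real_prod using that by (intro integrable_lborel_vec_prod) simp

lemma integral_gauss: "(LINT u|lborel. complex_of_real (gauss \<epsilon> (u :: real ^ 'n))) = 1"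
  if "0 < \<epsilon>"
  unfolding gauss_def of_real_prod using that by (subst integral_lborel_vec_prod) simp_all

lemma gauss_transform:
  assumes "0 < \<epsilon>"
  shows "(LINT u|lborel. complex_of_real (gauss \<epsilon> u) * exp (- \<i> * complex_of_real (\<xi> \<bullet> u))) =
    complex_of_real (gauss_hat \<epsilon> (\<xi> :: real ^ 'n))"
proof -
  have "(LINT t|lborel. complex_of_real (normal_density 0 \<epsilon> t) * exp (-1 * \<i> * complex_of_real (\<xi> $ i * t))) =
    complex_of_real (exp (- (\<epsilon>\<^sup>2 * (\<xi> $ i)\<^sup>2) / 2))" for i
    using normal_density_transform[OF assms, of "- (\<xi> $ i)"] by simp
  then show ?thesis
    using tensor_transform[of "\<lambda>_. normal_density 0 \<epsilon>" "-1" \<xi>] assms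
    by (simp add: gauss_def gauss_hat_def)
qed

text \<open>Up to a factor the transform is again a normal density, of deviation
  \<open>1 / \<epsilon>\<close>, so integrability and the second transform follow from facts on
  normal densities.\<close>

lemma integrable_exp_square: "integrable lborel (\<lambda>t. exp (- (\<epsilon>\<^sup>2 * t\<^sup>2) / 2) :: real)"
  and exp_square_eq: "exp (- (\<epsilon>\<^sup>2 * t\<^sup>2) / 2) = sqrt (2 * pi) / \<epsilon> * normal_density 0 (1 / \<epsilon>) t"
  if "0 < \<epsilon>"
proof -
  have eq: "exp (- (\<epsilon>\<^sup>2 * t\<^sup>2) / 2) = sqrt (2 * pi) / \<epsilon> * normal_density 0 (1 / \<epsilon>) t" for t
    using that by (simp add: normal_density_def real_sqrt_divide power_divide field_simps)
  show "exp (- (\<epsilon>\<^sup>2 * t\<^sup>2) / 2) = sqrt (2 * pi) / \<epsilon> * normal_density 0 (1 / \<epsilon>) t" by (rule eq)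
  show "integrable lborel (\<lambda>t. exp (- (\<epsilon>\<^sup>2 * t\<^sup>2) / 2) :: real)"
    unfolding eq using that by (intro integrable_mult_right) simp
qed

lemma integrable_gauss_hat:
  "0 < \<epsilon> \<Longrightarrow> integrable lborel (\<lambda>\<xi>. complex_of_real (gauss_hat \<epsilon> (\<xi> :: real ^ 'n)))"
  unfolding gauss_hat_def of_real_prod
  by (intro integrable_lborel_vec_prod) (use integrable_exp_square in auto)

lemma gauss_hat_transform:
  assumes "0 < \<epsilon>"
  shows "(LINT \<xi>|lborel. complex_of_real (gauss_hat \<epsilon> \<xi>) * exp (\<i> * complex_of_real ((u :: real ^ 'n) \<bullet> \<xi>))) =
    complex_of_real ((2 * pi) ^ CARD('n) * gauss \<epsilon> u)"
proof -
  have "(LINT t|lborel. complex_of_real (exp (- (\<epsilon>\<^sup>2 * t\<^sup>2) / 2)) * exp (1 * \<i> * complex_of_real (s * t))) =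
    complex_of_real (2 * pi * normal_density 0 \<epsilon> s)" for s
  proof -
    have "(LINT t|lborel. complex_of_real (exp (- (\<epsilon>\<^sup>2 * t\<^sup>2) / 2)) * exp (1 * \<i> * complex_of_real (s * t))) =
      (LINT t|lborel. complex_of_real (sqrt (2 * pi) / \<epsilon>) * (complex_of_real (normal_density 0 (1 / \<epsilon>) t) * exp (\<i> * complex_of_real (s * t))))"
      unfolding exp_square_eq[OF assms] by (simp only: of_real_mult mult_1 mult.assoc)
    also have "\<dots> = complex_of_real (sqrt (2 * pi) / \<epsilon>) * complex_of_real (exp (- ((1 / \<epsilon>)\<^sup>2 * s\<^sup>2) / 2))"
      using normal_density_transform[of "1 / \<epsilon>" s] assms by (simp only: integral_mult_right_zero) simp
    also have "\<dots> = complex_of_real (2 * pi * normal_density 0 \<epsilon> s)"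
    proof -
      have "sqrt (2 * pi) / \<epsilon> * exp (- ((1 / \<epsilon>)\<^sup>2 * s\<^sup>2) / 2) = 2 * pi * normal_density 0 \<epsilon> s"
        using assms real_sqrt_mult_self[of "2 * pi"]
        by (simp add: normal_density_def real_sqrt_mult power_divide field_simps)
      then show ?thesis by (metis of_real_mult)
    qed
    finally show ?thesis .
  qed
  then show ?thesis
    using tensor_transform[of "\<lambda>_ t. exp (- (\<epsilon>\<^sup>2 * t\<^sup>2) / 2)" 1 u] integrable_exp_square[OF assms]
    by (simp add: gauss_def gauss_hat_def prod.distrib)
qed

lemma gauss_convolution_fourier_inv:
  fixes \<Psi> :: "real ^ 'n \<Rightarrow> complex"
  assumes "integrable lborel \<Psi>" "0 < \<epsilon>"
  shows "(LINT y|lborel. fourier_inv \<Psi> y * complex_of_real (gauss \<epsilon> (x - y))) =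
    fourier_inv (\<lambda>\<xi>. \<Psi> \<xi> * complex_of_real (gauss_hat \<epsilon> \<xi>)) x"
  unfolding convolution_fourier_inv[OF assms(1) integrable_gauss[OF assms(2)]] gauss_transform[OF assms(2)] ..

text \<open>Fourier inversion in weak form: \<open>fourier g\<close> need not be integrable, but its
  product with \<open>gauss_hat \<epsilon>\<close> is.\<close>

lemma gauss_convolution_fourier:
  fixes g :: "real ^ 'n \<Rightarrow> complex"
  assumes g: "integrable lborel g" and \<epsilon>: "0 < \<epsilon>"
  shows "(LINT y|lborel. g y * complex_of_real (gauss \<epsilon> (x - y))) =
    fourier_inv (\<lambda>\<xi>. fourier g \<xi> * complex_of_real (gauss_hat \<epsilon> \<xi>)) x"
proof -
  define c where "c = complex_of_real ((2 * pi) powr (- real CARD('n) / 2))"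
  have "c * c = complex_of_real ((2 * pi) powr (- real CARD('n)))"
    unfolding c_def by (simp flip: of_real_mult powr_add)
  \<comment> \<open>The normalizing constants of \<open>fourier\<close> and
    \<open>fourier_inv\<close> cancel the factor \<open>(2 * pi) ^ CARD('n)\<close> of
    \<open>gauss_hat_transform\<close>.\<close>
  then have c: "c * (c * complex_of_real ((2 * pi) ^ CARD('n))) = 1"
  proof -
    have "(2 * pi) powr (- real CARD('n)) * (2 * pi) ^ CARD('n) = 1"
      using powr_add[of "2 * pi" "- real CARD('n)" "real CARD('n)"] powr_realpow[of "2 * pi" "CARD('n)"]
      by (simp del: power_mult_distrib)
    with \<open>c * c = _\<close> show ?thesis
      by (simp only: mult.assoc[symmetric] of_real_mult[symmetric] of_real_1)
  qed
  let ?h = "\<lambda>(\<xi>, y). exp (\<i> * complex_of_real ((x - y) \<bullet> \<xi>))"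
  have "fourier_inv (\<lambda>\<xi>. fourier g \<xi> * complex_of_real (gauss_hat \<epsilon> \<xi>)) x =
    c * (LINT \<xi>|lborel. c * (LINT y|lborel. complex_of_real (gauss_hat \<epsilon> \<xi>) * g y * ?h (\<xi>, y)))"
  proof -
    have "fourier g \<xi> * complex_of_real (gauss_hat \<epsilon> \<xi>) * exp (\<i> * complex_of_real (\<xi> \<bullet> x)) =
      c * (LINT y|lborel. complex_of_real (gauss_hat \<epsilon> \<xi>) * g y * ?h (\<xi>, y))" for \<xi>
    proof -
      have "exp (\<i> * complex_of_real ((x - y) \<bullet> \<xi>)) =
         exp (- \<i> * complex_of_real (\<xi> \<bullet> y)) * exp (\<i> * complex_of_real (\<xi> \<bullet> x))" for y
        unfolding exp_add[symmetric] by (simp add: inner_diff_right inner_commute[of "x - y"] right_diff_distrib)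
      then have "complex_of_real (gauss_hat \<epsilon> \<xi>) * g y * ?h (\<xi>, y) =
         (g y * exp (- \<i> * complex_of_real (\<xi> \<bullet> y))) * (complex_of_real (gauss_hat \<epsilon> \<xi>) * exp (\<i> * complex_of_real (\<xi> \<bullet> x)))" for y
        by (simp only: prod.case mult_ac)
      then have "(LINT y|lborel. complex_of_real (gauss_hat \<epsilon> \<xi>) * g y * ?h (\<xi>, y)) =
         (LINT y|lborel. g y * exp (- \<i> * complex_of_real (\<xi> \<bullet> y))) * (complex_of_real (gauss_hat \<epsilon> \<xi>) * exp (\<i> * complex_of_real (\<xi> \<bullet> x)))"
        by (simp only: integral_mult_left_zero)
      from this[symmetric] show ?thesis unfolding fourier_def c_def[symmetric]
        by (simp only: mult.assoc)
    qed
    then show ?thesis unfolding fourier_inv_def c_def[symmetric] by simp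
  qed
  also have "\<dots> = c * (c * (LINT \<xi>|lborel. LINT y|lborel. complex_of_real (gauss_hat \<epsilon> \<xi>) * g y * ?h (\<xi>, y)))"
    by (simp only: integral_mult_right_zero)
  also have "(LINT \<xi>|lborel. LINT y|lborel. complex_of_real (gauss_hat \<epsilon> \<xi>) * g y * ?h (\<xi>, y)) =
     (LINT y|lborel. LINT \<xi>|lborel. complex_of_real (gauss_hat \<epsilon> \<xi>) * g y * ?h (\<xi>, y))"
    by (rule lborel_pair.Fubini_integral[symmetric], rule integrable_lborel_pair_mult)
      (use integrable_gauss_hat[OF \<epsilon>] g in auto)
  also have "\<dots> = (LINT y|lborel. complex_of_real ((2 * pi) ^ CARD('n)) * (g y * complex_of_real (gauss \<epsilon> (x - y))))"
  proof (intro Bochner_Integration.integral_cong refl)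
    fix y
    have "complex_of_real (gauss_hat \<epsilon> \<xi>) * g y * ?h (\<xi>, y) = g y * (complex_of_real (gauss_hat \<epsilon> \<xi>) * exp (\<i> * complex_of_real ((x - y) \<bullet> \<xi>)))" for \<xi>
      by (simp add: mult_ac)
    then show "(LINT \<xi>|lborel. complex_of_real (gauss_hat \<epsilon> \<xi>) * g y * ?h (\<xi>, y)) =
      complex_of_real ((2 * pi) ^ CARD('n)) * (g y * complex_of_real (gauss \<epsilon> (x - y)))"
      by (simp only: integral_mult_right_zero gauss_hat_transform[OF \<epsilon>] of_real_mult) (simp only: mult_ac)
  qed
  also have "c * (c * \<dots>) = (LINT y|lborel. g y * complex_of_real (gauss \<epsilon> (x - y)))"
    using c by (simp only: integral_mult_right_zero) (simp only: mult.assoc[symmetric] mult_1)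
  finally show ?thesis ..
qed

text \<open>Substituting \<open>y = x - \<epsilon> *\<^sub>R z\<close> moves the width from the
  Gaussian into the argument of \<open>h\<close>, after which dominated convergence applies with a
  fixed Gaussian.\<close>

lemma gauss_convolution_bounded_tendsto:
  fixes h :: "real ^ 'n \<Rightarrow> complex"
  assumes [measurable]: "h \<in> borel_measurable borel" and B: "\<And>y. norm (h y) \<le> B" and h: "isCont h x"
  shows "(\<lambda>m. LINT y|lborel. h y * complex_of_real (gauss (1 / real (Suc m)) (x - y))) \<longlonglongrightarrow> h x"
proof -
  have eq: "(LINT y|lborel. h y * complex_of_real (gauss \<epsilon> (x - y))) =
      (LINT z|lborel. h (x + (- \<epsilon>) *\<^sub>R z) * complex_of_real (gauss 1 z))" if \<epsilon>: "0 < \<epsilon>" for \<epsilon>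
  proof -
    have sc: "normal_density 0 \<epsilon> (\<epsilon> * t) = std_normal_density t / \<epsilon>" for t
      using \<epsilon> by (simp add: normal_density_def real_sqrt_mult power_mult_distrib field_simps)
    have g: "gauss \<epsilon> (\<epsilon> *\<^sub>R z) = gauss 1 z / \<epsilon> ^ CARD('n)" for z :: "real ^ 'n"
      using \<epsilon> by (simp add: gauss_def sc prod_dividef)
    have "(LINT y|lborel. h y * complex_of_real (gauss \<epsilon> (x - y))) =
       \<bar>- \<epsilon>\<bar> ^ DIM(real ^ 'n) *\<^sub>R (LINT z|lborel. h (x + (- \<epsilon>) *\<^sub>R z) * complex_of_real (gauss \<epsilon> (x - (x + (- \<epsilon>) *\<^sub>R z))))"
      by (rule integral_lborel_affine) (use \<epsilon> in auto)
    also have "\<dots> = \<epsilon> ^ CARD('n) *\<^sub>R (LINT z|lborel. h (x + (- \<epsilon>) *\<^sub>R z) * complex_of_real (gauss 1 z) * complex_of_real (1 / \<epsilon> ^ CARD('n)))"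
      using \<epsilon> by (simp add: g)
    also have "\<dots> = (LINT z|lborel. h (x + (- \<epsilon>) *\<^sub>R z) * complex_of_real (gauss 1 z))"
      using \<epsilon> by (simp only: integral_mult_left_zero) (simp add: scaleR_conv_of_real)
    finally show ?thesis .
  qed
  have "(\<lambda>m. LINT z|lborel. h (x + (- (1 / real (Suc m))) *\<^sub>R z) * complex_of_real (gauss 1 z)) \<longlonglongrightarrow>
      (LINT z|lborel. h x * complex_of_real (gauss 1 (z :: real ^ 'n)))"
  proof (rule integral_dominated_convergence[where w = "\<lambda>z::real ^ 'n. B * gauss 1 z"])
    show "integrable lborel (\<lambda>z. B * gauss 1 (z :: real ^ 'n))"
      using integrable_gauss[of 1] by (intro integrable_mult_right) (simp only: complex_of_real_integrable_eq, simp)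
    show "AE z in lborel. (\<lambda>m. h (x + (- (1 / real (Suc m))) *\<^sub>R z) * complex_of_real (gauss 1 z)) \<longlonglongrightarrow> h x * complex_of_real (gauss 1 z)"
    proof (intro AE_I2 tendsto_mult tendsto_const)
      fix z :: "real ^ 'n"
      have "(\<lambda>m. - (1 / real (Suc m))) \<longlonglongrightarrow> 0" by real_asymp
      then have "(\<lambda>m. x + (- (1 / real (Suc m))) *\<^sub>R z) \<longlonglongrightarrow> x + 0 *\<^sub>R z" by (intro tendsto_intros)
      then show "(\<lambda>m. h (x + (- (1 / real (Suc m))) *\<^sub>R z)) \<longlonglongrightarrow> h x"
        using isCont_tendsto_compose[OF h] by simp
    qed
    show "AE z in lborel. norm (h (x + (- (1 / real (Suc m))) *\<^sub>R z) * complex_of_real (gauss 1 z)) \<le> B * gauss 1 z" for m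
      using B by (intro AE_I2) (simp add: norm_mult mult_right_mono)
  qed measurable
  then show ?thesis using integral_gauss[of 1, where 'n = 'n] by (simp add: eq)
qed

text \<open>Disposes of the part of an extension off the cube, of which only integrability is known.
  At distance at least \<delta> the Gaussian is bounded by \<open>q m\<close>, where the exponential
  beats the power of \<open>Suc m\<close>.\<close>

lemma gauss_convolution_away_tendsto:
  fixes g :: "real ^ 'n \<Rightarrow> complex"
  assumes g: "integrable lborel g" and \<delta>: "0 < \<delta>" and far: "\<And>y. dist x y < \<delta> \<Longrightarrow> g y = 0"
  shows "(\<lambda>m. LINT y|lborel. g y * complex_of_real (gauss (1 / real (Suc m)) (x - y))) \<longlonglongrightarrow> 0"
proof -
  have [measurable]: "g \<in> borel_measurable borel"
    using borel_measurable_integrable[OF g] by simp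
  define q where "q = (\<lambda>m. real (Suc m) ^ CARD('n) * exp (- (\<delta>\<^sup>2 / 2) * (real (Suc m))\<^sup>2))"
  have gq: "gauss (1 / real (Suc m)) u \<le> q m" if u: "\<delta> \<le> norm u" for m and u :: "real ^ 'n"
  proof -
    define k where "k = real (Suc m)"
    have k: "0 < k" by (simp add: k_def)
    have nd: "normal_density 0 (1 / k) t \<le> k * exp (- (k\<^sup>2 * t\<^sup>2) / 2)" for t
    proof -
      have "normal_density 0 (1 / k) t = (1 / sqrt (2 * pi)) * (k * exp (- (k\<^sup>2 * t\<^sup>2) / 2))"
        using exp_square_eq[OF k, of t] k by (simp add: field_simps)
      also have "\<dots> \<le> 1 * (k * exp (- (k\<^sup>2 * t\<^sup>2) / 2))"
        using k pi_gt3 by (intro mult_right_mono) auto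
      finally show ?thesis by simp
    qed
    have "gauss (1 / k) u \<le> (\<Prod>i\<in>UNIV. k * exp (- (k\<^sup>2 * (u $ i)\<^sup>2) / 2))"
      unfolding gauss_def by (intro prod_mono conjI nd) simp
    also have "\<dots> = k ^ CARD('n) * exp (\<Sum>i\<in>UNIV. - (k\<^sup>2 * (u $ i)\<^sup>2) / 2)"
      by (simp add: prod.distrib exp_sum)
    also have "(\<Sum>i\<in>UNIV. - (k\<^sup>2 * (u $ i)\<^sup>2) / 2) = - ((norm u)\<^sup>2 / 2) * k\<^sup>2"
      by (simp add: norm_vec_def L2_set_def sum_nonneg sum_divide_distrib sum_negf sum_distrib_left mult_ac)
    also have "k ^ CARD('n) * exp (- ((norm u)\<^sup>2 / 2) * k\<^sup>2) \<le> k ^ CARD('n) * exp (- (\<delta>\<^sup>2 / 2) * k\<^sup>2)"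
      using u \<delta> k by (intro mult_left_mono) (auto intro!: mult_right_mono power_mono)
    finally show ?thesis by (simp add: k_def q_def)
  qed
  have le: "norm (LINT y|lborel. g y * complex_of_real (gauss (1 / real (Suc m)) (x - y))) \<le> q m * (LINT y|lborel. norm (g y))" for m
  proof -
    have "norm (LINT y|lborel. g y * complex_of_real (gauss (1 / real (Suc m)) (x - y))) \<le>
      (LINT y|lborel. norm (g y * complex_of_real (gauss (1 / real (Suc m)) (x - y))))"
      by (rule integral_norm_bound)
    also have "\<dots> \<le> (LINT y|lborel. q m * norm (g y))"
    proof (rule integral_mono_AE')
      show "AE y in lborel. norm (g y * complex_of_real (gauss (1 / real (Suc m)) (x - y))) \<le> q m * norm (g y)"
      proof (intro AE_I2)
        fix y
        show "norm (g y * complex_of_real (gauss (1 / real (Suc m)) (x - y))) \<le> q m * norm (g y)"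
        proof (cases "dist x y < \<delta>")
          case False
          then have "gauss (1 / real (Suc m)) (x - y) * norm (g y) \<le> q m * norm (g y)"
            by (intro mult_right_mono gq) (auto simp: dist_norm)
          then show ?thesis by (simp add: norm_mult mult.commute[of "norm (g y)"])
        qed (simp add: far)
      qed
    qed (use g in \<open>auto simp: q_def\<close>)
    also have "\<dots> = q m * (LINT y|lborel. norm (g y))" by simp
    finally show ?thesis .
  qed
  have "q \<longlonglongrightarrow> 0"
  proof -
    have "0 < \<delta>\<^sup>2 / 2" using \<delta> by simp
    then show ?thesis unfolding q_def by real_asymp
  qed
  then have "(\<lambda>m. q m * (LINT y|lborel. norm (g y))) \<longlonglongrightarrow> 0"
    by (rule tendsto_mult_left_zero)
  then show ?thesis by (rule Lim_null_comparison[rotated]) (use le in auto)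
qed

subsection \<open>Dyadic blocks\<close>

definition below :: "nat ^ 'n \<Rightarrow> (nat ^ 'n) set" where
  "below k = {l. \<forall>i. l $ i \<le> k $ i}"

abbreviation box_index :: "nat \<Rightarrow> (nat ^ 'n) set" where
  "box_index N \<equiv> below (\<chi> i. N)"

text \<open>Finite distributivity. It factors the partial sums of blocks, the telescoping of mixed
  differences and the mixed kernels over the coordinates.\<close>

lemma prod_sum_below:
  fixes a :: "'n::finite \<Rightarrow> nat \<Rightarrow> 'b::comm_semiring_1"
  shows "(\<Prod>i\<in>UNIV. \<Sum>l\<le>k $ i. a i l) = (\<Sum>j\<in>below k. \<Prod>i\<in>UNIV. a i (j $ i))"
proof -
  have "(\<Prod>i\<in>UNIV. \<Sum>l\<le>k $ i. a i l) = (\<Sum>g\<in>PiE UNIV (\<lambda>i. {..k $ i}). \<Prod>i\<in>UNIV. a i (g i))"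
    by (rule prod_sum_PiE) auto
  also have "\<dots> = (\<Sum>j\<in>below k. \<Prod>i\<in>UNIV. a i (j $ i))"
    by (rule sum.reindex_bij_witness[where i = vec_nth and j = vec_lambda]) (auto simp: below_def)
  finally show ?thesis .
qed

lemma finite_below [simp]: "finite (below k)"
proof -
  have "below k \<subseteq> vec_lambda ` (PiE UNIV (\<lambda>i. {..k $ i}))"
  proof
    fix j assume "j \<in> below k"
    then have "vec_nth j \<in> PiE UNIV (\<lambda>i. {..k $ i})" by (auto simp: below_def)
    then show "j \<in> vec_lambda ` (PiE UNIV (\<lambda>i. {..k $ i}))" by (metis image_eqI vec_nth_inverse)
  qed
  then show ?thesis by (rule finite_subset) (intro finite_imageI finite_PiE; simp)
qed

lemma box_index_mono: "M \<le> N \<Longrightarrow> box_index M \<subseteq> box_index N"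
  by (auto simp: below_def intro: order_trans)

lemma fourier_inv_cong: "(\<And>\<xi>. \<Psi> \<xi> = \<Psi>' \<xi>) \<Longrightarrow> fourier_inv \<Psi> x = fourier_inv \<Psi>' x"
  by (simp add: fourier_inv_def)

section \<open>Dilated tensor kernels\<close>

definition scaled_kern :: "nat \<Rightarrow> real \<Rightarrow> real" where
  "scaled_kern j u = 2 ^ j * kern (2 ^ j * u)"

definition tensor_kern :: "nat ^ 'n \<Rightarrow> real ^ 'n \<Rightarrow> real" where
  "tensor_kern j u = (\<Prod>i\<in>UNIV. scaled_kern (j $ i) (u $ i))"

lemma scaled_kern_measurable [measurable]: "scaled_kern j \<in> borel_measurable borel"
  unfolding scaled_kern_def[abs_def] by measurable

lemma tensor_kern_measurable [measurable]: "tensor_kern j \<in> borel_measurable borel"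
  unfolding tensor_kern_def[abs_def] by measurable

lemma integrable_scaled_kern: "integrable lborel (scaled_kern j)"
  unfolding scaled_kern_def[abs_def]
  using lborel_integrable_real_affine[OF integrable_kern, of "2 ^ j" 0]
  by (intro integrable_mult_right) simp

lemma integrable_tensor_kern: "integrable lborel (\<lambda>u. complex_of_real (tensor_kern j u))"
  unfolding tensor_kern_def of_real_prod
  by (intro integrable_lborel_vec_prod) (simp add: integrable_scaled_kern)

text \<open>Dilation widens the plateau of the transform to
  \<open>\<bar>s\<bar> \<le> 2 ^ (j + 1)\<close>, which contains the support of the function with
  index \<open>j\<close> in the resolution.\<close>

lemma scaled_kern_transform:
  assumes "\<bar>s\<bar> \<le> 2 ^ (j + 1)"
  shows "(LINT t|lborel. complex_of_real (scaled_kern j t) * exp (-1 * \<i> * complex_of_real (s * t))) = 1"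
proof -
  have "(LINT t|lborel. complex_of_real (kern t) * exp (- \<i> * complex_of_real (s / 2 ^ j * t))) =
    \<bar>2 ^ j\<bar> *\<^sub>R (LINT t|lborel. complex_of_real (kern (0 + 2 ^ j * t)) * exp (- \<i> * complex_of_real (s / 2 ^ j * (0 + 2 ^ j * t))))"
    by (rule lborel_integral_real_affine) simp
  also have "\<dots> = (LINT t|lborel. complex_of_real (scaled_kern j t) * exp (-1 * \<i> * complex_of_real (s * t)))"
    by (simp add: scaled_kern_def scaleR_conv_of_real mult.assoc)
  finally show ?thesis using integral_kern_iexp[of "s / 2 ^ j"] assms by (simp add: divide_le_eq)
qed

lemma tensor_kern_transform:
  assumes "\<And>i. \<bar>\<xi> $ i\<bar> \<le> 2 ^ (j $ i + 1)"
  shows "(LINT u|lborel. complex_of_real (tensor_kern j u) * exp (- \<i> * complex_of_real (\<xi> \<bullet> u))) = 1"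
proof -
  have "(LINT u|lborel. complex_of_real (tensor_kern j u) * exp (-1 * \<i> * complex_of_real (\<xi> \<bullet> u))) = 1"
    unfolding tensor_kern_def
    by (subst tensor_transform) (use assms in \<open>auto simp only: integrable_scaled_kern scaled_kern_transform prod.neutral_const\<close>)
  then show ?thesis by simp
qed

text \<open>The summand 1 makes the constant, and hence its powers, at least 1.\<close>

definition kern_mass :: real where
  "kern_mass = 1 + (LINT u|lborel. \<bar>kern u\<bar>)"

lemma kern_mass_ge_1: "1 \<le> kern_mass"
  by (simp add: kern_mass_def)

lemma nn_integral_scaled_kern_le: "(\<integral>\<^sup>+t. ennreal \<bar>scaled_kern j t\<bar> \<partial>lborel) \<le> ennreal kern_mass"
proof -
  have "(\<integral>\<^sup>+t. ennreal \<bar>kern t\<bar> \<partial>lborel) = ennreal \<bar>2 ^ j\<bar> * (\<integral>\<^sup>+t. ennreal \<bar>kern (0 + 2 ^ j * t)\<bar> \<partial>lborel)"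
    by (rule nn_integral_real_affine) auto
  also have "\<dots> = (\<integral>\<^sup>+t. ennreal \<bar>scaled_kern j t\<bar> \<partial>lborel)"
    by (subst nn_integral_cmult[symmetric]) (auto simp: scaled_kern_def abs_mult ennreal_mult)
  finally have "(\<integral>\<^sup>+t. ennreal \<bar>scaled_kern j t\<bar> \<partial>lborel) = (\<integral>\<^sup>+t. ennreal \<bar>kern t\<bar> \<partial>lborel)" ..
  also have "\<dots> = ennreal (LINT u|lborel. \<bar>kern u\<bar>)"
    by (rule nn_integral_eq_integral) (use integrable_kern in auto)
  also have "\<dots> \<le> ennreal kern_mass" by (simp add: kern_mass_def ennreal_leI)
  finally show ?thesis .
qed

lemma nn_integral_tensor_kern_le:
  "(\<integral>\<^sup>+y. ennreal \<bar>tensor_kern j (x - y)\<bar> \<partial>lborel) \<le> ennreal (kern_mass ^ CARD('n))" for x :: "real ^ 'n"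
proof -
  have "(\<integral>\<^sup>+y. ennreal \<bar>tensor_kern j (x - y)\<bar> \<partial>lborel) = (\<integral>\<^sup>+y. ennreal \<bar>tensor_kern j y\<bar> \<partial>lborel)"
    by (rule nn_integral_lborel_reflect) measurable
  also have "\<dots> = (\<integral>\<^sup>+y. (\<Prod>i\<in>UNIV. ennreal \<bar>scaled_kern (j $ i) (y $ i)\<bar>) \<partial>lborel)"
    by (simp add: tensor_kern_def abs_prod prod_ennreal)
  also have "\<dots> = (\<Prod>i\<in>UNIV. \<integral>\<^sup>+t. ennreal \<bar>scaled_kern (j $ i) t\<bar> \<partial>lborel)"
    by (rule nn_integral_lborel_vec_prod) measurable
  also have "\<dots> \<le> (\<Prod>i\<in>(UNIV :: 'n set). ennreal kern_mass)"
    by (intro prod_mono_ennreal nn_integral_scaled_kern_le)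
  also have "\<dots> = ennreal (kern_mass ^ CARD('n))"
    using kern_mass_ge_1 by (simp add: ennreal_power)
  finally show ?thesis .
qed

lemma abs_tensor_kern_le: "\<bar>tensor_kern j u\<bar> \<le> 2 ^ (\<Sum>i\<in>UNIV. j $ i)"
proof -
  have "\<bar>tensor_kern j u\<bar> \<le> (\<Prod>i\<in>UNIV. 2 ^ (j $ i))"
    unfolding tensor_kern_def abs_prod
  proof (intro prod_mono conjI)
    show "\<bar>scaled_kern (j $ i) (u $ i)\<bar> \<le> 2 ^ (j $ i)" for i
      using abs_kern_le_1[of "2 ^ (j $ i) * u $ i"] by (simp add: scaled_kern_def abs_mult mult_left_le)
  qed simp
  then show ?thesis by (simp add: power_sum)
qed

section \<open>Resolution of unity and dyadic blocks\<close>

locale dyadic =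
  fixes \<phi> :: "nat \<Rightarrow> real \<Rightarrow> complex"
  assumes resolution: "dyadic_resolution \<phi>"
begin

lemma continuous_on_phi: "continuous_on A (\<phi> n)"
proof -
  have "smooth (\<phi> n)" using resolution by (simp add: dyadic_resolution_def)
  then have "iter_deriv 0 (\<phi> n) differentiable at x" for x unfolding smooth_def by blast
  then have "isCont (\<phi> n) x" for x
    by (auto simp: iter_deriv_def intro: differentiable_imp_continuous_within)
  then show ?thesis by (simp add: continuous_at_imp_continuous_on)
qed

lemma phi_measurable [measurable]: "\<phi> n \<in> borel_measurable borel"
  by (intro borel_measurable_continuous_onI continuous_on_phi)

lemma phi_bounded: "\<exists>B. \<forall>n x. norm (\<phi> n x) \<le> B"
proof -
  have "\<exists>B. \<forall>n x. 2 ^ (n * 0) * norm (iter_deriv 0 (\<phi> n) x) \<le> B"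
    using resolution unfolding dyadic_resolution_def by blast
  then show ?thesis by (simp add: iter_deriv_def)
qed

lemma supp_phi_0: "supp (\<phi> 0) \<subseteq> {x. \<bar>x\<bar> \<le> 2}"
  and supp_phi: "1 \<le> n \<Longrightarrow> supp (\<phi> n) \<subseteq> {x. 2 ^ (n - 1) \<le> \<bar>x\<bar> \<and> \<bar>x\<bar> \<le> 2 ^ (n + 1)}"
  using resolution unfolding dyadic_resolution_def by simp_all

lemma phi_eq_0_high: "2 ^ (n + 1) < \<bar>x\<bar> \<Longrightarrow> \<phi> n x = 0"
proof (rule ccontr)
  assume x: "2 ^ (n + 1) < \<bar>x\<bar>" and "\<phi> n x \<noteq> 0"
  then have "x \<in> supp (\<phi> n)" by (auto simp: supp_def intro!: subsetD[OF closure_subset])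
  then have "\<bar>x\<bar> \<le> 2 ^ (n + 1)"
    using supp_phi_0 supp_phi[of n] by (cases "n = 0") auto
  with x show False by simp
qed

lemma phi_eq_0_low: "1 \<le> n \<Longrightarrow> \<bar>x\<bar> < 2 ^ (n - 1) \<Longrightarrow> \<phi> n x = 0"
proof (rule ccontr)
  assume n: "1 \<le> n" and x: "\<bar>x\<bar> < 2 ^ (n - 1)" and "\<phi> n x \<noteq> 0"
  then have "x \<in> supp (\<phi> n)" by (auto simp: supp_def intro!: subsetD[OF closure_subset])
  then have "2 ^ (n - 1) \<le> \<bar>x\<bar>"
    using supp_phi[OF n] by auto
  with x show False by simp
qed

lemma phi_sums: "(\<lambda>n. \<phi> n x) sums 1"
  using resolution by (simp add: dyadic_resolution_def)

text \<open>At each point at most three consecutive functions are nonzero: if \<open>m\<close> is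
  the least such index, then \<open>\<bar>x\<bar> \<le> 2 ^ (m + 1)\<close>, and the lower ends of
  the supports exclude all indices from \<open>m + 3\<close> on. The uniform bound provides the
  majorant for dominated convergence.\<close>

lemma phi_partial_sums_bounded: "\<exists>B\<ge>1. \<forall>N x. norm (\<Sum>n\<le>N. \<phi> n x) \<le> B"
proof -
  obtain B where B: "\<And>n x. norm (\<phi> n x) \<le> B" using phi_bounded by blast
  have B0: "0 \<le> B" using B[of 0 0] norm_ge_zero order_trans by blast
  have "norm (\<Sum>n\<le>N. \<phi> n x) \<le> 3 * B" for N x
  proof (cases "\<exists>n. \<phi> n x \<noteq> 0")
    case True
    define m where "m = (LEAST n. \<phi> n x \<noteq> 0)"
    have m: "\<phi> m x \<noteq> 0" unfolding m_def using True by (rule LeastI_ex)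
    have least: "n < m \<Longrightarrow> \<phi> n x = 0" for n unfolding m_def using not_less_Least by blast
    have xm: "\<bar>x\<bar> \<le> 2 ^ (m + 1)" using phi_eq_0_high[of m x] m by force
    have big: "\<phi> n x = 0" if "m + 3 \<le> n" for n
    proof (rule phi_eq_0_low)
      have "(2::real) ^ (m + 1) < 2 ^ (n - 1)"
        using that by (intro power_strict_increasing) auto
      with xm show "\<bar>x\<bar> < 2 ^ (n - 1)" by simp
    qed (use that in simp)
    have z: "\<phi> n x = 0" if "n \<notin> {m, m + 1, m + 2}" for n
    proof -
      from that have "n < m \<or> m + 3 \<le> n" by auto
      then show ?thesis using least big by blast
    qed
    have "(\<Sum>n\<le>N. \<phi> n x) = (\<Sum>n\<in>{..N} \<inter> {m, m + 1, m + 2}. \<phi> n x)"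
      by (rule sum.mono_neutral_right) (use z in auto)
    also have "norm \<dots> \<le> (\<Sum>n\<in>{..N} \<inter> {m, m + 1, m + 2}. B)"
      by (rule sum_norm_le) (rule B)
    also have "\<dots> \<le> (\<Sum>n\<in>{m, m + 1, m + 2}. B)"
      by (rule sum_mono2) (use B0 in auto)
    finally show ?thesis by simp
  qed (use B0 in simp)
  then show ?thesis by (intro exI[of _ "max 1 (3 * B)"]) (auto simp: le_max_iff_disj)
qed

definition block :: "(real ^ 'n \<Rightarrow> complex) \<Rightarrow> nat ^ 'n \<Rightarrow> real ^ 'n \<Rightarrow> complex" where
  "block f j \<xi> = (\<Prod>i\<in>UNIV. \<phi> (j $ i) (\<xi> $ i)) * fourier f \<xi>"

lemma fourier_block_eq: "fourier_block \<phi> f j = fourier_inv (block f j)"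
  by (simp add: fourier_block_def block_def[abs_def])

lemma block_eq_0: "2 ^ (j $ i + 1) < \<bar>\<xi> $ i\<bar> \<Longrightarrow> block f j \<xi> = 0"
  unfolding block_def using phi_eq_0_high[of "j $ i" "\<xi> $ i"] by (auto simp: prod_zero_iff)

lemma integrable_block:
  assumes f: "integrable lborel (f :: real ^ 'n \<Rightarrow> complex)"
  shows "integrable lborel (block f j)"
proof -
  note [measurable] = fourier_measurable[OF f]
  obtain B where B: "\<And>n x. norm (\<phi> n x) \<le> B" using phi_bounded by blast
  define c where "c = (2 * pi) powr (- real CARD('n) / 2) * (LINT x|lborel. norm (f x))"
  define R :: "real ^ 'n" where "R = (\<chi> i. 2 ^ (j $ i + 1))"
  have "integrable lborel (\<lambda>\<xi>. B ^ CARD('n) * c * indicator (cbox (- R) R) \<xi>)"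
    using emeasure_lborel_cbox_finite[of "- R" R]
    by (intro integrable_mult_right integrable_real_indicator) auto
  then show ?thesis
  proof (rule Bochner_Integration.integrable_bound)
    show "block f j \<in> borel_measurable lborel" unfolding block_def[abs_def] by measurable
    show "AE \<xi> in lborel. norm (block f j \<xi>) \<le> norm (B ^ CARD('n) * c * indicator (cbox (- R) R) \<xi>)"
    proof (intro AE_I2)
      fix \<xi>
      show "norm (block f j \<xi>) \<le> norm (B ^ CARD('n) * c * indicator (cbox (- R) R) \<xi>)"
      proof (cases "\<xi> \<in> cbox (- R) R")
        case True
        have "norm (block f j \<xi>) = (\<Prod>i\<in>UNIV. norm (\<phi> (j $ i) (\<xi> $ i))) * norm (fourier f \<xi>)"
          by (simp add: block_def norm_mult prod_norm)
        also have "\<dots> \<le> (\<Prod>i\<in>(UNIV :: 'n set). B) * c"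
          unfolding c_def by (intro mult_mono prod_mono norm_fourier_le conjI B prod_nonneg) (auto intro: order_trans[OF _ B])
        finally show ?thesis using True by simp
      next
        case False
        then obtain i where "\<not> (- R $ i \<le> \<xi> $ i \<and> \<xi> $ i \<le> R $ i)" by (auto simp: mem_box_cart)
        then have "2 ^ (j $ i + 1) < \<bar>\<xi> $ i\<bar>" by (auto simp: R_def)
        then show ?thesis by (simp add: block_eq_0)
      qed
    qed
  qed
qed

lemma fourier_block_measurable:
  "integrable lborel f \<Longrightarrow> fourier_block \<phi> f j \<in> borel_measurable borel"
  unfolding fourier_block_eq by (intro fourier_inv_measurable integrable_block)

lemma continuous_on_fourier_block:
  "integrable lborel f \<Longrightarrow> continuous_on A (fourier_block \<phi> f j)"
  unfolding fourier_block_eq by (intro continuous_on_fourier_inv integrable_block)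

lemma fourier_block_reproducing:
  assumes f: "integrable lborel (f :: real ^ 'n \<Rightarrow> complex)"
  shows "fourier_block \<phi> f j x = (LINT y|lborel. fourier_block \<phi> f j y * complex_of_real (tensor_kern j (x - y)))"
  unfolding fourier_block_eq convolution_fourier_inv[OF integrable_block[OF f] integrable_tensor_kern]
proof (rule fourier_inv_cong)
  fix \<xi>
  show "block f j \<xi> = block f j \<xi> * (LINT u|lborel. complex_of_real (tensor_kern j u) * exp (- \<i> * complex_of_real (\<xi> \<bullet> u)))"
  proof (cases "\<forall>i. \<bar>\<xi> $ i\<bar> \<le> 2 ^ (j $ i + 1)")
    case True
    then show ?thesis by (subst tensor_kern_transform) auto
  next
    case False
    then have "block f j \<xi> = 0" using block_eq_0 not_le by blast
    then show ?thesis by simp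
  qed
qed

end

section \<open>Pointwise convergence of the block series\<close>

lemma norm_integral_le_nn_integral: "ennreal (norm (LINT x|M. f x)) \<le> (\<integral>\<^sup>+x. norm (f x) \<partial>M)"
  for f :: "'a \<Rightarrow> complex"
  by (cases "integrable M f") (auto simp: integral_norm_bound_ennreal not_integrable_integral_eq)

lemma borel_measurable_cube_restriction:
  fixes f :: "real ^ 'n \<Rightarrow> complex"
  assumes "continuous_on cube f"
  shows "(\<lambda>y. indicator cube y * f y) \<in> borel_measurable borel"
proof -
  have "(\<lambda>y. indicator cube y *\<^sub>R f y) \<in> borel_measurable borel"
    by (rule borel_measurable_continuous_on_indicator[OF _ assms]) simp
  also have "(\<lambda>y. indicator cube y *\<^sub>R f y) = (\<lambda>y. indicator cube y * f y)"
    by (auto simp: indicator_def)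
  finally show ?thesis .
qed

context dyadic
begin

lemma sum_block_box_index:
  "(\<Sum>j\<in>box_index N. block g j \<xi>) = (\<Prod>i\<in>UNIV. \<Sum>n\<le>N. \<phi> n (\<xi> $ i)) * fourier g \<xi>"
  for \<xi> :: "real ^ 'n"
  unfolding block_def sum_distrib_right[symmetric]
  using prod_sum_below[of "\<lambda>i n. \<phi> n (\<xi> $ i)" "\<chi> i. N"] by simp

text \<open>Holds for every integrable \<open>g\<close>, whether or not its blocks are summable: on
  the Fourier side the partial sums stay bounded, and \<open>gauss_hat \<epsilon>\<close> makes the
  majorant integrable.\<close>

lemma gauss_convolution_partial_sums_tendsto:
  fixes g :: "real ^ 'n \<Rightarrow> complex"
  assumes g: "integrable lborel g" and \<epsilon>: "0 < \<epsilon>"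
  shows "(\<lambda>N. LINT y|lborel. (\<Sum>j\<in>box_index N. fourier_block \<phi> g j y) * complex_of_real (gauss \<epsilon> (x - y)))
    \<longlonglongrightarrow> (LINT y|lborel. g y * complex_of_real (gauss \<epsilon> (x - y)))"
proof -
  note [measurable] = fourier_measurable[OF g]
  let ?\<Psi> = "\<lambda>N \<xi>. \<Sum>j\<in>box_index N. block g j \<xi>"
  obtain B where B: "1 \<le> B" "\<And>N x. norm (\<Sum>n\<le>N. \<phi> n x) \<le> B"
    using phi_partial_sums_bounded by blast
  define c where "c = (2 * pi) powr (- real CARD('n) / 2) * (LINT x|lborel. norm (g x))"
  have int: "integrable lborel (?\<Psi> N)" for N
    using integrable_block[OF g] by auto
  have eq: "(LINT y|lborel. (\<Sum>j\<in>box_index N. fourier_block \<phi> g j y) * complex_of_real (gauss \<epsilon> (x - y))) =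
     fourier_inv (\<lambda>\<xi>. ?\<Psi> N \<xi> * complex_of_real (gauss_hat \<epsilon> \<xi>)) x" for N
  proof -
    have "(\<Sum>j\<in>box_index N. fourier_block \<phi> g j y) = fourier_inv (?\<Psi> N) y" for y
      unfolding fourier_block_eq using integrable_block[OF g] by (subst fourier_inv_sum) auto
    then show ?thesis using gauss_convolution_fourier_inv[OF int \<epsilon>] by simp
  qed
  have "(\<lambda>N. fourier_inv (\<lambda>\<xi>. ?\<Psi> N \<xi> * complex_of_real (gauss_hat \<epsilon> \<xi>)) x) \<longlonglongrightarrow>
     fourier_inv (\<lambda>\<xi>. fourier g \<xi> * complex_of_real (gauss_hat \<epsilon> \<xi>)) x"
  proof (rule fourier_inv_tendsto[where w = "\<lambda>\<xi>. B ^ CARD('n) * c * gauss_hat \<epsilon> \<xi>"])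
    show "(\<lambda>\<xi>. ?\<Psi> N \<xi> * complex_of_real (gauss_hat \<epsilon> \<xi>)) \<in> borel_measurable borel" for N
      unfolding sum_block_box_index by measurable
    show "(\<lambda>\<xi>. fourier g \<xi> * complex_of_real (gauss_hat \<epsilon> \<xi>)) \<in> borel_measurable borel" by measurable
    show "integrable lborel (\<lambda>\<xi>::real ^ 'n. B ^ CARD('n) * c * gauss_hat \<epsilon> \<xi>)"
      using integrable_gauss_hat[OF \<epsilon>] by (intro integrable_mult_right) (simp only: complex_of_real_integrable_eq)
    show "norm (?\<Psi> N \<xi> * complex_of_real (gauss_hat \<epsilon> \<xi>)) \<le> B ^ CARD('n) * c * gauss_hat \<epsilon> \<xi>" for N \<xi>
    proof -
      have "norm (?\<Psi> N \<xi>) = (\<Prod>i\<in>UNIV. norm (\<Sum>n\<le>N. \<phi> n (\<xi> $ i))) * norm (fourier g \<xi>)"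
        by (simp add: sum_block_box_index norm_mult prod_norm)
      also have "\<dots> \<le> (\<Prod>i\<in>(UNIV :: 'n set). B) * c"
        unfolding c_def using B by (intro mult_mono prod_mono norm_fourier_le conjI prod_nonneg) auto
      finally show ?thesis using gauss_hat_bounds[of \<epsilon> \<xi>] by (simp add: norm_mult mult_right_mono)
    qed
    show "(\<lambda>N. ?\<Psi> N \<xi> * complex_of_real (gauss_hat \<epsilon> \<xi>)) \<longlonglongrightarrow> fourier g \<xi> * complex_of_real (gauss_hat \<epsilon> \<xi>)" for \<xi>
    proof -
      have "(\<lambda>N. (\<Prod>i\<in>UNIV. \<Sum>n\<le>N. \<phi> n (\<xi> $ i)) * fourier g \<xi>) \<longlonglongrightarrow> (\<Prod>i\<in>(UNIV :: 'n set). 1) * fourier g \<xi>"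
        by (intro tendsto_mult tendsto_prod tendsto_const) (use phi_sums in \<open>simp add: sums_def_le\<close>)
      then show ?thesis by (intro tendsto_mult tendsto_const) (simp add: sum_block_box_index)
    qed
  qed simp
  then show ?thesis unfolding eq gauss_convolution_fourier[OF g \<epsilon>] .
qed

lemma gauss_convolution_bounded_norm_le:
  fixes h :: "real ^ 'n \<Rightarrow> complex"
  assumes \<epsilon>: "0 < \<epsilon>" and B: "\<And>y. norm (h y) \<le> B"
  shows "norm (LINT y|lborel. h y * complex_of_real (gauss \<epsilon> (x - y))) \<le> B"
proof -
  have int: "integrable lborel (\<lambda>y. gauss \<epsilon> (x - y))"
    using integrable_lborel_reflect[OF integrable_gauss[OF \<epsilon>], of x] by (simp only: complex_of_real_integrable_eq)
  have one: "(LINT y|lborel. gauss \<epsilon> (x - y)) = 1"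
  proof -
    have "(LINT y|lborel. complex_of_real (gauss \<epsilon> (x - y))) = 1"
      by (subst integral_lborel_reflect) (auto simp only: integral_gauss[OF \<epsilon>], measurable)
    then show ?thesis by simp
  qed
  have B0: "0 \<le> B" using B[of x] norm_ge_zero order_trans by blast
  have "norm (LINT y|lborel. h y * complex_of_real (gauss \<epsilon> (x - y))) \<le> (LINT y|lborel. norm (h y * complex_of_real (gauss \<epsilon> (x - y))))"
    by (rule integral_norm_bound)
  also have "\<dots> \<le> (LINT y|lborel. B * gauss \<epsilon> (x - y))"
    by (rule integral_mono_AE') (use int B B0 in \<open>auto simp: norm_mult mult_right_mono\<close>)
  also have "\<dots> = B" by (simp add: one)
  finally show ?thesis .
qed

text \<open>Summable sup norms make the partial sums uniformly Cauchy; the issue is that the limit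
  is \<open>f\<close>, since \<open>g\<close> is related to \<open>f\<close> only almost everywhere
  and only on the cube. Convolution with Gaussians ignores null sets: for fixed width the smoothed
  partial sums tend to the smoothed \<open>g\<close>, and as the width shrinks the latter recovers
  \<open>f\<close> at interior points.\<close>

lemma fourier_block_partial_sums_tendsto:
  fixes f g :: "real ^ 'n \<Rightarrow> complex"
  assumes f: "continuous_on cube f" and g: "integrable lborel g"
    and fg: "AE x in cube_measure. g x = f x"
    and a: "\<And>j x. norm (fourier_block \<phi> g j x) \<le> a j"
    and b: "\<And>N. (\<Sum>j\<in>box_index N. a j) \<le> b" and x: "x \<in> cube"
  shows "(\<lambda>N. \<Sum>j\<in>box_index N. fourier_block \<phi> g j x) \<longlonglongrightarrow> f x"
proof -
  note [measurable] = borel_measurable_integrable[OF g]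
  define S where "S = (\<lambda>N x. \<Sum>j\<in>box_index N. fourier_block \<phi> g j x)"
  define s where "s = (\<lambda>N. \<Sum>j\<in>(box_index N :: (nat ^ 'n) set). a j)"
  have a0: "0 \<le> a j" for j using a[of j 0] norm_ge_zero order_trans by blast
  have "incseq s"
    unfolding s_def incseq_def by (auto intro!: sum_mono2 box_index_mono a0)
  moreover have "Bseq s"
    using b a0 by (intro BseqI'[of _ b]) (auto simp: s_def sum_nonneg)
  ultimately obtain L where L: "s \<longlonglongrightarrow> L" using Bseq_monoseq_convergent incseq_imp_monoseq convergent_def by blast
  have sL: "s N \<le> L" for N using incseq_le[OF \<open>incseq s\<close> L] .
  have S_cont: "continuous_on A (S N)" for A N
    unfolding S_def by (intro continuous_intros continuous_on_fourier_block g)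
  have [measurable]: "S N \<in> borel_measurable borel" for N
    by (intro borel_measurable_continuous_onI S_cont)
  have S_bound: "norm (S N y) \<le> s N" for N y
    unfolding S_def s_def by (intro sum_norm_le a)
  \<comment> \<open>The tail \<open>L - s N\<close> of the majorant bounds the distance to all later
    partial sums, uniformly in \<open>y\<close>; this one number is carried through every limit
    below.\<close>
  have S_diff: "norm (S M y - S N y) \<le> L - s N" if "N \<le> M" for M N y
  proof -
    have "S M y - S N y = (\<Sum>j\<in>box_index M - box_index N. fourier_block \<phi> g j y)"
      unfolding S_def by (rule sum_diff[OF finite_below box_index_mono[OF that], symmetric])
    also have "norm \<dots> \<le> (\<Sum>j\<in>box_index M - box_index N. a j)"
      by (intro sum_norm_le a)
    also have "\<dots> = s M - s N"
      unfolding s_def by (rule sum_diff[OF finite_below box_index_mono[OF that]])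
    finally show ?thesis using sL[of M] by simp
  qed
  have conv_int: "integrable lborel (\<lambda>y. h y * complex_of_real (gauss \<epsilon> (x - y)))"
    if [measurable]: "h \<in> borel_measurable borel" and "\<And>y. norm (h y) \<le> B" "0 < \<epsilon>" for h B \<epsilon> and x :: "real ^ 'n"
  proof (rule Bochner_Integration.integrable_bound)
    show "integrable lborel (\<lambda>y. complex_of_real B * complex_of_real (gauss \<epsilon> (x - y)))"
      by (intro integrable_mult_right integrable_lborel_reflect integrable_gauss that)
    have "norm (h y) \<le> \<bar>B\<bar>" for y using that(2)[of y] by simp
    then show "AE y in lborel. norm (h y * complex_of_real (gauss \<epsilon> (x - y))) \<le> norm (complex_of_real B * complex_of_real (gauss \<epsilon> (x - y)))"
      by (intro AE_I2) (simp add: norm_mult mult_right_mono)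
  qed measurable
  \<comment> \<open>Here \<open>h\<close> is only integrable, so the Gaussian has to supply the
    bound.\<close>
  have conv_int': "integrable lborel (\<lambda>y. h y * complex_of_real (gauss (1 / real (Suc m)) (x - y)))"
    if "integrable lborel h" for h m and x :: "real ^ 'n"
  proof -
    have "norm (gauss (1 / real (Suc m)) u) \<le> real (Suc m) ^ CARD('n)" for u :: "real ^ 'n"
    proof -
      have "normal_density 0 (1 / real (Suc m)) t \<le> real (Suc m)" for t
      proof -
        have "normal_density 0 (1 / real (Suc m)) t = real (Suc m) * ((1 / sqrt (2 * pi)) * exp (- ((real (Suc m))\<^sup>2 * t\<^sup>2) / 2))"
          using exp_square_eq[of "real (Suc m)" t] by (simp add: field_simps)
        also have "\<dots> \<le> real (Suc m) * (1 * 1)"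
          using pi_gt3 by (intro mult_left_mono mult_mono) auto
        finally show ?thesis by simp
      qed
      then have "gauss (1 / real (Suc m)) u \<le> (\<Prod>i\<in>(UNIV :: 'n set). real (Suc m))"
        unfolding gauss_def by (intro prod_mono) auto
      then show ?thesis by simp
    qed
    note G = this
    note [measurable] = borel_measurable_integrable[OF that]
    have "integrable lborel (\<lambda>y. complex_of_real (real (Suc m) ^ CARD('n)) * h y)"
      using that by (rule integrable_mult_right)
    then show ?thesis
    proof (rule Bochner_Integration.integrable_bound)
      show "AE y in lborel. norm (h y * complex_of_real (gauss (1 / real (Suc m)) (x - y))) \<le> norm (complex_of_real (real (Suc m) ^ CARD('n)) * h y)"
        using G by (intro AE_I2) (simp add: norm_mult norm_power mult.commute[of "norm (h _)"] mult_right_mono del: of_nat_Suc)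
    qed measurable
  qed
  \<comment> \<open>Up to a null set, \<open>g\<close> is split into the bounded function
    \<open>f1\<close>, continuous inside the cube, and a remainder vanishing on the cube; each part
    has its own limit lemma.\<close>
  define f1 where "f1 = (\<lambda>y. indicator cube y * f y)"
  define g2 where "g2 = (\<lambda>y. indicator (- cube) y * g y)"
  have [measurable]: "f1 \<in> borel_measurable borel"
    unfolding f1_def by (rule borel_measurable_cube_restriction[OF f])
  obtain Bf where Bf: "\<And>y. norm (f1 y) \<le> Bf"
  proof -
    have "compact (f ` cube)" by (rule compact_continuous_image[OF f]) simp
    then have "bounded (f ` cube)" by (rule compact_imp_bounded)
    then obtain C where "\<forall>y\<in>cube. norm (f y) \<le> C" by (auto simp: bounded_iff)
    then have "norm (f1 y) \<le> max C 0" for y by (auto simp: f1_def indicator_def le_max_iff_disj)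
    then show ?thesis by (rule that)
  qed
  have g2: "integrable lborel g2"
    by (rule Bochner_Integration.integrable_bound[OF g]) (auto simp: g2_def indicator_def)
  have g_split: "AE y in lborel. g y = f1 y + g2 y"
    using fg by (subst (asm) AE_restrict_space_iff) (auto simp: f1_def g2_def indicator_def elim!: eventually_mono)
  have interior: "norm (f x - S N x) \<le> L - s N" if x: "x \<in> box 0 1" for x N
  proof -
    let ?T = "\<lambda>h m. LINT y|lborel. h y * complex_of_real (gauss (1 / real (Suc m)) (x - y))"
    obtain \<delta> where \<delta>: "0 < \<delta>" "ball x \<delta> \<subseteq> box 0 1"
      using open_contains_ball x open_box by blast
    have "\<forall>\<^sub>F y in nhds x. f1 y = f y"
    proof -
      have "\<forall>\<^sub>F y in nhds x. y \<in> box 0 1" using x by (intro eventually_nhds_in_open) auto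
      then show ?thesis
        by eventually_elim (use box_subset_cbox[of 0 "1::real^'n"] in \<open>auto simp: f1_def indicator_def\<close>)
    qed
    moreover have "isCont f x"
      using continuous_on_subset[OF f box_subset_cbox] x continuous_on_eq_continuous_at[OF open_box] by blast
    ultimately have f1c: "isCont f1 x" by (simp add: isCont_cong)
    have f1x: "f1 x = f x"
      using x box_subset_cbox[of 0 "1::real^'n"] by (auto simp: f1_def indicator_def)
    have T1: "?T f1 \<longlonglongrightarrow> f x"
      unfolding f1x[symmetric] by (rule gauss_convolution_bounded_tendsto[OF _ Bf f1c]) measurable
    have T2: "?T g2 \<longlonglongrightarrow> 0"
      using \<delta> box_subset_cbox[of 0 "1::real^'n"]
      by (intro gauss_convolution_away_tendsto[OF g2 \<delta>(1)]) (auto simp: g2_def indicator_def)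
    have "?T g m = ?T f1 m + ?T g2 m" for m
    proof -
      have "?T g m = (LINT y|lborel. f1 y * complex_of_real (gauss (1 / real (Suc m)) (x - y)) + g2 y * complex_of_real (gauss (1 / real (Suc m)) (x - y)))"
        by (rule integral_cong_AE)
          (use g_split g2 in \<open>auto simp: distrib_right elim!: eventually_mono simp del: of_nat_Suc\<close>)
      also have "\<dots> = ?T f1 m + ?T g2 m"
        by (intro Bochner_Integration.integral_add conv_int[OF _ Bf] conv_int' g2) auto
      finally show ?thesis .
    qed
    with tendsto_add[OF T1 T2] have Tg: "?T g \<longlonglongrightarrow> f x" by simp
    have TS: "?T (S N) \<longlonglongrightarrow> S N x"
      using S_cont[of UNIV N] by (intro gauss_convolution_bounded_tendsto[OF _ S_bound]) (auto simp: continuous_on_eq_continuous_at)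
    \<comment> \<open>The number of blocks grows first, at fixed width; the width shrinks
      afterwards. The bound depends on neither \<open>M\<close> nor \<open>m\<close>, so it survives
      both limits.\<close>
    have "norm (?T g m - ?T (S N) m) \<le> L - s N" for m
    proof -
      have lim: "(\<lambda>M. ?T (S M) m) \<longlonglongrightarrow> ?T g m"
        using gauss_convolution_partial_sums_tendsto[OF g, of "1 / real (Suc m)" x] by (simp add: S_def)
      have "norm (?T (S M) m - ?T (S N) m) \<le> L - s N" if "N \<le> M" for M
      proof -
        have "?T (S M) m - ?T (S N) m = (LINT y|lborel. (S M y - S N y) * complex_of_real (gauss (1 / real (Suc m)) (x - y)))"
          unfolding left_diff_distrib
          by (intro Bochner_Integration.integral_diff[symmetric] conv_int[OF _ S_bound]) auto
        also have "norm \<dots> \<le> L - s N"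
          by (rule gauss_convolution_bounded_norm_le) (use S_diff[OF that] in auto)
        finally show ?thesis .
      qed
      then show ?thesis
        by (intro LIMSEQ_le_const2[OF tendsto_norm[OF tendsto_diff[OF lim tendsto_const]]]) blast
    qed
    then show ?thesis
      by (intro LIMSEQ_le_const2[OF tendsto_norm[OF tendsto_diff[OF Tg TS]]]) blast
  qed
  \<comment> \<open>Sample points may lie on the boundary of the cube, so convergence is needed there as well.\<close>
  have closure: "norm (f x - S N x) \<le> L - s N" for N
  proof (rule continuous_on_closure_norm_le[where f = "\<lambda>x. f x - S N x" and x = x and s = "box 0 1"])
    have "(\<chi> i. 1 / 2) \<in> box 0 (1 :: real ^ 'n)" by (simp add: mem_box_cart)
    then have ne: "box 0 (1 :: real ^ 'n) \<noteq> {}" by blast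
    then show "continuous_on (closure (box 0 1)) (\<lambda>x. f x - S N x)"
      by (simp add: closure_box) (intro continuous_intros f S_cont)
    show "x \<in> closure (box 0 1)" using ne x by (simp add: closure_box)
  qed (use interior in auto)
  have "(\<lambda>N. norm (S N x - f x)) \<longlonglongrightarrow> 0"
  proof (rule tendsto_sandwich[OF _ _ tendsto_const])
    show "(\<lambda>N. L - s N) \<longlonglongrightarrow> 0" using tendsto_diff[OF tendsto_const L, of L] by simp
  qed (use closure in \<open>auto simp: norm_minus_commute\<close>)
  then have "(\<lambda>N. S N x) \<longlonglongrightarrow> f x" by (simp add: LIM_zero_iff tendsto_norm_zero_iff)
  then show ?thesis by (simp add: S_def)
qed

text \<open>Jensen with the modulus of the reproducing kernel as weight; the kernel remaining under
  the integral is bounded by its supremum \<open>2 ^ J\<close>, whose p-th root is the factor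
  gained. This factor is the Besov weight for smoothness \<open>1 / p\<close>, whence the sup norms
  of the blocks are summable when q = 1.\<close>

lemma fourier_block_Nikolskii:
  fixes g :: "real ^ 'n \<Rightarrow> complex"
  assumes g: "integrable lborel g" and p: "1 \<le> p"
    and c: "Lp_norm p lborel (fourier_block \<phi> g j) = ennreal c" "0 \<le> c"
  shows "norm (fourier_block \<phi> g j x) \<le> kern_mass ^ CARD('n) * 2 powr (real (\<Sum>i\<in>UNIV. j $ i) / p) * c"
proof -
  note [measurable] = fourier_block_measurable[OF g]
  define A where "A = kern_mass ^ CARD('n)"
  define J where "J = (\<Sum>i\<in>UNIV. j $ i)"
  have A: "1 \<le> A" unfolding A_def by (rule one_le_power[OF kern_mass_ge_1])
  let ?w = "\<lambda>y. ennreal \<bar>tensor_kern j (x - y)\<bar>" and ?u = "\<lambda>y. ennreal (norm (fourier_block \<phi> g j y))"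
  have "ennreal (norm (fourier_block \<phi> g j x)) \<le> (\<integral>\<^sup>+y. ?w y * ?u y \<partial>lborel)"
  proof -
    have "ennreal (norm (fourier_block \<phi> g j x)) \<le> (\<integral>\<^sup>+y. norm (fourier_block \<phi> g j y * complex_of_real (tensor_kern j (x - y))) \<partial>lborel)"
      by (subst fourier_block_reproducing[OF g]) (rule norm_integral_le_nn_integral)
    also have "\<dots> = (\<integral>\<^sup>+y. ?w y * ?u y \<partial>lborel)"
      by (intro nn_integral_cong) (simp add: norm_mult ennreal_mult mult.commute)
    finally show ?thesis .
  qed
  then have "ennreal_rpow (ennreal (norm (fourier_block \<phi> g j x))) p \<le> ennreal_rpow (\<integral>\<^sup>+y. ?w y * ?u y \<partial>lborel) p"
    using p by (intro ennreal_rpow_mono) auto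
  also have "\<dots> \<le> ennreal (A powr (p - 1)) * (\<integral>\<^sup>+y. ?w y * ennreal_rpow (?u y) p \<partial>lborel)"
    by (rule nn_integral_Jensen_powr) (use A p nn_integral_tensor_kern_le in \<open>auto simp: A_def\<close>)
  \<comment> \<open>\<open>A powr (p - 1)\<close> is enlarged so that the whole bound becomes a p-th
    power.\<close>
  also have "\<dots> \<le> ennreal (A powr p) * (\<integral>\<^sup>+y. ennreal (2 ^ J) * ennreal (norm (fourier_block \<phi> g j y) powr p) \<partial>lborel)"
    using A abs_tensor_kern_le[of j] unfolding J_def
    by (intro mult_mono ennreal_leI powr_mono nn_integral_mono) auto
  also have "\<dots> = ennreal (A powr p) * (ennreal (2 ^ J) * (\<integral>\<^sup>+y. ennreal (norm (fourier_block \<phi> g j y) powr p) \<partial>lborel))"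
    by (subst nn_integral_cmult) auto
  also have "\<dots> \<le> ennreal (A powr p) * (ennreal (2 ^ J) * ennreal (c powr p))"
  proof -
    have "Lp_norm p lborel (fourier_block \<phi> g j) \<le> ennreal c" using c by simp
    then have "(\<integral>\<^sup>+y. ennreal (norm (fourier_block \<phi> g j y) powr p) \<partial>lborel) \<le> ennreal (c powr p)"
      by (subst (asm) Lp_norm_le_iff) (use p c(2) in auto)
    then show ?thesis by (intro mult_left_mono) auto
  qed
  also have "\<dots> = ennreal ((A * 2 powr (real J / p) * c) powr p)"
    using A c p by (simp add: powr_mult powr_powr powr_realpow ennreal_mult[symmetric] mult.assoc)
  finally have "norm (fourier_block \<phi> g j x) powr p \<le> (A * 2 powr (real J / p) * c) powr p"
    by simp
  then have "norm (fourier_block \<phi> g j x) \<le> A * 2 powr (real J / p) * c"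
    using powr_less_mono2[of p "A * 2 powr (real J / p) * c" "norm (fourier_block \<phi> g j x)"] p A c(2)
    by (force simp: not_le[symmetric])
  then show ?thesis by (simp add: A_def J_def)
qed

end

subsection \<open>Mixed differences of dyadic interpolation\<close>

definition dyadic_floor :: "nat \<Rightarrow> real \<Rightarrow> real" where
  "dyadic_floor k t = real_of_int \<lfloor>2 ^ k * t\<rfloor> / 2 ^ k"

definition grid_proj :: "nat ^ 'n \<Rightarrow> real ^ 'n \<Rightarrow> real ^ 'n" where
  "grid_proj l x = (\<chi> i. dyadic_floor (l $ i) (x $ i))"

text \<open>With \<open>I k\<close> the interpolation by dyadic step functions of level \<open>k\<close>, \<open>diff_coeff k\<close> lists the
  coefficients of \<open>I k - I (k - 1)\<close>, where \<open>I (-1) = 0\<close>.\<close>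

definition diff_coeff :: "nat \<Rightarrow> nat \<Rightarrow> real" where
  "diff_coeff k l = (if l = k then 1 else if Suc l = k then -1 else 0)"

text \<open>The sum runs over all of \<open>below k\<close>, although at most two indices per
  coordinate have a nonzero coefficient; a full product range is what \<open>prod_sum_below\<close>
  expands.\<close>

definition mixed_diff :: "(real ^ 'n \<Rightarrow> complex) \<Rightarrow> nat ^ 'n \<Rightarrow> real ^ 'n \<Rightarrow> complex" where
  "mixed_diff f k x = (\<Sum>l\<in>below k. complex_of_real (\<Prod>i\<in>UNIV. diff_coeff (k $ i) (l $ i)) * f (grid_proj l x))"

lemma dyadic_floor_le: "dyadic_floor k t \<le> t"
  and dyadic_floor_gt: "t - 1 / 2 ^ k < dyadic_floor k t"
proof -
  have "real_of_int \<lfloor>2 ^ k * t\<rfloor> \<le> 2 ^ k * t" "2 ^ k * t - 1 < real_of_int \<lfloor>2 ^ k * t\<rfloor>" by linarith+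
  from divide_right_mono[OF this(1), of "2 ^ k"] divide_strict_right_mono[OF this(2), of "2 ^ k"]
  show "dyadic_floor k t \<le> t" "t - 1 / 2 ^ k < dyadic_floor k t"
    by (simp_all add: dyadic_floor_def diff_divide_distrib)
qed

lemma dyadic_floor_Suc: "dyadic_floor k t \<le> dyadic_floor (Suc k) t"
proof -
  have "2 * \<lfloor>2 ^ k * t\<rfloor> \<le> \<lfloor>2 ^ Suc k * t\<rfloor>" by (simp add: le_floor_iff mult.assoc)
  then have "2 * real_of_int \<lfloor>2 ^ k * t\<rfloor> \<le> real_of_int \<lfloor>2 ^ Suc k * t\<rfloor>" by linarith
  then show ?thesis by (simp add: dyadic_floor_def field_simps)
qed

lemma dyadic_floor_unit: "0 \<le> t \<Longrightarrow> t \<le> 1 \<Longrightarrow> 0 \<le> dyadic_floor k t \<and> dyadic_floor k t \<le> 1"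
  using order_trans[OF dyadic_floor_le[of k t], of 1] by (simp add: dyadic_floor_def[of k t, THEN arg_cong[where f = "\<lambda>u. 0 \<le> u"]])

lemma dyadic_floor_measurable [measurable]: "dyadic_floor k \<in> borel_measurable borel"
  unfolding dyadic_floor_def[abs_def] by measurable

lemma borel_measurable_vec_lambda:
  fixes f :: "'n::finite \<Rightarrow> 'a \<Rightarrow> real"
  assumes [measurable]: "\<And>i. f i \<in> borel_measurable M"
  shows "(\<lambda>x. \<chi> i. f i x) \<in> borel_measurable M"
proof -
  have "(\<chi> i. f i x) = (\<Sum>i\<in>UNIV. f i x *\<^sub>R axis i 1)" for x
    using basis_expansion[of "\<chi> i. f i x"] by (simp add: scalar_mult_eq_scaleR)
  then show ?thesis by simp
qed

lemma grid_proj_measurable [measurable]: "grid_proj l \<in> borel_measurable borel"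
  unfolding grid_proj_def[abs_def] by (rule borel_measurable_vec_lambda) measurable

lemma grid_proj_in_cube: "x \<in> cube \<Longrightarrow> grid_proj l x \<in> cube"
  using dyadic_floor_unit by (auto simp: mem_box_cart grid_proj_def)

lemma grid_proj_box_tendsto: "(\<lambda>N. grid_proj (\<chi> i. N) x) \<longlonglongrightarrow> x"
proof (rule vec_tendstoI)
  fix i
  have lim: "(\<lambda>N. x $ i - 1 / 2 ^ N) \<longlonglongrightarrow> x $ i"
    using tendsto_diff[OF tendsto_const LIMSEQ_inverse_realpow_zero[of 2], of "x $ i"] by (simp add: inverse_eq_divide)
  show "(\<lambda>N. grid_proj (\<chi> i. N) x $ i) \<longlonglongrightarrow> x $ i"
    by (rule tendsto_sandwich[OF _ _ lim tendsto_const])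
      (auto simp: grid_proj_def dyadic_floor_le dyadic_floor_gt less_imp_le)
qed

lemma mixed_diff_measurable:
  assumes [measurable]: "f \<in> borel_measurable borel"
  shows "mixed_diff f k \<in> borel_measurable borel"
  unfolding mixed_diff_def[abs_def] by measurable

lemma mixed_diff_sum: "mixed_diff (\<lambda>z. \<Sum>j\<in>J. g j z) k x = (\<Sum>j\<in>J. mixed_diff (g j) k x)"
  unfolding mixed_diff_def sum_distrib_left by (rule sum.swap)

lemma mixed_diff_tendsto:
  assumes "\<And>l. (\<lambda>N. g N (grid_proj l x)) \<longlonglongrightarrow> f (grid_proj l x)"
  shows "(\<lambda>N. mixed_diff (g N) k x) \<longlonglongrightarrow> mixed_diff f k x"
  unfolding mixed_diff_def by (intro tendsto_intros assms)

text \<open>Telescoping: level \<open>l\<close> enters with 1 at \<open>k = l\<close> and with -1 at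
  \<open>k = Suc l\<close>, and the latter is out of range exactly when
  \<open>l = N\<close>.\<close>

lemma sum_diff_coeff: "l \<le> N \<Longrightarrow> (\<Sum>k\<le>N. diff_coeff k l) = of_bool (l = N)"
proof -
  assume l: "l \<le> N"
  have "diff_coeff k l = of_bool (k = l) - of_bool (k = Suc l)" for k
    by (auto simp: diff_coeff_def)
  then have "(\<Sum>k\<le>N. diff_coeff k l) = (\<Sum>k\<le>N. of_bool (k = l)) - (\<Sum>k\<le>N. of_bool (k = Suc l))"
    by (simp add: sum_subtractf)
  also have "(\<Sum>k\<le>N. of_bool (k = l)) = (1::real)" using l by (simp add: of_bool_def)
  also have "(\<Sum>k\<le>N. of_bool (k = Suc l)) = (of_bool (Suc l \<le> N) :: real)" by (simp add: of_bool_def)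
  finally show ?thesis using l by auto
qed

lemma sum_abs_diff_coeff_le: "(\<Sum>l\<le>k. \<bar>diff_coeff k l\<bar>) \<le> 2"
proof -
  have "(\<Sum>l\<le>k. \<bar>diff_coeff k l\<bar>) = (\<Sum>l\<in>{..k} \<inter> {k, k - 1}. \<bar>diff_coeff k l\<bar>)"
    by (rule sum.mono_neutral_right) (auto simp: diff_coeff_def)
  also have "\<dots> \<le> (\<Sum>l\<in>{k, k - 1}. \<bar>diff_coeff k l\<bar>)"
    by (rule sum_mono2) auto
  also have "\<dots> \<le> 2" by (cases "k = k - 1") (auto simp: diff_coeff_def)
  finally show ?thesis .
qed

lemma sum_mixed_diff_box: "(\<Sum>k\<in>box_index N. mixed_diff f k x) = f (grid_proj (\<chi> i. N) x)"
  for x :: "real ^ 'n"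
proof -
  let ?c = "\<lambda>k l. complex_of_real (\<Prod>i\<in>(UNIV :: 'n set). diff_coeff (k $ i) (l $ i))"
  \<comment> \<open>Padding with zero coefficients gives all inner sums the same range, so that the
    two sums can be swapped.\<close>
  have ext: "mixed_diff f k x = (\<Sum>l\<in>box_index N. ?c k l * f (grid_proj l x))" if "k \<in> box_index N" for k
    unfolding mixed_diff_def
  proof (rule sum.mono_neutral_left)
    show "below k \<subseteq> box_index N" using that by (auto simp: below_def intro: order_trans)
    show "\<forall>l\<in>box_index N - below k. ?c k l * f (grid_proj l x) = 0"
    proof
      fix l assume "l \<in> box_index N - below k"
      then obtain i where "k $ i < l $ i" by (auto simp: below_def not_le)
      then have "diff_coeff (k $ i) (l $ i) = 0" by (auto simp: diff_coeff_def)
      then have "(\<Prod>i\<in>(UNIV :: 'n set). diff_coeff (k $ i) (l $ i)) = 0"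
        by (intro prod_zero) auto
      then show "?c k l * f (grid_proj l x) = 0" by (simp only: of_real_0 mult_zero_left)
    qed
  qed simp
  have c: "(\<Sum>k\<in>box_index N. ?c k l) = of_bool (l = (\<chi> i. N))" if "l \<in> box_index N" for l
  proof -
    have "(\<Sum>k\<in>box_index N. \<Prod>i\<in>(UNIV :: 'n set). diff_coeff (k $ i) (l $ i)) = (\<Prod>i\<in>UNIV. \<Sum>k\<le>N. diff_coeff k (l $ i))"
      using prod_sum_below[of "\<lambda>i k. diff_coeff k (l $ i)" "\<chi> i. N"] by simp
    also have "\<dots> = (\<Prod>i\<in>UNIV. of_bool (l $ i = N))"
      using that by (intro prod.cong refl sum_diff_coeff) (simp add: below_def)
    also have "\<dots> = of_bool (l = (\<chi> i. N))"
      by (auto simp: vec_eq_iff)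
    finally have e: "(\<Sum>k\<in>box_index N. \<Prod>i\<in>(UNIV :: 'n set). diff_coeff (k $ i) (l $ i)) = of_bool (l = (\<chi> i. N))" .
    have "complex_of_real (\<Sum>k\<in>box_index N. \<Prod>i\<in>(UNIV :: 'n set). diff_coeff (k $ i) (l $ i)) = of_bool (l = (\<chi> i. N))"
      unfolding e by (simp add: of_bool_def)
    then show ?thesis by (simp only: of_real_sum)
  qed
  have "(\<Sum>k\<in>box_index N. mixed_diff f k x) = (\<Sum>k\<in>box_index N. \<Sum>l\<in>box_index N. ?c k l * f (grid_proj l x))"
    by (intro sum.cong refl ext)
  also have "\<dots> = (\<Sum>l\<in>box_index N. (\<Sum>k\<in>box_index N. ?c k l) * f (grid_proj l x))"
    unfolding sum_distrib_right by (rule sum.swap)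
  also have "\<dots> = (\<Sum>l\<in>box_index N. if l = (\<chi> i. N) then f (grid_proj l x) else 0)"
    by (intro sum.cong refl) (subst c, assumption, simp)
  also have "\<dots> = f (grid_proj (\<chi> i. N) x)"
    by (subst sum.delta[OF finite_below]) (simp add: below_def)
  finally show ?thesis .
qed

section \<open>Integral kernels of the mixed differences\<close>

definition diff_kern :: "nat \<Rightarrow> nat \<Rightarrow> real \<Rightarrow> real \<Rightarrow> real" where
  "diff_kern k j t y = (\<Sum>l\<le>k. diff_coeff k l * scaled_kern j (dyadic_floor l t - y))"

lemma diff_kern_measurable [measurable (raw)]:
  assumes [measurable]: "f \<in> borel_measurable M" "h \<in> borel_measurable M"
  shows "(\<lambda>x. diff_kern k j (f x) (h x)) \<in> borel_measurable M"
  unfolding diff_kern_def by measurable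

text \<open>The coefficients have total modulus at most 2, and reflection and translation do not
  change the mass of the kernel.\<close>

lemma diff_kern_row: "(\<integral>\<^sup>+y. ennreal \<bar>diff_kern k j t y\<bar> \<partial>lborel) \<le> ennreal (2 * kern_mass)"
proof -
  have "(\<integral>\<^sup>+y. ennreal \<bar>diff_kern k j t y\<bar> \<partial>lborel) \<le>
      (\<integral>\<^sup>+y. (\<Sum>l\<le>k. ennreal \<bar>diff_coeff k l\<bar> * ennreal \<bar>scaled_kern j (dyadic_floor l t - y)\<bar>) \<partial>lborel)"
  proof (intro nn_integral_mono)
    fix y
    have "\<bar>diff_kern k j t y\<bar> \<le> (\<Sum>l\<le>k. \<bar>diff_coeff k l\<bar> * \<bar>scaled_kern j (dyadic_floor l t - y)\<bar>)"
      unfolding diff_kern_def by (rule order_trans[OF sum_abs]) (simp add: abs_mult)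
    then show "ennreal \<bar>diff_kern k j t y\<bar> \<le> (\<Sum>l\<le>k. ennreal \<bar>diff_coeff k l\<bar> * ennreal \<bar>scaled_kern j (dyadic_floor l t - y)\<bar>)"
      by (simp add: ennreal_mult'[symmetric] sum_ennreal ennreal_leI)
  qed
  also have "\<dots> = (\<Sum>l\<le>k. ennreal \<bar>diff_coeff k l\<bar> * (\<integral>\<^sup>+y. ennreal \<bar>scaled_kern j (dyadic_floor l t - y)\<bar> \<partial>lborel))"
    by (simp add: nn_integral_sum nn_integral_cmult)
  also have "\<dots> \<le> (\<Sum>l\<le>k. ennreal \<bar>diff_coeff k l\<bar> * ennreal kern_mass)"
  proof (intro sum_mono mult_left_mono)
    show "(\<integral>\<^sup>+y. ennreal \<bar>scaled_kern j (dyadic_floor l t - y)\<bar> \<partial>lborel) \<le> ennreal kern_mass" for l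
      using nn_integral_lborel_reflect[of "\<lambda>y. ennreal \<bar>scaled_kern j y\<bar>" "dyadic_floor l t"]
        nn_integral_scaled_kern_le[of j] by simp
  qed simp
  also have "\<dots> = ennreal ((\<Sum>l\<le>k. \<bar>diff_coeff k l\<bar>) * kern_mass)"
    using kern_mass_ge_1 by (simp add: sum_distrib_right[symmetric] sum_ennreal ennreal_mult sum_nonneg)
  also have "\<dots> \<le> ennreal (2 * kern_mass)"
    using kern_mass_ge_1 sum_abs_diff_coeff_le by (intro ennreal_leI mult_right_mono) auto
  finally show ?thesis .
qed

text \<open>With the antiderivative \<open>Q\<close> of \<open>arctan\<close>, the integral becomes
  a difference of two increments of \<open>Q\<close> over steps of length
  \<open>a * \<delta>\<close>, divided by \<open>a\<close>. As \<open>arctan\<close> is bounded by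
  \<open>pi / 2\<close>, each costs at most \<open>pi / 2 * \<delta>\<close>, independently of
  \<open>a\<close> and \<open>y\<close>.\<close>

lemma arctan_shift_integral_le:
  assumes \<delta>: "0 \<le> \<delta>" and a: "0 < a"
  shows "(\<integral>\<^sup>+t. ennreal (arctan (a * (t - y)) - arctan (a * (t - \<delta> - y))) * indicator {0..1} t \<partial>lborel) \<le> ennreal (pi * \<delta>)"
proof -
  define Q where "Q = (\<lambda>s::real. s * arctan s - ln (1 + s\<^sup>2) / 2)"
  have Q': "(Q has_real_derivative arctan s) (at s)" for s
  proof -
    have "0 < 1 + s\<^sup>2" by (simp add: add_pos_nonneg)
    moreover have "((\<lambda>s. 1 + s\<^sup>2) has_real_derivative 2 * s) (at s)"
      by (auto intro!: derivative_eq_intros)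
    ultimately have "((\<lambda>s. ln (1 + s\<^sup>2) / 2) has_real_derivative inverse (1 + s\<^sup>2) * (2 * s) / 2) (at s)"
      by (intro DERIV_cdivide DERIV_chain2[OF DERIV_ln])
    from DERIV_diff[OF DERIV_mult[OF DERIV_ident DERIV_arctan] this] show ?thesis
      unfolding Q_def by (rule DERIV_cong) simp
  qed
  have lip: "\<bar>Q u - Q (u - b)\<bar> \<le> pi / 2 * b" if "0 \<le> b" for u b
  proof (cases "b = 0")
    case False
    with that have "u - b < u" by simp
    from MVT2[OF this, of Q arctan] Q' obtain z where "Q u - Q (u - b) = b * arctan z" by auto
    then have "\<bar>Q u - Q (u - b)\<bar> = b * \<bar>arctan z\<bar>" using that by (simp add: abs_mult)
    also have "\<dots> \<le> b * (pi / 2)"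
      using that arctan_lbound[of z] arctan_ubound[of z] by (intro mult_left_mono) auto
    finally show ?thesis by (simp add: mult.commute)
  qed simp
  define F where "F = (\<lambda>t. (Q (a * (t - y)) - Q (a * (t - \<delta> - y))) / a)"
  have "(\<integral>\<^sup>+t. ennreal (arctan (a * (t - y)) - arctan (a * (t - \<delta> - y))) * indicator {0..1} t \<partial>lborel) = ennreal (F 1 - F 0)"
  proof (rule nn_integral_FTC_Icc)
    show "DERIV F t :> arctan (a * (t - y)) - arctan (a * (t - \<delta> - y))" for t
    proof -
      have 1: "((\<lambda>t. Q (a * (t - y))) has_real_derivative arctan (a * (t - y)) * a) (at t)"
        by (rule DERIV_chain2[OF Q']) (auto intro!: derivative_eq_intros)
      have 2: "((\<lambda>t. Q (a * (t - \<delta> - y))) has_real_derivative arctan (a * (t - \<delta> - y)) * a) (at t)"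
        by (rule DERIV_chain2[OF Q']) (auto intro!: derivative_eq_intros)
      show ?thesis unfolding F_def
        by (rule DERIV_cong[OF DERIV_cdivide[OF DERIV_diff[OF 1 2]]]) (use a in \<open>simp add: field_simps\<close>)
    qed
    show "0 \<le> arctan (a * (t - y)) - arctan (a * (t - \<delta> - y))" for t
      using \<delta> a by (simp add: arctan_le_iff)
  qed (auto)
  also have "F 1 - F 0 \<le> pi * \<delta>"
  proof -
    have d: "a * (t - \<delta> - y) = a * (t - y) - a * \<delta>" for t by (simp add: algebra_simps)
    have "(Q (a * (1 - y)) - Q (a * (1 - \<delta> - y))) - (Q (a * (0 - y)) - Q (a * (0 - \<delta> - y))) \<le> pi / 2 * (a * \<delta>) + pi / 2 * (a * \<delta>)"
    proof -
      have "0 \<le> a * \<delta>" using \<delta> a by simp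
      from abs_le_D1[OF lip[OF this, of "a * (1 - y)"]] abs_le_D2[OF lip[OF this, of "a * (0 - y)"]]
      show ?thesis unfolding d by linarith
    qed
    also have "\<dots> = (pi * \<delta>) * a" by simp
    finally show ?thesis using a by (simp add: F_def diff_divide_distrib[symmetric] divide_le_eq)
  qed
  then have "ennreal (F 1 - F 0) \<le> ennreal (pi * \<delta>)" by (rule ennreal_leI)
  finally show ?thesis .
qed

text \<open>Both dyadic floors of \<open>t\<close> lie in an interval of length \<open>2 / 2 ^ k\<close> ending at \<open>t\<close>, so the variation of
  the kernel there is that of \<open>arctan\<close>, whose increments over such intervals integrate to at most
  \<open>pi\<close> times the length.\<close>

lemma diff_kern_column:
  "(\<integral>\<^sup>+t. ennreal \<bar>diff_kern k j t y\<bar> * indicator {0..1} t \<partial>lborel) \<le> ennreal (16 * pi * 2 ^ j / 2 ^ k)"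
proof (cases k)
  \<comment> \<open>At level 0 there is no difference to exploit; the supremum of the kernel
    suffices.\<close>
  case 0
  have "(\<integral>\<^sup>+t. ennreal \<bar>diff_kern k j t y\<bar> * indicator {0..1} t \<partial>lborel) \<le> (\<integral>\<^sup>+t. ennreal (2 ^ j) * indicator {0..1} (t::real) \<partial>lborel)"
  proof (intro nn_integral_mono mult_right_mono ennreal_leI)
    show "\<bar>diff_kern k j t y\<bar> \<le> 2 ^ j" for t
      using abs_kern_le_1[of "2 ^ j * (dyadic_floor 0 t - y)"]
      by (simp add: 0 diff_kern_def diff_coeff_def scaled_kern_def abs_mult mult_left_le)
  qed simp
  also have "\<dots> = ennreal (2 ^ j)" by (subst nn_integral_cmult_indicator) auto
  also have "\<dots> \<le> ennreal (16 * pi * 2 ^ j / 2 ^ k)"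
    using pi_gt3 by (intro ennreal_leI) (simp add: 0)
  finally show ?thesis .
next
  case (Suc m)
  define \<alpha> where "\<alpha> = (\<lambda>t. arctan (2 ^ j * (t - y)))"
  have mono: "\<alpha> s \<le> \<alpha> t" if "s \<le> t" for s t using that by (simp add: \<alpha>_def arctan_le_iff)
  have eq: "diff_kern k j t y = scaled_kern j (dyadic_floor (Suc m) t - y) - scaled_kern j (dyadic_floor m t - y)" for t
  proof -
    have "(\<Sum>l\<le>m. diff_coeff (Suc m) l * scaled_kern j (dyadic_floor l t - y)) = (\<Sum>l\<in>{m}. diff_coeff (Suc m) l * scaled_kern j (dyadic_floor l t - y))"
      by (rule sum.mono_neutral_right) (auto simp: diff_coeff_def)
    then show ?thesis by (simp add: diff_kern_def Suc diff_coeff_def)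
  qed
  have "\<bar>diff_kern k j t y\<bar> \<le> 8 * 2 ^ j * (arctan (2 ^ j * (t - y)) - arctan (2 ^ j * (t - 1 / 2 ^ m - y)))" for t
  proof -
    have "\<bar>diff_kern k j t y\<bar> = 2 ^ j * \<bar>kern (2 ^ j * (dyadic_floor (Suc m) t - y)) - kern (2 ^ j * (dyadic_floor m t - y))\<bar>"
      by (simp add: eq scaled_kern_def right_diff_distrib[symmetric] abs_mult)
    also have "\<dots> \<le> 2 ^ j * (8 * (\<alpha> (dyadic_floor (Suc m) t) - \<alpha> (dyadic_floor m t)))"
      unfolding \<alpha>_def using dyadic_floor_Suc[of m t] by (intro mult_left_mono kern_variation) auto
    also have "\<dots> \<le> 2 ^ j * (8 * (\<alpha> t - \<alpha> (t - 1 / 2 ^ m)))"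
      using mono[OF dyadic_floor_le[of "Suc m" t]] mono[OF less_imp_le[OF dyadic_floor_gt[of t m]]]
      by (intro mult_left_mono) auto
    finally show ?thesis by (simp only: \<alpha>_def mult_ac)
  qed
  then have "(\<integral>\<^sup>+t. ennreal \<bar>diff_kern k j t y\<bar> * indicator {0..1} t \<partial>lborel) \<le>
    (\<integral>\<^sup>+t. ennreal (8 * 2 ^ j) * (ennreal (arctan (2 ^ j * (t - y)) - arctan (2 ^ j * (t - 1 / 2 ^ m - y))) * indicator {0..1} t) \<partial>lborel)"
    by (intro nn_integral_mono) (simp add: mult.assoc[symmetric] ennreal_mult'[symmetric] mult_right_mono ennreal_leI)
  also have "\<dots> = ennreal (8 * 2 ^ j) * (\<integral>\<^sup>+t. ennreal (arctan (2 ^ j * (t - y)) - arctan (2 ^ j * (t - 1 / 2 ^ m - y))) * indicator {0..1} t \<partial>lborel)"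
    by (rule nn_integral_cmult) measurable
  also have "\<dots> \<le> ennreal (8 * 2 ^ j) * ennreal (pi * (1 / 2 ^ m))"
    by (intro mult_left_mono arctan_shift_integral_le) auto
  \<comment> \<open>\<open>2 ^ m\<close> is half of \<open>2 ^ k\<close>, which doubles the constant
    8.\<close>
  also have "\<dots> = ennreal (16 * pi * 2 ^ j / 2 ^ k)"
    by (simp add: Suc ennreal_mult'[symmetric])
  finally show ?thesis .
qed

lemma vec_nth_measurable [measurable (raw)]:
  fixes f :: "'a \<Rightarrow> real ^ 'n"
  assumes "f \<in> borel_measurable M"
  shows "(\<lambda>x. f x $ i) \<in> borel_measurable M"
  using measurable_compose[OF assms borel_measurable_continuous_onI[of "\<lambda>v. v $ i"]]
  by (simp add: continuous_on_component)

abbreviation level :: "nat ^ 'n \<Rightarrow> nat" where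
  "level k \<equiv> (\<Sum>i\<in>UNIV. k $ i)"

definition mixed_kern :: "nat ^ 'n \<Rightarrow> nat ^ 'n \<Rightarrow> real ^ 'n \<Rightarrow> real ^ 'n \<Rightarrow> real" where
  "mixed_kern k j x y = (\<Prod>i\<in>UNIV. diff_kern (k $ i) (j $ i) (x $ i) (y $ i))"

text \<open>The product form gives the row and column bounds coordinate by coordinate; the sum over
  nodes identifies the kernel as that of a mixed difference.\<close>

lemma mixed_kern_eq:
  "mixed_kern k j x y = (\<Sum>l\<in>below k. (\<Prod>i\<in>UNIV. diff_coeff (k $ i) (l $ i)) * tensor_kern j (grid_proj l x - y))"
  unfolding mixed_kern_def diff_kern_def tensor_kern_def grid_proj_def
  using prod_sum_below[of "\<lambda>i l. diff_coeff (k $ i) l * scaled_kern (j $ i) (dyadic_floor l (x $ i) - y $ i)" k]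
  by (simp add: prod.distrib)

lemma mixed_kern_row:
  "(\<integral>\<^sup>+y. ennreal \<bar>mixed_kern k j x y\<bar> \<partial>lborel) \<le> ennreal ((2 * kern_mass) ^ CARD('n))" for x :: "real ^ 'n"
proof -
  have "(\<integral>\<^sup>+y. ennreal \<bar>mixed_kern k j x y\<bar> \<partial>lborel) = (\<integral>\<^sup>+y. (\<Prod>i\<in>UNIV. ennreal \<bar>diff_kern (k $ i) (j $ i) (x $ i) (y $ i)\<bar>) \<partial>lborel)"
    by (simp add: mixed_kern_def abs_prod prod_ennreal)
  also have "\<dots> = (\<Prod>i\<in>UNIV. \<integral>\<^sup>+t. ennreal \<bar>diff_kern (k $ i) (j $ i) (x $ i) t\<bar> \<partial>lborel)"
    by (rule nn_integral_lborel_vec_prod) measurable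
  also have "\<dots> \<le> (\<Prod>i\<in>(UNIV :: 'n set). ennreal (2 * kern_mass))"
    by (intro prod_mono_ennreal diff_kern_row)
  also have "\<dots> = ennreal ((2 * kern_mass) ^ CARD('n))"
    using kern_mass_ge_1 by (simp add: ennreal_power del: ennreal_mult'')
  finally show ?thesis .
qed

lemma indicator_cube_prod: "(indicator cube x :: ennreal) = (\<Prod>i\<in>UNIV. indicator {0..1} (x $ i))" for x :: "real ^ 'n"
proof (cases "x \<in> cube")
  case True
  then show ?thesis by (simp add: mem_box_cart)
next
  case False
  then obtain i where "x $ i \<notin> {0..1}" by (auto simp: mem_box_cart)
  then have "(\<Prod>i\<in>UNIV. indicator {0..1} (x $ i) :: ennreal) = 0" by (intro prod_zero bexI[of _ i]) auto
  then show ?thesis using False by simp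
qed

lemma mixed_kern_column:
  "(\<integral>\<^sup>+x. ennreal \<bar>mixed_kern k j x y\<bar> * indicator cube x \<partial>lborel)
    \<le> ennreal ((16 * pi) ^ CARD('n) * (2 ^ level j / 2 ^ level k))" for y :: "real ^ 'n"
proof -
  have "(\<integral>\<^sup>+x. ennreal \<bar>mixed_kern k j x y\<bar> * indicator cube x \<partial>lborel) =
     (\<integral>\<^sup>+x. (\<Prod>i\<in>UNIV. ennreal \<bar>diff_kern (k $ i) (j $ i) (x $ i) (y $ i)\<bar> * indicator {0..1} (x $ i)) \<partial>lborel)"
    unfolding indicator_cube_prod by (simp add: mixed_kern_def abs_prod prod_ennreal prod.distrib)
  also have "\<dots> = (\<Prod>i\<in>UNIV. \<integral>\<^sup>+t. ennreal \<bar>diff_kern (k $ i) (j $ i) t (y $ i)\<bar> * indicator {0..1} t \<partial>lborel)"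
    by (rule nn_integral_lborel_vec_prod) measurable
  also have "\<dots> \<le> (\<Prod>i\<in>UNIV. ennreal (16 * pi * 2 ^ (j $ i) / 2 ^ (k $ i)))"
    by (intro prod_mono_ennreal diff_kern_column)
  also have "\<dots> = ennreal (\<Prod>i\<in>UNIV. 16 * pi * (2 ^ (j $ i) / 2 ^ (k $ i)))"
    by (subst prod_ennreal) auto
  also have "(\<Prod>i\<in>UNIV. 16 * pi * (2 ^ (j $ i) / 2 ^ (k $ i))) = (16 * pi) ^ CARD('n) * (2 ^ level j / 2 ^ level k)"
    unfolding prod.distrib prod_dividef power_sum by simp
  finally show ?thesis .
qed

context dyadic
begin

text \<open>The reproducing formula is applied at each of the finitely many nodes. Boundedness of
  the block makes the single integrals converge, so that they can be added.\<close>

lemma mixed_diff_fourier_block: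
  fixes g :: "real ^ 'n \<Rightarrow> complex"
  assumes g: "integrable lborel g" and B: "\<And>y. norm (fourier_block \<phi> g j y) \<le> B"
  shows "mixed_diff (fourier_block \<phi> g j) k x = (LINT y|lborel. fourier_block \<phi> g j y * complex_of_real (mixed_kern k j x y))"
proof -
  note [measurable] = fourier_block_measurable[OF g]
  let ?G = "fourier_block \<phi> g j"
  have int: "integrable lborel (\<lambda>y. ?G y * complex_of_real (tensor_kern j (z - y)))" for z
  proof (rule Bochner_Integration.integrable_bound)
    show "integrable lborel (\<lambda>y. complex_of_real B * complex_of_real (tensor_kern j (z - y)))"
      by (intro integrable_mult_right integrable_lborel_reflect integrable_tensor_kern)
    have "norm (?G y) \<le> \<bar>B\<bar>" for y using B[of y] by simp
    then show "AE y in lborel. norm (?G y * complex_of_real (tensor_kern j (z - y))) \<le> norm (complex_of_real B * complex_of_real (tensor_kern j (z - y)))"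
      by (intro AE_I2) (simp add: norm_mult mult_right_mono)
  qed measurable
  have "mixed_diff ?G k x = (\<Sum>l\<in>below k. complex_of_real (\<Prod>i\<in>UNIV. diff_coeff (k $ i) (l $ i)) *
      (LINT y|lborel. ?G y * complex_of_real (tensor_kern j (grid_proj l x - y))))"
    unfolding mixed_diff_def by (subst fourier_block_reproducing[OF g]) rule
  also have "\<dots> = (LINT y|lborel. (\<Sum>l\<in>below k. complex_of_real (\<Prod>i\<in>UNIV. diff_coeff (k $ i) (l $ i)) *
      (?G y * complex_of_real (tensor_kern j (grid_proj l x - y)))))"
    by (subst Bochner_Integration.integral_sum) (intro integrable_mult_right int, simp only: integral_mult_right_zero)
  also have "\<dots> = (LINT y|lborel. ?G y * complex_of_real (mixed_kern k j x y))"
    by (intro Bochner_Integration.integral_cong refl)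
      (simp only: mixed_kern_eq of_real_sum of_real_mult sum_distrib_left mult_ac)
  finally show ?thesis .
qed

text \<open>Schur test: the rows of the mixed kernel are bounded uniformly and its columns by
  \<open>2 ^ level j / 2 ^ level k\<close>, which enters with the power \<open>1 / p\<close>.\<close>

lemma Lp_norm_mixed_diff_block_le:
  fixes g :: "real ^ 'n \<Rightarrow> complex"
  assumes g: "integrable lborel g" and p: "1 \<le> p"
    and c: "Lp_norm p lborel (fourier_block \<phi> g j) = ennreal c" "0 \<le> c"
  shows "Lp_norm p cube_measure (mixed_diff (fourier_block \<phi> g j) k) \<le>
    ennreal ((2 * kern_mass) ^ CARD('n) * (16 * pi) ^ CARD('n) * 2 powr (- real (level k) / p) * (2 powr (real (level j) / p) * c))"
proof -
  note [measurable] = fourier_block_measurable[OF g]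
  let ?G = "fourier_block \<phi> g j"
  define A where "A = (2 * kern_mass) ^ CARD('n)"
  define E where "E = (16 * pi) ^ CARD('n)"
  define q where "q = (2::real) ^ level j / 2 ^ level k"
  have A: "1 \<le> A" unfolding A_def using kern_mass_ge_1 by (intro one_le_power) simp
  have E: "1 \<le> E" unfolding E_def using pi_gt3 by (intro one_le_power) simp
  have q: "0 < q" by (simp add: q_def)
  have [measurable]: "(\<lambda>z. mixed_kern k j (fst z) (snd z)) \<in> borel_measurable (lborel \<Otimes>\<^sub>M lborel)"
    unfolding mixed_kern_def by measurable
  have [measurable]: "mixed_kern k j x \<in> borel_measurable borel" "(\<lambda>x. mixed_kern k j x y) \<in> borel_measurable borel" for x y
    unfolding mixed_kern_def by measurable
  have Lp: "(\<integral>\<^sup>+y. ennreal (norm (?G y) powr p) \<partial>lborel) \<le> ennreal (c powr p)"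
  proof -
    have "Lp_norm p lborel ?G \<le> ennreal c" using c by simp
    then show ?thesis by (subst (asm) Lp_norm_le_iff) (use p c(2) in auto)
  qed
  have pt: "ennreal (norm (mixed_diff ?G k x) powr p) \<le>
      ennreal (A powr (p - 1)) * (\<integral>\<^sup>+y. ennreal \<bar>mixed_kern k j x y\<bar> * ennreal (norm (?G y) powr p) \<partial>lborel)" for x
  proof -
    have "ennreal (norm (mixed_diff ?G k x)) \<le> (\<integral>\<^sup>+y. norm (?G y * complex_of_real (mixed_kern k j x y)) \<partial>lborel)"
      using mixed_diff_fourier_block[OF g fourier_block_Nikolskii[OF g p c], of k x] norm_integral_le_nn_integral
      by metis
    also have "\<dots> = (\<integral>\<^sup>+y. ennreal \<bar>mixed_kern k j x y\<bar> * ennreal (norm (?G y)) \<partial>lborel)"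
      by (intro nn_integral_cong) (simp add: norm_mult ennreal_mult mult.commute)
    finally have "ennreal_rpow (ennreal (norm (mixed_diff ?G k x))) p \<le>
       ennreal_rpow (\<integral>\<^sup>+y. ennreal \<bar>mixed_kern k j x y\<bar> * ennreal (norm (?G y)) \<partial>lborel) p"
      using p by (intro ennreal_rpow_mono) auto
    also have "\<dots> \<le> ennreal (A powr (p - 1)) * (\<integral>\<^sup>+y. ennreal \<bar>mixed_kern k j x y\<bar> * ennreal_rpow (ennreal (norm (?G y))) p \<partial>lborel)"
      by (rule nn_integral_Jensen_powr) (use A p mixed_kern_row in \<open>auto simp: A_def\<close>)
    finally show ?thesis by simp
  qed
  have "(\<integral>\<^sup>+x. ennreal (norm (mixed_diff ?G k x) powr p) \<partial>cube_measure) =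
    (\<integral>\<^sup>+x. ennreal (norm (mixed_diff ?G k x) powr p) * indicator cube x \<partial>lborel)"
    by (rule nn_integral_restrict_space) simp
  also have "\<dots> \<le> (\<integral>\<^sup>+x. ennreal (A powr (p - 1)) * (\<integral>\<^sup>+y. ennreal \<bar>mixed_kern k j x y\<bar> * ennreal (norm (?G y) powr p) \<partial>lborel) * indicator cube x \<partial>lborel)"
    by (intro nn_integral_mono mult_right_mono pt) simp
  \<comment> \<open>The factors are regrouped so that after Fubini the inner integral is a column of
    the kernel.\<close>
  also have "\<dots> = (\<integral>\<^sup>+x. ennreal (A powr (p - 1)) * (\<integral>\<^sup>+y. ennreal (norm (?G y) powr p) * (ennreal \<bar>mixed_kern k j x y\<bar> * indicator cube x) \<partial>lborel) \<partial>lborel)"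
    by (intro nn_integral_cong, case_tac "x \<in> cube") (simp_all add: mult.commute)
  also have "\<dots> = ennreal (A powr (p - 1)) * (\<integral>\<^sup>+x. \<integral>\<^sup>+y. ennreal (norm (?G y) powr p) * (ennreal \<bar>mixed_kern k j x y\<bar> * indicator cube x) \<partial>lborel \<partial>lborel)"
    by (rule nn_integral_cmult) measurable
  also have "(\<integral>\<^sup>+x. \<integral>\<^sup>+y. ennreal (norm (?G y) powr p) * (ennreal \<bar>mixed_kern k j x y\<bar> * indicator cube x) \<partial>lborel \<partial>lborel) =
     (\<integral>\<^sup>+y. \<integral>\<^sup>+x. ennreal (norm (?G y) powr p) * (ennreal \<bar>mixed_kern k j x y\<bar> * indicator cube x) \<partial>lborel \<partial>lborel)"
    by (rule lborel_pair.Fubini'[symmetric]) measurable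
  also have "\<dots> = (\<integral>\<^sup>+y. ennreal (norm (?G y) powr p) * (\<integral>\<^sup>+x. ennreal \<bar>mixed_kern k j x y\<bar> * indicator cube x \<partial>lborel) \<partial>lborel)"
    by (intro nn_integral_cong nn_integral_cmult) measurable
  also have "\<dots> \<le> (\<integral>\<^sup>+y. ennreal (norm (?G y) powr p) * ennreal (E * q) \<partial>lborel)"
    unfolding E_def q_def by (intro nn_integral_mono mult_left_mono mixed_kern_column) simp
  also have "\<dots> = (\<integral>\<^sup>+y. ennreal (norm (?G y) powr p) \<partial>lborel) * ennreal (E * q)"
    by (rule nn_integral_multc) measurable
  also have "\<dots> \<le> ennreal (c powr p) * ennreal (E * q)"
    by (intro mult_right_mono Lp) simp
  also have "ennreal (A powr (p - 1)) * (ennreal (c powr p) * ennreal (E * q)) = ennreal (A powr (p - 1) * E * (q * c powr p))"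
    using E q by (simp add: ennreal_mult'[symmetric] mult_ac)
  \<comment> \<open>\<open>A\<close> and \<open>E\<close> are at least 1, so they may be raised to
    the power \<open>p\<close>; the p-th root then leaves the plain constant
    \<open>A * E\<close>.\<close>
  also have "\<dots> \<le> ennreal (A powr p * E powr p * (q * c powr p))"
  proof (intro ennreal_leI mult_right_mono mult_mono)
    show "A powr (p - 1) \<le> A powr p" using A by (intro powr_mono) auto
    show "E \<le> E powr p" using powr_mono[of 1 p E] E p by simp
  qed (use E q in auto)
  also have "A powr p * E powr p * (q * c powr p) = (A * E * 2 powr (- real (level k) / p) * (2 powr (real (level j) / p) * c)) powr p"
  proof -
    have "(2 powr (- real s / p)) powr p = 2 powr (- real s)" "(2 powr (real s / p)) powr p = 2 powr real s" for s
      using p by (simp_all add: powr_powr)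
    then have "(2 powr (- real s / p)) powr p = 1 / 2 ^ s" "(2 powr (real s / p)) powr p = 2 ^ s" for s
      by (simp_all add: powr_minus powr_realpow divide_inverse)
    then have "q = (2 powr (- real (level k) / p)) powr p * (2 powr (real (level j) / p)) powr p"
      by (simp only: q_def) simp
    then show ?thesis using A E c p by (simp add: powr_mult)
  qed
  finally have "(\<integral>\<^sup>+x. ennreal (norm (mixed_diff ?G k x) powr p) \<partial>cube_measure) \<le>
     ennreal ((A * E * 2 powr (- real (level k) / p) * (2 powr (real (level j) / p) * c)) powr p)"
    by (simp add: mult_left_mono)
  then show ?thesis
    using p A E c by (subst Lp_norm_le_iff) (auto simp: A_def E_def)
qed

end

section \<open>Counting levels and nodes\<close>

lemma finite_level: "finite {k :: nat ^ 'n. level k = s}"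
  and card_level: "card {k :: nat ^ 'n. level k = s} \<le> (s + 1) ^ (CARD('n) - 1)"
proof -
  \<comment> \<open>An arbitrary coordinate: within a level it is determined by the others, which is
    why the exponent is \<open>CARD('n) - 1\<close>.\<close>
  obtain i0 :: 'n where True by simp
  let ?I = "UNIV - {i0}"
  let ?r = "\<lambda>k :: nat ^ 'n. restrict (vec_nth k) ?I"
  have split: "level k = k $ i0 + (\<Sum>i\<in>?I. k $ i)" for k :: "nat ^ 'n"
    by (rule sum.remove) auto
  have inj: "inj_on ?r {k. level k = s}"
  proof (rule inj_onI)
    fix k k' :: "nat ^ 'n"
    assume k: "k \<in> {k. level k = s}" and k': "k' \<in> {k. level k = s}" and r: "?r k = ?r k'"
    have off: "k $ i = k' $ i" if "i \<noteq> i0" for i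
      using fun_cong[OF r, of i] that by simp
    then have "(\<Sum>i\<in>?I. k $ i) = (\<Sum>i\<in>?I. k' $ i)" by (intro sum.cong) auto
    then have "k $ i0 = k' $ i0" using k k' split[of k] split[of k'] by simp
    with off show "k = k'" unfolding vec_eq_iff by metis
  qed
  have sub: "?r ` {k. level k = s} \<subseteq> PiE ?I (\<lambda>_. {..s})"
  proof (intro image_subsetI)
    fix k :: "nat ^ 'n" assume "k \<in> {k. level k = s}"
    then have "k $ i \<le> s" for i using member_le_sum[of i UNIV "\<lambda>i. k $ i"] by simp
    then show "?r k \<in> PiE ?I (\<lambda>_. {..s})" by auto
  qed
  have fin: "finite (PiE ?I (\<lambda>_. {..s}))" by (intro finite_PiE) auto
  show "finite {k :: nat ^ 'n. level k = s}"
    using finite_imageD[OF finite_subset[OF sub fin] inj] .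
  have "card {k :: nat ^ 'n. level k = s} \<le> card (PiE ?I (\<lambda>_. {..s}))"
    using card_inj_on_le[OF inj sub fin] .
  also have "\<dots> = (s + 1) ^ (CARD('n) - 1)" by (simp add: card_PiE card_Diff_singleton)
  finally show "card {k :: nat ^ 'n. level k = s} \<le> (s + 1) ^ (CARD('n) - 1)" .
qed

text \<open>Grouping by level. \<open>S\<close> may exceed the set of levels that occur, so that
  convenient ranges of summation can be chosen.\<close>

lemma sum_level_le:
  fixes h :: "nat \<Rightarrow> real" and F :: "(nat ^ 'n) set"
  assumes F: "finite F" and h: "\<And>s. 0 \<le> h s" and S: "finite S" "level ` F \<subseteq> S"
  shows "(\<Sum>k\<in>F. h (level k)) \<le> (\<Sum>s\<in>S. real (s + 1) ^ (CARD('n) - 1) * h s)"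
proof -
  have "(\<Sum>k\<in>F. h (level k)) = (\<Sum>s\<in>level ` F. \<Sum>k\<in>{k \<in> F. level k = s}. h (level k))"
    by (rule sum.image_gen[OF F])
  also have "\<dots> = (\<Sum>s\<in>level ` F. real (card {k \<in> F. level k = s}) * h s)"
    by (intro sum.cong refl) simp
  also have "\<dots> \<le> (\<Sum>s\<in>level ` F. real (s + 1) ^ (CARD('n) - 1) * h s)"
  proof (intro sum_mono mult_right_mono h)
    fix s
    have "card {k \<in> F. level k = s} \<le> card {k :: nat ^ 'n. level k = s}"
      by (intro card_mono finite_level) auto
    also note card_level
    finally have "real (card {k \<in> F. level k = s}) \<le> real ((s + 1) ^ (CARD('n) - 1))"
      by (simp only: of_nat_le_iff)
    then show "real (card {k \<in> F. level k = s}) \<le> real (s + 1) ^ (CARD('n) - 1)"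
      by (simp only: of_nat_power)
  qed
  also have "\<dots> \<le> (\<Sum>s\<in>S. real (s + 1) ^ (CARD('n) - 1) * h s)"
    using S h by (intro sum_mono2) auto
  finally show ?thesis .
qed

text \<open>Writing levels as \<open>n + t\<close> and using
  \<open>n + t + 1 \<le> (n + 1) * (1 + t)\<close> separates the dependence on \<open>n\<close> from
  a convergent series in \<open>t\<close>, whose sum yields a constant valid for all
  \<open>n\<close>. Finite sets \<open>F\<close> are enough, as the error is a limit of finite
  sums.\<close>

lemma level_tail_bound:
  assumes p: "1 \<le> p"
  shows "\<exists>C>0. \<forall>n (F :: (nat ^ 'n) set). finite F \<longrightarrow> (\<forall>k\<in>F. n \<le> level k) \<longrightarrow>
    (\<Sum>k\<in>F. 2 powr (- real (level k) / p)) \<le> C * real (n + 1) ^ (CARD('n) - 1) * 2 powr (- real n / p)"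
proof -
  define D where "D = CARD('n) - 1"
  define a where "a = ln 2 / p"
  have a: "0 < a" using p by (simp add: a_def)
  define h where "h = (\<lambda>s::nat. exp (- a * real s))"
  have h: "2 powr (- real s / p) = h s" for s
    by (simp add: h_def a_def powr_def mult.commute)
  define f where "f = (\<lambda>t. (1 + real t) ^ D * h t)"
  have f0: "0 \<le> f t" for t by (simp add: f_def h_def)
  have "summable f"
  proof (rule summable_comparison_test_bigo)
    show "summable (\<lambda>t. norm (1 / real t ^ 2))"
      using inverse_power_summable[of 2] by (simp add: inverse_eq_divide)
    show "f \<in> O(\<lambda>t. 1 / real t ^ 2)"
      unfolding f_def h_def using a by real_asymp
  qed
  define C where "C = 1 + suminf f"
  have C: "0 < C" using suminf_nonneg[OF \<open>summable f\<close> f0] by (simp add: C_def)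
  have "(\<Sum>k\<in>F. h (level k)) \<le> C * real (n + 1) ^ D * h n"
    if F: "finite F" "\<forall>k\<in>F. n \<le> level k" for n and F :: "(nat ^ 'n) set"
  proof -
    obtain N where N: "\<And>k. k \<in> F \<Longrightarrow> level k \<le> N"
      using finite_imageI[OF F(1), of level] by (auto simp: finite_nat_set_iff_bounded_le)
    have "(\<Sum>k\<in>F. h (level k)) \<le> (\<Sum>s\<in>(\<lambda>t. n + t) ` {..N}. real (s + 1) ^ D * h s)"
      unfolding D_def
    proof (rule sum_level_le[OF F(1)])
      show "level ` F \<subseteq> (\<lambda>t. n + t) ` {..N}"
      proof
        fix s assume "s \<in> level ` F"
        then have "n \<le> s" "s \<le> N" using F(2) N by auto
        then show "s \<in> (\<lambda>t. n + t) ` {..N}" by (intro image_eqI[of _ _ "s - n"]) auto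
      qed
    qed (auto simp: h_def)
    also have "\<dots> = (\<Sum>t\<le>N. real (n + t + 1) ^ D * h (n + t))"
      by (subst sum.reindex) (auto simp: inj_on_def)
    also have "\<dots> \<le> (\<Sum>t\<le>N. real (n + 1) ^ D * h n * f t)"
    proof (intro sum_mono)
      fix t
      have "real (n + t + 1) \<le> real (n + 1) * (1 + real t)" by (simp add: algebra_simps)
      then have "real (n + t + 1) ^ D \<le> (real (n + 1) * (1 + real t)) ^ D" by (intro power_mono) auto
      then have "real (n + t + 1) ^ D * (h n * h t) \<le> (real (n + 1) * (1 + real t)) ^ D * (h n * h t)"
        by (intro mult_right_mono) (auto simp: h_def)
      moreover have "h (n + t) = h n * h t" by (simp add: h_def exp_add[symmetric] algebra_simps)
      ultimately show "real (n + t + 1) ^ D * h (n + t) \<le> real (n + 1) ^ D * h n * f t"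
        by (simp only: f_def power_mult_distrib mult_ac)
    qed
    also have "\<dots> = real (n + 1) ^ D * h n * (\<Sum>t\<le>N. f t)" by (simp add: sum_distrib_left)
    also have "\<dots> \<le> real (n + 1) ^ D * h n * C"
    proof (intro mult_left_mono)
      have "(\<Sum>t\<le>N. f t) \<le> suminf f" by (rule sum_le_suminf[OF \<open>summable f\<close>]) (use f0 in auto)
      then show "(\<Sum>t\<le>N. f t) \<le> C" by (simp add: C_def)
    qed (simp add: h_def)
    finally show ?thesis by (simp add: mult_ac)
  qed
  with C show ?thesis unfolding h D_def by blast
qed

definition grid :: "nat \<Rightarrow> (real ^ 'n) set" where
  "grid n = (\<Union>l\<in>{l. level l < n}. grid_proj l ` cube)"

lemma finite_level_less: "finite {l :: nat ^ 'n. level l < n}"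
proof -
  have "{l :: nat ^ 'n. level l < n} = (\<Union>s<n. {l. level l = s})" by auto
  then show ?thesis by (simp add: finite_level)
qed

text \<open>Each coordinate has at most \<open>2 ^ (l $ i) + 1\<close> values, the extra one because
  the end point 1 is its own dyadic floor; doubling absorbs it and produces
  \<open>2 ^ CARD('n)\<close>.\<close>

lemma finite_grid_proj: "finite (grid_proj l ` cube)" 
  and card_grid_proj: "card (grid_proj l ` cube) \<le> 2 ^ CARD('n) * 2 ^ level l"
  for l :: "nat ^ 'n"
proof -
  let ?P = "PiE UNIV (\<lambda>i. {..2 ^ (l $ i)}) :: ('n \<Rightarrow> nat) set"
  let ?v = "\<lambda>g :: 'n \<Rightarrow> nat. \<chi> i. real (g i) / 2 ^ (l $ i)"
  have sub: "grid_proj l ` cube \<subseteq> ?v ` ?P"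
  proof (intro image_subsetI)
    fix x :: "real ^ 'n" assume x: "x \<in> cube"
    define g where "g = (\<lambda>i. nat \<lfloor>2 ^ (l $ i) * x $ i\<rfloor>)"
    have x01: "0 \<le> x $ i" "x $ i \<le> 1" for i using x by (auto simp: mem_box_cart)
    have "g i \<le> 2 ^ (l $ i)" for i
    proof -
      have "2 ^ (l $ i) * x $ i \<le> 2 ^ (l $ i)" using x01 by (simp add: mult_left_le)
      from floor_mono[OF this] have "\<lfloor>2 ^ (l $ i) * x $ i\<rfloor> \<le> 2 ^ (l $ i)" by simp
      then show ?thesis by (simp add: g_def nat_le_iff)
    qed
    then have "g \<in> ?P" by auto
    moreover have "grid_proj l x = ?v g"
      using x01 by (simp add: vec_eq_iff grid_proj_def dyadic_floor_def g_def)
    ultimately show "grid_proj l x \<in> ?v ` ?P" by blast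
  qed
  have fin: "finite ?P" by (intro finite_PiE) auto
  show "finite (grid_proj l ` cube)" by (rule finite_subset[OF sub finite_imageI[OF fin]])
  have "card (grid_proj l ` cube) \<le> card (?v ` ?P)" by (rule card_mono[OF finite_imageI[OF fin] sub])
  also have "\<dots> \<le> card ?P" by (rule card_image_le[OF fin])
  also have "\<dots> = (\<Prod>i\<in>UNIV. 2 ^ (l $ i) + 1)" by (simp add: card_PiE)
  also have "\<dots> \<le> (\<Prod>i\<in>UNIV. 2 * 2 ^ (l $ i))"
    by (rule prod_mono) simp
  also have "\<dots> = 2 ^ CARD('n) * 2 ^ level l" by (simp add: prod.distrib power_sum)
  finally show "card (grid_proj l ` cube) \<le> 2 ^ CARD('n) * 2 ^ level l" .
qed

lemma finite_grid: "finite (grid n)"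
  unfolding grid_def by (intro finite_UN_I finite_level_less finite_grid_proj)

lemma grid_subset_cube: "grid n \<subseteq> cube"
  unfolding grid_def using grid_proj_in_cube by blast

text \<open>The union bound loses no further power of \<open>n\<close>, because the geometric sum
  over the levels stays below \<open>2 ^ n\<close>.\<close>

lemma card_grid: "real (card (grid n :: (real ^ 'n) set)) \<le> 2 ^ CARD('n) * real (n + 1) ^ (CARD('n) - 1) * 2 ^ n"
proof -
  have "card (grid n :: (real ^ 'n) set) \<le> (\<Sum>l\<in>{l :: nat ^ 'n. level l < n}. card (grid_proj l ` cube))"
    unfolding grid_def by (rule card_UN_le[OF finite_level_less])
  also have "\<dots> \<le> (\<Sum>l\<in>{l :: nat ^ 'n. level l < n}. 2 ^ CARD('n) * 2 ^ level l)"
    by (intro sum_mono card_grid_proj)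
  finally have "real (card (grid n :: (real ^ 'n) set)) \<le> real (\<Sum>l\<in>{l :: nat ^ 'n. level l < n}. 2 ^ CARD('n) * 2 ^ level l)"
    by (simp only: of_nat_le_iff)
  also have "\<dots> = (\<Sum>l\<in>{l :: nat ^ 'n. level l < n}. 2 ^ CARD('n) * 2 ^ level l)" by simp
  also have "\<dots> \<le> (\<Sum>s<n. real (s + 1) ^ (CARD('n) - 1) * (2 ^ CARD('n) * 2 ^ s))"
    by (rule sum_level_le[where h = "\<lambda>s. 2 ^ CARD('n) * 2 ^ s"]) (use finite_level_less in auto)
  also have "\<dots> \<le> (\<Sum>s<n. real (n + 1) ^ (CARD('n) - 1) * (2 ^ CARD('n) * 2 ^ s))"
    by (intro sum_mono mult_right_mono power_mono) auto
  also have "\<dots> = real (n + 1) ^ (CARD('n) - 1) * 2 ^ CARD('n) * (\<Sum>s<n. 2 ^ s)"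
    by (simp add: sum_distrib_left mult.assoc)
  also have "(\<Sum>s<n. (2::real) ^ s) = 2 ^ n - 1" by (simp add: geometric_sum)
  also have "real (n + 1) ^ (CARD('n) - 1) * 2 ^ CARD('n) * (2 ^ n - 1) \<le> real (n + 1) ^ (CARD('n) - 1) * 2 ^ CARD('n) * 2 ^ n"
    by (intro mult_left_mono) auto
  finally show ?thesis by (simp add: mult_ac)
qed

subsection \<open>Smolyak sampling\<close>

lemma ennreal_sum_le_infsum:
  fixes h :: "'a \<Rightarrow> ennreal"
  assumes "finite F"
  shows "(\<Sum>j\<in>F. h j) \<le> (\<Sum>\<^sub>\<infinity>j\<in>UNIV. h j)"
proof -
  have "(\<Sum>\<^sub>\<infinity>j\<in>UNIV. h j) = (SUP F\<in>{F. finite F \<and> F \<subseteq> UNIV}. \<Sum>j\<in>F. h j)"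
    by (rule nonneg_infsum_complete) simp
  then show ?thesis using assms by (auto intro: SUP_upper)
qed

lemma mixed_diff_cong:
  assumes "\<And>l. l \<in> below k \<Longrightarrow> f (grid_proj l x) = g (grid_proj l x)"
  shows "mixed_diff f k x = mixed_diff g k x"
  unfolding mixed_diff_def using assms by (intro sum.cong) auto

lemma Lp_norm_cube_cong:
  assumes "\<And>x. x \<in> cube \<Longrightarrow> f x = g x"
  shows "Lp_norm p cube_measure f = Lp_norm p cube_measure g"
proof -
  have "(\<integral>\<^sup>+x. ennreal (norm (f x) powr p) \<partial>cube_measure) = (\<integral>\<^sup>+x. ennreal (norm (g x) powr p) \<partial>cube_measure)"
    using assms by (intro nn_integral_cong) (simp add: space_restrict_space)
  then show ?thesis by (simp add: Lp_norm_def)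
qed

text \<open>The inequality is strict, so \<open>smolyak 0\<close> is zero and uses no nodes; this covers the small values
  of \<open>m\<close>.\<close>

definition smolyak :: "nat \<Rightarrow> (real ^ 'n \<Rightarrow> complex) \<Rightarrow> real ^ 'n \<Rightarrow> complex" where
  "smolyak n f x = (\<Sum>k\<in>{k. level k < n}. mixed_diff f k x)"

text \<open>The index vectors below \<open>k\<close> have no larger level than \<open>k\<close>, so
  only nodes of \<open>grid n\<close> are read. This makes the algorithm a function of the
  samples.\<close>

lemma smolyak_cong:
  fixes x :: "real ^ 'n"
  assumes x: "x \<in> cube" and fg: "\<And>z. z \<in> grid n \<Longrightarrow> f z = g z"
  shows "smolyak n f x = smolyak n g x"
  unfolding smolyak_def
proof (intro sum.cong refl mixed_diff_cong fg)
  fix k l :: "nat ^ 'n" assume k: "k \<in> {k. level k < n}" and l: "l \<in> below k"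
  have "level l \<le> level k" using l by (intro sum_mono) (simp add: below_def)
  then have "level l < n" using k by simp
  then show "grid_proj l x \<in> grid n" using x unfolding grid_def by blast
qed

lemma smolyak_measurable:
  "f \<in> borel_measurable borel \<Longrightarrow> smolyak n f \<in> borel_measurable borel"
  unfolding smolyak_def[abs_def] by (intro borel_measurable_sum mixed_diff_measurable)

text \<open>The reconstruction map has to send every vector of values into L_p, not only those
  sampled from continuous functions; boundedness together with measurability ensures this.\<close>

lemma smolyak_bounded:
  fixes f :: "real ^ 'n \<Rightarrow> complex"
  assumes B: "\<And>z. norm (f z) \<le> B"
  shows "\<exists>B'. \<forall>x. norm (smolyak n f x) \<le> B'"
proof (intro exI allI)
  fix x :: "real ^ 'n"
  show "norm (smolyak n f x) \<le> (\<Sum>k\<in>{k :: nat ^ 'n. level k < n}. \<Sum>l\<in>below k. \<bar>\<Prod>i\<in>UNIV. diff_coeff (k $ i) (l $ i)\<bar> * B)"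
    unfolding smolyak_def mixed_diff_def
    by (intro sum_norm_le) (simp only: norm_mult norm_of_real, intro mult_left_mono B abs_ge_zero)
qed

lemma bounded_measurable_in_Lp_space_cube:
  fixes f :: "real ^ 'n \<Rightarrow> complex"
  assumes f: "f \<in> borel_measurable borel" and B: "\<And>x. norm (f x) \<le> B" and p: "1 \<le> p"
  shows "f \<in> Lp_space p cube_measure"
proof -
  have B0: "0 \<le> B" using B[of 0] norm_ge_zero order_trans by blast
  have "(\<integral>\<^sup>+x. ennreal (norm (f x) powr p) \<partial>cube_measure) \<le> (\<integral>\<^sup>+x. ennreal (B powr p) \<partial>(cube_measure :: (real ^ 'n) measure))"
    using p B by (intro nn_integral_mono ennreal_leI powr_mono2) auto
  also have "\<dots> = ennreal (B powr p) * emeasure (lborel :: (real ^ 'n) measure) cube"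
    by (subst nn_integral_restrict_space) (auto intro: nn_integral_cmult_indicator)
  also have "emeasure (lborel :: (real ^ 'n) measure) cube = 1"
    by (subst emeasure_lborel_cbox) (auto simp: Basis_vec_real prod.reindex[OF inj_axis_one] inner_axis)
  finally have "Lp_norm p cube_measure f \<le> ennreal B"
    using p B0 by (subst Lp_norm_le_iff) auto
  then have "Lp_norm p cube_measure f < \<infinity>" by (rule le_less_trans) simp
  then show ?thesis using f by (simp add: Lp_space_def measurable_restrict_space1)
qed

text \<open>A sampling set must have exactly \<open>m\<close> distinct points, so the grid is padded
  by further points of the cube, whose values the algorithm ignores.\<close>

lemma cube_grid_superset:
  assumes "card (grid n :: (real ^ 'n) set) \<le> m"
  shows "\<exists>xs. length xs = m \<and> distinct xs \<and> set xs \<subseteq> (cube :: (real ^ 'n) set) \<and> grid n \<subseteq> set xs"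
proof -
  have inf: "infinite (cube :: (real ^ 'n) set)"
  proof -
    have "inj_on (\<lambda>t. \<chi> i::'n. t) {0..1::real}" by (auto simp: inj_on_def vec_eq_iff)
    then have "infinite ((\<lambda>t. \<chi> i::'n. t) ` {0..1::real})"
      using finite_imageD infinite_Icc[of 0 "1::real"] by fastforce
    moreover have "(\<lambda>t. \<chi> i::'n. t) ` {0..1::real} \<subseteq> cube" by (auto simp: mem_box_cart)
    ultimately show ?thesis using infinite_super by blast
  qed
  then have inf': "infinite ((cube :: (real ^ 'n) set) - grid n)" by (rule Diff_infinite_finite[OF finite_grid])
  obtain Y :: "(real ^ 'n) set" where Y: "finite Y" "card Y = m - card (grid n :: (real ^ 'n) set)" "Y \<subseteq> cube - grid n"
    using infinite_arbitrarily_large[OF inf', of "m - card (grid n :: (real ^ 'n) set)"] by blast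
  have "card (grid n \<union> Y) = m"
    using Y assms finite_grid by (subst card_Un_disjoint) auto
  moreover have "finite (grid n \<union> Y)" using Y(1) finite_grid by simp
  then obtain xs where xs: "set xs = grid n \<union> Y" "distinct xs"
    using finite_distinct_list by blast
  ultimately have "length xs = m" using distinct_card[OF xs(2)] by simp
  moreover have "set xs \<subseteq> cube" using xs(1) Y(3) grid_subset_cube[of n] by blast
  ultimately show ?thesis using xs by (intro exI[of _ xs]) simp
qed

text \<open>Turns a list of values into a function on the whole space, zero off the nodes, to which
  \<open>smolyak\<close> applies. Values at repeated nodes would add up, hence the distinctness in
  \<open>point_interp_map\<close>.\<close>

definition point_interp :: "(real ^ 'n) list \<Rightarrow> complex list \<Rightarrow> real ^ 'n \<Rightarrow> complex" where
  "point_interp xs v z = (\<Sum>i<length xs. v ! i * indicator {xs ! i} z)"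

lemma point_interp_measurable: "point_interp xs v \<in> borel_measurable borel"
  unfolding point_interp_def[abs_def] by measurable

lemma point_interp_bounded: "norm (point_interp xs v z) \<le> (\<Sum>i<length xs. norm (v ! i))"
  unfolding point_interp_def by (intro sum_norm_le) (auto simp: norm_mult indicator_def)

lemma point_interp_map:
  assumes "distinct xs" "z \<in> set xs"
  shows "point_interp xs (map f xs) z = f z"
proof -
  obtain i where i: "i < length xs" "z = xs ! i" using assms(2) by (auto simp: in_set_conv_nth)
  have "point_interp xs (map f xs) z = (\<Sum>i'<length xs. if i' = i then f (xs ! i) else 0)"
    unfolding point_interp_def
    by (intro sum.cong refl) (use i assms(1) in \<open>auto simp: nth_eq_iff_index_eq\<close>)
  then show ?thesis using i by simp
qed

context dyadic
begin

text \<open>Two limits by Fatou. The first, over boxes of blocks, bounds each mixed difference by a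
  multiple of \<open>2 powr (- real (level k) / p)\<close>: the factors
  \<open>2 powr (real (level j) / p)\<close> are the Besov weights, and for q = 1 the weighted sum
  is the norm of \<open>g\<close>. The second, over boxes of differences, presents the error as a
  limit of sums over levels at least \<open>n\<close>.\<close>

lemma smolyak_error:
  fixes f g :: "real ^ 'n \<Rightarrow> complex"
  assumes p: "1 \<le> p" and f: "continuous_on cube f"
    and g: "g \<in> besov_extensions \<phi> (1 / p) p 1 f" and g2: "besov_norm \<phi> (1 / p) p 1 g \<le> 2"
    and T: "\<And>F. finite F \<Longrightarrow> \<forall>k\<in>F. n \<le> level k \<Longrightarrow> (\<Sum>k\<in>(F :: (nat ^ 'n) set). 2 powr (- real (level k) / p)) \<le> T"
  shows "Lp_norm p cube_measure (\<lambda>x. f x - smolyak n f x)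
    \<le> ennreal ((2 * kern_mass) ^ CARD('n) * (16 * pi) ^ CARD('n) * 2 * T)"
proof -
  define D where "D = (2 * kern_mass) ^ CARD('n) * (16 * pi) ^ CARD('n)"
  have D: "0 < D" unfolding D_def using kern_mass_ge_1 by simp
  have gi: "integrable lborel g" and fg: "AE x in cube_measure. g x = f x"
    using g by (auto simp: besov_extensions_def besov_def)
  let ?G = "fourier_block \<phi> g"
  note [measurable] = fourier_block_measurable[OF gi]
  define w where "w = (\<lambda>j :: nat ^ 'n. 2 powr (real (level j) / p))"
  have w: "0 < w j" for j by (simp add: w_def)
  have norm_eq: "besov_norm \<phi> (1 / p) p 1 g = (\<Sum>\<^sub>\<infinity>j\<in>UNIV. ennreal (w j) * Lp_norm p lborel (?G j))"
    by (simp add: besov_norm_def w_def)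
  have sum_le: "(\<Sum>j\<in>F. ennreal (w j) * Lp_norm p lborel (?G j)) \<le> 2" if "finite F" for F
    using ennreal_sum_le_infsum[OF that, of "\<lambda>j. ennreal (w j) * Lp_norm p lborel (?G j)"] g2
    unfolding norm_eq by (rule order_trans)
  have fin: "Lp_norm p lborel (?G j) < \<infinity>" for j
  proof -
    have "ennreal (w j) * Lp_norm p lborel (?G j) \<le> 2" using sum_le[of "{j}"] by simp
    then show ?thesis using w[of j]
      by (cases "Lp_norm p lborel (?G j)") (auto simp: ennreal_mult_top top_unique)
  qed
  define c where "c = (\<lambda>j. enn2real (Lp_norm p lborel (?G j)))"
  have c: "Lp_norm p lborel (?G j) = ennreal (c j)" "0 \<le> c j" for j
    using fin[of j] by (auto simp: c_def)
  have csum: "(\<Sum>j\<in>F. w j * c j) \<le> 2" if "finite F" for F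
  proof -
    have "ennreal (\<Sum>j\<in>F. w j * c j) \<le> ennreal 2"
      using sum_le[OF that] w c(2) by (simp add: c(1) ennreal_mult'[symmetric] sum_ennreal less_imp_le)
    then show ?thesis by (subst (asm) ennreal_le_iff) auto
  qed
  \<comment> \<open>Off the cube \<open>f\<close> is arbitrary; cutting it off gives a measurable
    function with the same samples and the same values on the cube.\<close>
  define f1 where "f1 = (\<lambda>y. indicator cube y * f y)"
  have [measurable]: "f1 \<in> borel_measurable borel"
    unfolding f1_def by (rule borel_measurable_cube_restriction[OF f])
  have f1: "f1 y = f y" if "y \<in> cube" for y using that by (simp add: f1_def)
  have meas: "u \<in> borel_measurable cube_measure" if "u \<in> borel_measurable borel" for u :: "real ^ 'n \<Rightarrow> complex"
    using that by (simp add: measurable_restrict_space1)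
  define S where "S = (\<lambda>N x. \<Sum>j\<in>box_index N. ?G j x)"
  have [measurable]: "S N \<in> borel_measurable borel" for N unfolding S_def by measurable
  have S: "(\<lambda>N. S N x) \<longlonglongrightarrow> f1 x" if "x \<in> cube" for x
    unfolding S_def f1[OF that]
  proof (rule fourier_block_partial_sums_tendsto[OF f gi fg _ _ that])
    show "norm (?G j x) \<le> kern_mass ^ CARD('n) * (w j * c j)" for j x
      using fourier_block_Nikolskii[OF gi p c] by (simp add: w_def mult.assoc)
    show "(\<Sum>j\<in>box_index N. kern_mass ^ CARD('n) * (w j * c j)) \<le> kern_mass ^ CARD('n) * 2" for N
      unfolding sum_distrib_left[symmetric] using kern_mass_ge_1 csum by (intro mult_left_mono) auto
  qed
  have diff_le: "Lp_norm p cube_measure (mixed_diff f1 k) \<le> ennreal (D * 2 * 2 powr (- real (level k) / p))" for k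
  proof (rule Lp_norm_lim_le[where u = "\<lambda>N. mixed_diff (S N) k"])
    show "mixed_diff (S N) k \<in> borel_measurable cube_measure" for N
      by (intro meas mixed_diff_measurable) measurable
    show "(\<lambda>N. mixed_diff (S N) k x) \<longlonglongrightarrow> mixed_diff f1 k x" if "x \<in> space cube_measure" for x
      using that by (intro mixed_diff_tendsto S grid_proj_in_cube) (simp add: space_restrict_space)
    show "Lp_norm p cube_measure (mixed_diff (S N) k) \<le> ennreal (D * 2 * 2 powr (- real (level k) / p))" for N
    proof -
      have "mixed_diff (S N) k = (\<lambda>x. \<Sum>j\<in>box_index N. mixed_diff (?G j) k x)"
        unfolding S_def by (intro ext mixed_diff_sum)
      then have "Lp_norm p cube_measure (mixed_diff (S N) k) = Lp_norm p cube_measure (\<lambda>x. \<Sum>j\<in>box_index N. mixed_diff (?G j) k x)"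
        by simp
      also have "\<dots> \<le> ennreal (\<Sum>j\<in>box_index N. D * 2 powr (- real (level k) / p) * (w j * c j))"
      proof (rule Lp_norm_sum_le)
        show "Lp_norm p cube_measure (mixed_diff (?G j) k) \<le> ennreal (D * 2 powr (- real (level k) / p) * (w j * c j))" for j
          using Lp_norm_mixed_diff_block_le[OF gi p c] by (simp add: D_def w_def)
        show "mixed_diff (?G j) k \<in> borel_measurable cube_measure" for j
          by (intro meas mixed_diff_measurable) measurable
      qed (use p D w c(2) in \<open>auto simp: less_imp_le\<close>)
      also have "\<dots> \<le> ennreal (D * 2 * 2 powr (- real (level k) / p))"
      proof (intro ennreal_leI)
        have "(\<Sum>j\<in>box_index N. D * 2 powr (- real (level k) / p) * (w j * c j)) = D * 2 powr (- real (level k) / p) * (\<Sum>j\<in>box_index N. w j * c j)"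
          by (simp only: sum_distrib_left)
        also have "\<dots> \<le> D * 2 powr (- real (level k) / p) * 2"
          using D by (intro mult_left_mono csum) auto
        finally show "(\<Sum>j\<in>box_index N. D * 2 powr (- real (level k) / p) * (w j * c j)) \<le> D * 2 * 2 powr (- real (level k) / p)"
          by (simp only: mult_ac)
      qed
      finally show ?thesis .
    qed
  qed (use p D in auto)
  have T0: "0 \<le> T" using T[of "{}"] by simp
  have "Lp_norm p cube_measure (\<lambda>x. f1 x - smolyak n f1 x) \<le> ennreal (D * 2 * T)"
  proof (rule Lp_norm_lim_le[where u = "\<lambda>N x. \<Sum>k\<in>box_index N - {k. level k < n}. mixed_diff f1 k x"])
    show "(\<lambda>x. \<Sum>k\<in>box_index N - {k. level k < n}. mixed_diff f1 k x) \<in> borel_measurable cube_measure" for N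
      by (intro meas borel_measurable_sum mixed_diff_measurable) measurable
    show "Lp_norm p cube_measure (\<lambda>x. \<Sum>k\<in>box_index N - {k. level k < n}. mixed_diff f1 k x) \<le> ennreal (D * 2 * T)" for N
    proof -
      have "Lp_norm p cube_measure (\<lambda>x. \<Sum>k\<in>box_index N - {k. level k < n}. mixed_diff f1 k x) \<le>
        ennreal (\<Sum>k\<in>box_index N - {k :: nat ^ 'n. level k < n}. D * 2 * 2 powr (- real (level k) / p))"
        by (rule Lp_norm_sum_le) (use p D diff_le in \<open>auto intro!: meas mixed_diff_measurable\<close>)
      also have "\<dots> \<le> ennreal (D * 2 * T)"
        unfolding sum_distrib_left[symmetric] using D by (intro ennreal_leI mult_left_mono T) auto
      finally show ?thesis .
    qed
    fix x :: "real ^ 'n" assume "x \<in> space cube_measure"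
    then have x: "x \<in> cube" by (simp add: space_restrict_space)
    have "(\<lambda>N. f (grid_proj (\<chi> i. N) x)) \<longlonglongrightarrow> f x"
      by (rule continuous_on_tendsto_compose[OF f grid_proj_box_tendsto x]) (simp add: grid_proj_in_cube x)
    then have lim: "(\<lambda>N. f1 (grid_proj (\<chi> i. N) x) - smolyak n f1 x) \<longlonglongrightarrow> f1 x - smolyak n f1 x"
      using x by (intro tendsto_diff tendsto_const) (simp add: f1 grid_proj_in_cube)
    have "f1 (grid_proj (\<chi> i. N) x) - smolyak n f1 x = (\<Sum>k\<in>box_index N - {k. level k < n}. mixed_diff f1 k x)" if N: "n \<le> N" for N
    proof -
      \<comment> \<open>Every index vector of level below \<open>n\<close> has all entries below
        \<open>n\<close>, so large boxes contain the whole Smolyak index set.\<close>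
      have "{k :: nat ^ 'n. level k < n} \<subseteq> box_index N"
      proof
        fix k :: "nat ^ 'n" assume "k \<in> {k. level k < n}"
        then have "level k \<le> N" using N by simp
        moreover have "k $ i \<le> level k" for i by (rule member_le_sum) auto
        ultimately show "k \<in> box_index N" unfolding below_def using order_trans by fastforce
      qed
      then show ?thesis
        unfolding smolyak_def sum_mixed_diff_box[symmetric] by (rule sum_diff[OF finite_below, symmetric])
    qed
    then have "\<forall>\<^sub>F N in sequentially. f1 (grid_proj (\<chi> i. N) x) - smolyak n f1 x = (\<Sum>k\<in>box_index N - {k. level k < n}. mixed_diff f1 k x)"
      using eventually_ge_at_top[of n] by (rule eventually_mono[rotated])
    then show "(\<lambda>N. \<Sum>k\<in>box_index N - {k. level k < n}. mixed_diff f1 k x) \<longlonglongrightarrow> f1 x - smolyak n f1 x"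
      using lim by (rule Lim_transform_eventually[rotated])
  qed (use p D T0 in auto)
  also have "Lp_norm p cube_measure (\<lambda>x. f1 x - smolyak n f1 x) = Lp_norm p cube_measure (\<lambda>x. f x - smolyak n f x)"
  proof (rule Lp_norm_cube_cong)
    fix x :: "real ^ 'n" assume x: "x \<in> cube"
    have "smolyak n f1 x = smolyak n f x"
      using grid_subset_cube by (intro smolyak_cong[OF x] f1) blast
    then show "f1 x - smolyak n f1 x = f x - smolyak n f x" using f1[OF x] by simp
  qed
  finally show ?thesis by (simp add: D_def)
qed

lemma sampling_width_le:
  assumes p: "1 \<le> p" and card: "card (grid n :: (real ^ 'n) set) \<le> m"
    and T: "\<And>F. finite F \<Longrightarrow> \<forall>k\<in>F. n \<le> level k \<Longrightarrow> (\<Sum>k\<in>(F :: (nat ^ 'n) set). 2 powr (- real (level k) / p)) \<le> T"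
  shows "sampling_width m
      (besov_cube_cont \<phi> (1 / p) p 1 :: (real ^ 'n \<Rightarrow> complex) set) (besov_cube_norm \<phi> (1 / p) p 1) p
    \<le> ennreal ((2 * kern_mass) ^ CARD('n) * (16 * pi) ^ CARD('n) * 2 * T)"
proof -
  obtain xs :: "(real ^ 'n) list" where xs: "length xs = m" "distinct xs" "set xs \<subseteq> cube" "grid n \<subseteq> set xs"
    using cube_grid_superset[OF card] by blast
  define \<psi> where "\<psi> = (\<lambda>v. smolyak n (point_interp xs v))"
  have \<psi>: "\<psi> v \<in> Lp_space p cube_measure" for v
  proof -
    obtain B' where "\<And>x. norm (\<psi> v x) \<le> B'"
      unfolding \<psi>_def using smolyak_bounded[of "point_interp xs v", OF point_interp_bounded] by blast
    moreover have "\<psi> v \<in> borel_measurable borel"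
      unfolding \<psi>_def by (intro smolyak_measurable point_interp_measurable)
    ultimately show ?thesis using bounded_measurable_in_Lp_space_cube[OF _ _ p] by blast
  qed
  have err: "Lp_norm p cube_measure (\<lambda>x. f x - \<psi> (map f xs) x) \<le> ennreal ((2 * kern_mass) ^ CARD('n) * (16 * pi) ^ CARD('n) * 2 * T)"
    if f: "f \<in> besov_cube_cont \<phi> (1 / p) p 1" "besov_cube_norm \<phi> (1 / p) p 1 f \<le> 1" for f :: "real ^ 'n \<Rightarrow> complex"
  proof -
    \<comment> \<open>The norm on the cube is an infimum that need not be attained; the slack
      between 1 and 2 provides an extension.\<close>
    have "besov_cube_norm \<phi> (1 / p) p 1 f < 2" using f(2) by (rule le_less_trans) simp
    then obtain g where g: "g \<in> besov_extensions \<phi> (1 / p) p 1 f" "besov_norm \<phi> (1 / p) p 1 g < 2"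
      unfolding besov_cube_norm_def by (auto simp: INF_less_iff)
    have cont: "continuous_on cube f" using f(1) by (simp add: besov_cube_cont_def)
    have "Lp_norm p cube_measure (\<lambda>x. f x - \<psi> (map f xs) x) = Lp_norm p cube_measure (\<lambda>x. f x - smolyak n f x)"
    proof (rule Lp_norm_cube_cong)
      fix x :: "real ^ 'n" assume x: "x \<in> cube"
      have "smolyak n (point_interp xs (map f xs)) x = smolyak n f x"
        using xs by (intro smolyak_cong[OF x] point_interp_map) auto
      then show "f x - \<psi> (map f xs) x = f x - smolyak n f x" by (simp add: \<psi>_def)
    qed
    also have "\<dots> \<le> ennreal ((2 * kern_mass) ^ CARD('n) * (16 * pi) ^ CARD('n) * 2 * T)"
      by (rule smolyak_error[OF p cont g(1) less_imp_le[OF g(2)] T])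
    finally show ?thesis .
  qed
  show ?thesis
    unfolding sampling_width_def
    by (rule INF_lower2[of xs], (use xs in auto)[1], rule INF_lower2[of \<psi>], (use \<psi> in auto)[1], rule SUP_least)
      (use err in auto)
qed

end

theorem theorem6p4:
  fixes \<phi> :: "nat \<Rightarrow> real \<Rightarrow> complex" and p :: real
  assumes "dyadic_resolution \<phi>" and "1 \<le> p"
  shows "\<exists>C::real. C > 0 \<and> (\<forall>m::nat. m \<ge> 2 \<longrightarrow>
    sampling_width m
      (besov_cube_cont \<phi> (1 / p) p 1 :: (real ^ 'n \<Rightarrow> complex) set)
      (besov_cube_norm \<phi> (1 / p) p 1) p
    \<le> ennreal (C * real m powr (- (1 / p)) * (ln (real m) ^ (CARD('n) - 1)) powr (1 / p + 1)))"
proof -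
  interpret dyadic \<phi> by standard (rule assms(1))
  define d where "d = CARD('n) - 1"
  define K where "K = (2::real) ^ CARD('n)"
  have K: "1 \<le> K" by (simp add: K_def)
  obtain C0 where C0: "0 < C0" and tail: "\<And>n (F :: (nat ^ 'n) set). finite F \<Longrightarrow> \<forall>k\<in>F. n \<le> level k \<Longrightarrow>
    (\<Sum>k\<in>F. 2 powr (- real (level k) / p)) \<le> C0 * real (n + 1) ^ d * 2 powr (- real n / p)"
    using level_tail_bound[OF assms(2), where 'n = 'n] unfolding d_def by blast
  define D where "D = (2 * kern_mass) ^ CARD('n) * (16 * pi) ^ CARD('n) * 2"
  have D: "0 < D" unfolding D_def using kern_mass_ge_1 by simp
  \<comment> \<open>\<open>b\<close> turns \<open>ln m\<close> into twice the binary logarithm,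
    which dominates \<open>log 2 m + 1\<close> for \<open>m \<ge> 2\<close>.\<close>
  define b where "b = 2 / ln (2::real)"
  have b: "0 < b" by (simp add: b_def)
  define C where "C = D * C0 * (2 * K) powr (1 / p) * (b ^ d) powr (1 / p + 1)"
  have "0 < C" unfolding C_def using D C0 K b by simp
  moreover have "sampling_width m (besov_cube_cont \<phi> (1 / p) p 1 :: (real ^ 'n \<Rightarrow> complex) set) (besov_cube_norm \<phi> (1 / p) p 1) p
    \<le> ennreal (C * real m powr (- (1 / p)) * (ln (real m) ^ d) powr (1 / p + 1))" if m: "2 \<le> m" for m
  proof -
    define a where "a = log 2 (real m)"
    have a: "1 \<le> a" unfolding a_def using m by (simp add: le_log_iff)
    \<comment> \<open>What \<open>m\<close> leaves for \<open>2 ^ n\<close> once the factor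
      \<open>K * (n + 1) ^ d\<close> of the node count has been bounded through
      \<open>n \<le> a\<close>.\<close>
    define Q where "Q = real m / (K * (a + 1) ^ d)"
    have den: "1 \<le> K * (a + 1) ^ d"
      using K a mult_mono[of 1 K 1 "(a + 1) ^ d"] by (simp add: one_le_power)
    have Q: "0 < Q" unfolding Q_def using m den by (intro divide_pos_pos) auto
    \<comment> \<open>The largest \<open>n\<close> with \<open>2 ^ n \<le> Q\<close>. If there is
      none, \<open>n = 0\<close> selects the algorithm without nodes, and
      \<open>Q / 2 \<le> 2 ^ n\<close> still holds.\<close>
    define n where "n = (if 1 \<le> Q then nat \<lfloor>log 2 Q\<rfloor> else 0)"
    have nQ: "Q / 2 \<le> 2 ^ n" and na: "real n \<le> a" and nK: "K * real (n + 1) ^ d * 2 ^ n \<le> real m \<or> n = 0"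
    proof -
      show "Q / 2 \<le> 2 ^ n"
      proof (cases "1 \<le> Q")
        case True
        have "log 2 Q < real n + 1" using True by (simp add: n_def)
        then have "Q < 2 powr (real n + 1)" using Q by (simp add: log_less_iff)
        then show ?thesis by (simp add: powr_add powr_realpow)
      qed (simp add: n_def)
      have nlog: "real n \<le> log 2 Q" if "1 \<le> Q" using that by (simp add: n_def)
      have "Q \<le> real m" unfolding Q_def using den m by (simp add: divide_le_eq mult_left_le_one_le mult_le_cancel_left1)
      then have "log 2 Q \<le> a" unfolding a_def using Q by (intro log_mono) auto
      then show na: "real n \<le> a" using order_trans[OF nlog] a by (cases "1 \<le> Q") (simp, simp add: n_def)
      show "K * real (n + 1) ^ d * 2 ^ n \<le> real m \<or> n = 0"
      proof (cases "1 \<le> Q")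
        case True
        have "2 powr real n \<le> Q" using nlog[OF True] Q by (simp add: le_log_iff)
        then have "2 ^ n \<le> Q" by (simp add: powr_realpow)
        then have "K * real (n + 1) ^ d * 2 ^ n \<le> K * (a + 1) ^ d * Q"
          using K na a by (intro mult_mono mult_left_mono power_mono) auto
        also have "\<dots> = real m" unfolding Q_def using den a K by simp
        finally show ?thesis by simp
      qed (simp add: n_def)
    qed
    have "card (grid n :: (real ^ 'n) set) \<le> m"
    proof (cases "n = 0")
      case True
      then show ?thesis by (simp add: grid_def)
    next
      case False
      then have "real (card (grid n :: (real ^ 'n) set)) \<le> real m"
        using nK card_grid[of n, where 'n = 'n] unfolding K_def d_def by simp
      then show ?thesis by simp
    qed
    from sampling_width_le[OF assms(2) this tail]
    have "sampling_width m (besov_cube_cont \<phi> (1 / p) p 1 :: (real ^ 'n \<Rightarrow> complex) set) (besov_cube_norm \<phi> (1 / p) p 1) p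
      \<le> ennreal (D * (C0 * real (n + 1) ^ d * 2 powr (- real n / p)))"
      by (simp add: D_def)
    also have "\<dots> \<le> ennreal (C * real m powr (- (1 / p)) * (ln (real m) ^ d) powr (1 / p + 1))"
    proof (rule ennreal_leI)
      define L where "L = b * ln (real m)"
      have "L = 2 * a" by (simp add: L_def b_def a_def log_def)
      then have aL: "a + 1 \<le> L" using a by simp
      have L: "0 < L" using aL a by simp
      have "2 powr (- real n / p) = (2 ^ n) powr (- (1 / p))"
        by (simp add: powr_powr flip: powr_realpow)
      \<comment> \<open>The exponent is negative, so the lower bound on \<open>2 ^ n\<close> becomes
        an upper bound; the denominator of \<open>Q\<close> yields the logarithmic factor with
        exponent \<open>1 / p\<close>.\<close>
      also have "\<dots> \<le> (Q / 2) powr (- (1 / p))"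
        using nQ Q assms(2) by (intro powr_mono2') auto
      also have "\<dots> = (2 * K) powr (1 / p) * ((a + 1) ^ d) powr (1 / p) * real m powr (- (1 / p))"
        unfolding Q_def using K a m by (simp add: powr_minus powr_divide powr_mult field_simps)
      also have "\<dots> \<le> (2 * K) powr (1 / p) * (L ^ d) powr (1 / p) * real m powr (- (1 / p))"
        using aL a assms(2) by (intro mult_right_mono mult_left_mono powr_mono2 power_mono) auto
      finally have "2 powr (- real n / p) \<le> (2 * K) powr (1 / p) * (L ^ d) powr (1 / p) * real m powr (- (1 / p))" .
      \<comment> \<open>The number of index vectors per level contributes a full power of
        \<open>L ^ d\<close>, so that the exponents add up to \<open>1 / p + 1\<close>.\<close>
      moreover have "real (n + 1) ^ d \<le> L ^ d" using na aL by (intro power_mono) auto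
      ultimately have "real (n + 1) ^ d * 2 powr (- real n / p) \<le> L ^ d * ((2 * K) powr (1 / p) * (L ^ d) powr (1 / p) * real m powr (- (1 / p)))"
        using L by (intro mult_mono) auto
      also have "\<dots> = (2 * K) powr (1 / p) * real m powr (- (1 / p)) * (L ^ d) powr (1 / p + 1)"
        using L by (simp add: powr_add)
      also have "(L ^ d) powr (1 / p + 1) = (b ^ d) powr (1 / p + 1) * (ln (real m) ^ d) powr (1 / p + 1)"
        using b m by (simp add: L_def power_mult_distrib powr_mult)
      finally have "D * C0 * (real (n + 1) ^ d * 2 powr (- real n / p)) \<le>
         D * C0 * ((2 * K) powr (1 / p) * real m powr (- (1 / p)) * ((b ^ d) powr (1 / p + 1) * (ln (real m) ^ d) powr (1 / p + 1)))"
        using D C0 by (intro mult_left_mono) auto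
      then show "D * (C0 * real (n + 1) ^ d * 2 powr (- real n / p)) \<le> C * real m powr (- (1 / p)) * (ln (real m) ^ d) powr (1 / p + 1)"
        unfolding C_def by (simp only: mult_ac)
    qed
    finally show ?thesis .
  qed
  ultimately show ?thesis unfolding d_def by blast
qed

end
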